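(* Let $M$ and $N$ be smooth, connected, paracompact Hausdorff manifolds. (i) Let $u\in\mathcal G(M)$. Then $u=0$ in $\mathcal G(M)$ if and only if $u(\tilde x)=0$ in $\widetilde{\mathbb R}$ for all near-standard points $\tilde x\in\widetilde M_c$. (ii) Let $u,v\in\mathcal G[M,N]$. Then $u=v$ in $\mathcal G[M,N]$ if and only if $u(\tilde x)=v(\tilde x)$ in $\widetilde N_c$ for all near-standard points $\tilde x\in\widetilde M_c$.
   Context: Let $I=(0,1]$; $K\subset\subset M$ means $K$ is a compact subset of $M$; $O(\cdot)$-estimates are for $\varepsilon\to0$. $\mathcal E_M(M)$ is the set of nets $(u_\varepsilon)_{\varepsilon\in I}\in C^\infty(M)^I$ such that for all $K\subset\subset M$ and all linear differential operators $P$ on $M$ there is $p\in\mathbb N$ with $\sup_K|Pu_\varepsilon|=O(\varepsilon^{-p})$. $\mathcal N(M)$ is the set of $(u_\varepsilon)_\varepsilon\in\mathcal E_M(M)$ with $\sup_K|u_\varepsilon|=O(\varepsilon^{k})$ for all $K\subset\subset M$, $k\in\mathbb N$. $\mathcal G(M):=\mathcal E_M(M)/\mathcal N(M)$. Generalized numbers: $\widetilde{\mathbb R}$ is the set of nets $(r_\varepsilon)\in\mathbb R^I$ with $|r_\varepsilon|=O(\varepsilon^{-p})$ for some $p$, modulo nets with $|r_\varepsilon|=O(\varepsilon^k)$ for all $k$. $\widetilde M_c$ (compactly supported generalized points) is the set of nets $(x_\varepsilon)\in M^I$ that stay in some compact subset of $M$ for small $\varepsilon$, modulo $(x_\varepsilon)\sim(y_\varepsilon)$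 iff $d_h(x_\varepsilon,y_\varepsilon)=O(\varepsilon^k)$ for all $k$, where $d_h$ is the distance induced by one (hence any) Riemannian metric $h$ on $M$. A net $(u_\varepsilon)\in C^\infty(M,N)^I$ is c-bounded if for every $K\subset\subset M$ there are $\varepsilon_0>0$ and $K'\subset\subset N$ with $u_\varepsilon(K)\subseteq K'$ for all $\varepsilon<\varepsilon_0$. $\mathcal E_M[M,N]$ is the set of c-bounded nets with $(f\circ u_\varepsilon)_\varepsilon\in\mathcal E_M(M)$ for all $f\in C^\infty(N)$; $(u_\varepsilon)\sim(v_\varepsilon)$ iff $(f\circ u_\varepsilon-f\circ v_\varepsilon)_\varepsilon\in\mathcal N(M)$ for all $f\in C^\infty(N)$; $\mathcal G[M,N]:=\mathcal E_M[M,N]/\sim$. Point values: $u(\tilde x):=[(u_\varepsilon(x_\varepsilon))_\varepsilon]$, a well-defined element of $\widetilde{\mathbb R}$ if $u\in\mathcal G(M)$ and of $\widetilde N_c$ if $u\in\mathcal G[M,N]$. A point $\tilde x\in\widetilde M_c$ is near-standard if there is $x\in M$ such that $x_\varepsilon\to x$ as $\varepsilon\to0$ for every representative $(x_\varepsilon)_\varepsilon$ of $\tilde x$. *)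

theory Defs
  imports "HOL-Analysis.Analysis" "HOL-Library.Landau_Symbols"
begin

section \<open>Smooth functions on open subsets of normed spaces\<close>

text \<open>All the sets \<open>S\<close> below are open.  In finite dimension this is the usual notion of \<open>C\<^sup>k\<close>:
  continuity of every directional derivative of a differentiable function is continuity of the
  derivative.\<close>

primrec Ck_on :: "nat \<Rightarrow> 'a::real_normed_vector set \<Rightarrow> ('a \<Rightarrow> 'b::real_normed_vector) \<Rightarrow> bool" where
  "Ck_on 0 S f \<longleftrightarrow> continuous_on S f"
| "Ck_on (Suc k) S f \<longleftrightarrow> (\<forall>x\<in>S. f differentiable (at x)) \<and>
     (\<forall>v. Ck_on k S (\<lambda>x. frechet_derivative f (at x) v))"

definition smooth_on :: "'a::real_normed_vector set \<Rightarrow> ('a \<Rightarrow> 'b::real_normed_vector) \<Rightarrow> bool" where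
  "smooth_on S f \<longleftrightarrow> (\<forall>k. Ck_on k S f)"

primrec iterated_dderiv :: "'a::real_normed_vector list \<Rightarrow> ('a \<Rightarrow> real) \<Rightarrow> 'a \<Rightarrow> real" where
  "iterated_dderiv [] f = f"
| "iterated_dderiv (v # vs) f = iterated_dderiv vs (\<lambda>x. frechet_derivative f (at x) v)"


section \<open>Smooth manifolds\<close>

text \<open>A manifold is the whole of a type \<open>'m\<close>, with charts \<open>(U, \<phi>)\<close> in a finite-dimensional inner
  product space \<open>'e\<close>; values of \<open>\<phi>\<close> off \<open>U\<close> are irrelevant.  The class \<open>euclidean_space\<close> is not
  used for \<open>'e\<close> because it excludes dimension 0.  For inner product spaces the constraint
  \<open>heine_borel\<close> is equivalent to finite dimension and hence redundant in \<open>smooth_manifold\<close>.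
  The smooth structure is given by an arbitrary, not necessarily maximal, atlas; all notions
  below depend only on the maximal atlas that it generates.\<close>

type_synonym ('m, 'e) chart = "'m set \<times> ('m \<Rightarrow> 'e)"
type_synonym ('m, 'e) atlas = "('m, 'e) chart set"

abbreviation chart_inv :: "('m, 'e) chart \<Rightarrow> 'e \<Rightarrow> 'm" where
  "chart_inv c \<equiv> inv_into (fst c) (snd c)"

abbreviation chart_image :: "('m, 'e) chart \<Rightarrow> 'e set" where
  "chart_image c \<equiv> snd c ` fst c"

definition is_chart :: "('m::topological_space, 'e::real_normed_vector) chart \<Rightarrow> bool" where
  "is_chart c \<longleftrightarrow> open (fst c) \<and> open (chart_image c) \<and>
     homeomorphism (fst c) (chart_image c) (snd c) (chart_inv c)"

definition smooth_atlas :: "('m::topological_space, 'e::real_normed_vector) atlas \<Rightarrow> bool" where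
  "smooth_atlas A \<longleftrightarrow> (\<forall>c\<in>A. is_chart c) \<and> (\<Union>c\<in>A. fst c) = UNIV \<and>
     (\<forall>c\<in>A. \<forall>d\<in>A. smooth_on (snd c ` (fst c \<inter> fst d)) (snd d \<circ> chart_inv c))"

definition paracompact_space :: "'a topology \<Rightarrow> bool" where
  "paracompact_space X \<longleftrightarrow>
     (\<forall>\<U>. (\<forall>U\<in>\<U>. openin X U) \<and> \<Union>\<U> = topspace X \<longrightarrow>
        (\<exists>\<V>. (\<forall>V\<in>\<V>. openin X V) \<and> \<Union>\<V> = topspace X \<and>
             (\<forall>V\<in>\<V>. \<exists>U\<in>\<U>. V \<subseteq> U) \<and> locally_finite_in X \<V>))"

definition smooth_manifold :: "('m::t2_space, 'e::{real_inner, heine_borel}) atlas \<Rightarrow> bool" where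
  "smooth_manifold A \<longleftrightarrow> (\<exists>B::'e set. finite B \<and> span B = UNIV) \<and> smooth_atlas A \<and>
     connected (UNIV :: 'm set) \<and> paracompact_space (euclidean :: 'm topology)"

definition smooth_functions ::
    "('m::topological_space, 'e::real_normed_vector) atlas \<Rightarrow> ('m \<Rightarrow> real) set" where
  "smooth_functions A = {f. \<forall>c\<in>A. smooth_on (chart_image c) (f \<circ> chart_inv c)}"

definition smooth_maps ::
    "('m::topological_space, 'e::real_normed_vector) atlas \<Rightarrow>
     ('n::topological_space, 'f::real_normed_vector) atlas \<Rightarrow> ('m \<Rightarrow> 'n) set" where
  "smooth_maps A B = {f. continuous_on UNIV f \<and>
     (\<forall>c\<in>A. \<forall>d\<in>B. smooth_on (snd c ` (fst c \<inter> f -` fst d)) (snd d \<circ> f \<circ> chart_inv c))}"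

text \<open>Linear differential operators: in every chart they are of the form
  \<open>\<Sum>\<^bsub>|\<alpha>| \<le> m\<^esub> a\<^bsub>\<alpha>\<^esub> \<partial>\<^sup>\<alpha>\<close> with smooth coefficients, where \<open>B\<close> is a basis of the model space and \<open>\<alpha>\<close>
  ranges over words of length at most \<open>m\<close> in \<open>B\<close> (partial derivatives commute, so that words may
  replace multi-indices).\<close>

definition linear_diff_op ::
    "('m::topological_space, 'e::real_normed_vector) atlas \<Rightarrow>
     (('m \<Rightarrow> real) \<Rightarrow> ('m \<Rightarrow> real)) \<Rightarrow> bool" where
  "linear_diff_op A P \<longleftrightarrow>
     (\<exists>(B::'e set) (m::nat) (a :: ('m, 'e) chart \<Rightarrow> 'e list \<Rightarrow> 'e \<Rightarrow> real).
        finite B \<and> independent B \<and> span B = UNIV \<and>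
        (\<forall>c\<in>A. \<forall>\<alpha>. smooth_on (chart_image c) (a c \<alpha>)) \<and>
        (\<forall>f\<in>smooth_functions A. \<forall>c\<in>A. \<forall>y\<in>chart_image c.
           P f (chart_inv c y) =
             (\<Sum>\<alpha> | set \<alpha> \<subseteq> B \<and> length \<alpha> \<le> m. a c \<alpha> y * iterated_dderiv \<alpha> (f \<circ> chart_inv c) y)))"


section \<open>Riemannian metrics and the induced distance\<close>

text \<open>\<open>g c p v w\<close> is the metric at \<open>p\<close>, evaluated at the tangent vectors which have coordinates
  \<open>v\<close> and \<open>w\<close> in the chart \<open>c\<close>.\<close>

type_synonym ('m, 'e) metric_tensor = "('m, 'e) chart \<Rightarrow> 'm \<Rightarrow> 'e \<Rightarrow> 'e \<Rightarrow> real"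

definition riemannian_metric ::
    "('m::topological_space, 'e::real_normed_vector) atlas \<Rightarrow> ('m, 'e) metric_tensor \<Rightarrow> bool" where
  "riemannian_metric A g \<longleftrightarrow>
     (\<forall>c\<in>A. \<forall>p\<in>fst c. bilinear (g c p) \<and> (\<forall>v w. g c p v w = g c p w v) \<and>
                        (\<forall>v. v \<noteq> 0 \<longrightarrow> g c p v v > 0)) \<and>
     (\<forall>c\<in>A. \<forall>v w. smooth_on (chart_image c) (\<lambda>y. g c (chart_inv c y) v w)) \<and>
     (\<forall>c\<in>A. \<forall>d\<in>A. \<forall>p\<in>fst c \<inter> fst d. \<forall>v w.
        g c p v w = g d p (frechet_derivative (snd d \<circ> chart_inv c) (at (snd c p)) v)
                          (frechet_derivative (snd d \<circ> chart_inv c) (at (snd c p)) w))"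

definition C1_curve_on ::
    "('m::topological_space, 'e::real_normed_vector) atlas \<Rightarrow> (real \<Rightarrow> 'm) \<Rightarrow> real set \<Rightarrow> bool" where
  "C1_curve_on A \<gamma> S \<longleftrightarrow> continuous_on S \<gamma> \<and>
     (\<forall>c\<in>A. \<exists>D. (\<forall>t\<in>S \<inter> \<gamma> -` fst c. ((snd c \<circ> \<gamma>) has_vector_derivative D t) (at t within S)) \<and>
                 continuous_on (S \<inter> \<gamma> -` fst c) D)"

text \<open>The library's \<open>piecewise_C1_differentiable_on\<close> does not require one-sided derivatives at the
  break points, so a partition of \<open>[0,1]\<close> is used here.\<close>

definition piecewise_C1_curve ::
    "('m::topological_space, 'e::real_normed_vector) atlas \<Rightarrow> (real \<Rightarrow> 'm) \<Rightarrow> bool" where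
  "piecewise_C1_curve A \<gamma> \<longleftrightarrow>
     (\<exists>(n::nat) t. t 0 = 0 \<and> t n = 1 \<and> (\<forall>i<n. t i < t (Suc i) \<and> C1_curve_on A \<gamma> {t i..t (Suc i)}))"

text \<open>The speed at \<open>t\<close> does not depend on the chart around \<open>\<gamma> t\<close>.\<close>

definition curve_speed ::
    "('m::topological_space, 'e::real_normed_vector) atlas \<Rightarrow> ('m, 'e) metric_tensor \<Rightarrow>
     (real \<Rightarrow> 'm) \<Rightarrow> real \<Rightarrow> real" where
  "curve_speed A g \<gamma> t =
     (let c = (SOME c. c \<in> A \<and> \<gamma> t \<in> fst c);
          v = vector_derivative (snd c \<circ> \<gamma>) (at t)
      in sqrt (g c (\<gamma> t) v v))"

definition riemannian_dist ::
    "('m::topological_space, 'e::real_normed_vector) atlas \<Rightarrow> ('m, 'e) metric_tensor \<Rightarrow>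
     'm \<Rightarrow> 'm \<Rightarrow> real" where
  "riemannian_dist A g p q =
     Inf {integral {0..1} (curve_speed A g \<gamma>) | \<gamma>. piecewise_C1_curve A \<gamma> \<and> \<gamma> 0 = p \<and> \<gamma> 1 = q}"


section \<open>Nets, generalized functions and generalized points\<close>

text \<open>Nets indexed by \<open>I = (0,1]\<close> are functions on \<open>real\<close>, their values outside \<open>I\<close> being
  irrelevant: all equivalence relations below only see small positive \<open>\<epsilon>\<close>.\<close>

type_synonym 'a net = "real \<Rightarrow> 'a"

definition moderate_order :: "nat \<Rightarrow> real net \<Rightarrow> bool" where
  "moderate_order p r \<longleftrightarrow> r \<in> O[at_right 0](\<lambda>\<epsilon>. 1 / \<epsilon> ^ p)"

definition negligible_net :: "real net \<Rightarrow> bool" where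
  "negligible_net r \<longleftrightarrow> (\<forall>k::nat. r \<in> O[at_right 0](\<lambda>\<epsilon>. \<epsilon> ^ k))"

definition moderate_numbers :: "real net set" where
  "moderate_numbers = {r. \<exists>p. moderate_order p r}"

definition gen_number_rel :: "(real net \<times> real net) set" where
  "gen_number_rel = {(r, s). r \<in> moderate_numbers \<and> s \<in> moderate_numbers \<and>
     negligible_net (\<lambda>\<epsilon>. r \<epsilon> - s \<epsilon>)}"

definition gen_numbers :: "real net set set" where
  "gen_numbers = moderate_numbers // gen_number_rel"

definition gen_number_zero :: "real net set" where
  "gen_number_zero = gen_number_rel `` {\<lambda>\<epsilon>. 0}"

text \<open>The point \<open>0\<close> is inserted so that the supremum over the empty set is \<open>0\<close>.\<close>

definition sup_abs_on :: "'m set \<Rightarrow> ('m \<Rightarrow> real) \<Rightarrow> real" where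
  "sup_abs_on K f = Sup (insert 0 ((\<lambda>x. \<bar>f x\<bar>) ` K))"

definition moderate_functions ::
    "('m::topological_space, 'e::real_normed_vector) atlas \<Rightarrow> ('m \<Rightarrow> real) net set" where
  "moderate_functions A = {u. (\<forall>\<epsilon>\<in>{0<..1}. u \<epsilon> \<in> smooth_functions A) \<and>
     (\<forall>K P. compact K \<and> linear_diff_op A P \<longrightarrow>
        (\<exists>p. moderate_order p (\<lambda>\<epsilon>. sup_abs_on K (P (u \<epsilon>)))))}"

definition negligible_functions ::
    "('m::topological_space, 'e::real_normed_vector) atlas \<Rightarrow> ('m \<Rightarrow> real) net set" where
  "negligible_functions A = {u \<in> moderate_functions A.
     \<forall>K. compact K \<longrightarrow> negligible_net (\<lambda>\<epsilon>. sup_abs_on K (u \<epsilon>))}"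

definition gen_function_rel ::
    "('m::topological_space, 'e::real_normed_vector) atlas \<Rightarrow>
     (('m \<Rightarrow> real) net \<times> ('m \<Rightarrow> real) net) set" where
  "gen_function_rel A = {(u, v). u \<in> moderate_functions A \<and> v \<in> moderate_functions A \<and>
     (\<lambda>\<epsilon> x. u \<epsilon> x - v \<epsilon> x) \<in> negligible_functions A}"

definition gen_functions ::
    "('m::topological_space, 'e::real_normed_vector) atlas \<Rightarrow> ('m \<Rightarrow> real) net set set" where
  "gen_functions A = moderate_functions A // gen_function_rel A"

definition gen_function_zero ::
    "('m::topological_space, 'e::real_normed_vector) atlas \<Rightarrow> ('m \<Rightarrow> real) net set" where
  "gen_function_zero A = gen_function_rel A `` {\<lambda>\<epsilon> x. 0}"

definition compactly_supported_nets :: "'m::topological_space net set" where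
  "compactly_supported_nets = {x. \<exists>K. compact K \<and> (\<forall>\<^sub>F \<epsilon> in at_right 0. x \<epsilon> \<in> K)}"

definition gen_point_rel ::
    "('m::topological_space, 'e::real_normed_vector) atlas \<Rightarrow> ('m, 'e) metric_tensor \<Rightarrow>
     ('m net \<times> 'm net) set" where
  "gen_point_rel A g = {(x, y). x \<in> compactly_supported_nets \<and> y \<in> compactly_supported_nets \<and>
     negligible_net (\<lambda>\<epsilon>. riemannian_dist A g (x \<epsilon>) (y \<epsilon>))}"

definition gen_points ::
    "('m::topological_space, 'e::real_normed_vector) atlas \<Rightarrow> ('m, 'e) metric_tensor \<Rightarrow>
     'm net set set" where
  "gen_points A g = compactly_supported_nets // gen_point_rel A g"

definition near_standard :: "'m::topological_space net set \<Rightarrow> bool" where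
  "near_standard X \<longleftrightarrow> (\<exists>p. \<forall>x\<in>X. (x \<longlongrightarrow> p) (at_right 0))"

definition c_bounded :: "('m::topological_space \<Rightarrow> 'n::topological_space) net \<Rightarrow> bool" where
  "c_bounded u \<longleftrightarrow>
     (\<forall>K. compact K \<longrightarrow> (\<exists>K'. compact K' \<and> (\<forall>\<^sub>F \<epsilon> in at_right 0. u \<epsilon> ` K \<subseteq> K')))"

definition moderate_maps ::
    "('m::topological_space, 'e::real_normed_vector) atlas \<Rightarrow>
     ('n::topological_space, 'f::real_normed_vector) atlas \<Rightarrow> ('m \<Rightarrow> 'n) net set" where
  "moderate_maps A B = {u. (\<forall>\<epsilon>\<in>{0<..1}. u \<epsilon> \<in> smooth_maps A B) \<and> c_bounded u \<and>
     (\<forall>f\<in>smooth_functions B. (\<lambda>\<epsilon>. f \<circ> u \<epsilon>) \<in> moderate_functions A)}"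

definition gen_map_rel ::
    "('m::topological_space, 'e::real_normed_vector) atlas \<Rightarrow>
     ('n::topological_space, 'f::real_normed_vector) atlas \<Rightarrow>
     (('m \<Rightarrow> 'n) net \<times> ('m \<Rightarrow> 'n) net) set" where
  "gen_map_rel A B = {(u, v). u \<in> moderate_maps A B \<and> v \<in> moderate_maps A B \<and>
     (\<forall>f\<in>smooth_functions B. (\<lambda>\<epsilon> x. f (u \<epsilon> x) - f (v \<epsilon> x)) \<in> negligible_functions A)}"

definition gen_maps ::
    "('m::topological_space, 'e::real_normed_vector) atlas \<Rightarrow>
     ('n::topological_space, 'f::real_normed_vector) atlas \<Rightarrow> ('m \<Rightarrow> 'n) net set set" where
  "gen_maps A B = moderate_maps A B // gen_map_rel A B"

text \<open>The class, modulo \<open>R\<close>, of \<open>(u\<^sub>\<epsilon>(x\<^sub>\<epsilon>))\<close> for representatives \<open>u\<close> of \<open>U\<close> and \<open>x\<close> of \<open>X\<close>.  As usual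
  for operations on quotients, the union over all representatives is taken: it is a union of
  copies of a single class, since point values are well defined.\<close>

definition point_value ::
    "('b net \<times> 'b net) set \<Rightarrow> ('a \<Rightarrow> 'b) net set \<Rightarrow> 'a net set \<Rightarrow> 'b net set" where
  "point_value R U X = (\<Union>u\<in>U. \<Union>x\<in>X. R `` {\<lambda>\<epsilon>. u \<epsilon> (x \<epsilon>)})"

end

theory Submission
  imports Defs
begin


text \<open>Among moderate nets, negligibility only concerns suprema over compact sets, without
  derivatives. If \<open>u\<close> is negligible, its value at a net that stays in a compact set is
  bounded by the supremum over that set. Conversely, suppose that the suprema of |w_\<epsilon>| over
  a compact set K are not O(\<epsilon>^k). Then there are \<epsilon>_j -> 0 and x_j in K with
  |w(x_j)| > j \<epsilon>_j^k at the parameter \<epsilon>_j. By compactness a subsequence of the x_j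
  converges to some p in K. Setting the net equal to p at all other \<epsilon> gives a net that
  converges to p and along which w is not negligible (\<open>not_negligible_near_standard\<close>).
  Its class is near-standard because convergence passes to all representatives
  (\<open>tendsto_riemannian_dist_0\<close>). This settles (i).

  For (ii) the same detection is applied to w = f o u - f o v for every smooth f on N. Equal point
  values mean negligible distances in N, and f is Lipschitz for the distance near compact sets
  (\<open>smooth_function_negligible\<close>). A point value is a union over representatives, so
  equality only provides representatives v' of v and x' of x with v'(x') equivalent to u(x).
  Replacing v' by v costs a negligible net. Replacing x' by x uses the mean value inequality with a
  moderate Lipschitz constant (\<open>moderate_function_negligible\<close>); the derivatives in a
  chart are controlled through globally defined operators, cut off by a bump function
  (\<open>linear_diff_op_bump\<close>, \<open>moderate_first_derivatives\<close>).

  Apart from d(x,x) = 0, all information on the Riemannian distance comes from one local comparison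
  (\<open>riemannian_dist_chart\<close>): near a point, a small distance forces the other end into
  the same chart and dominates a multiple of the coordinate distance. Indeed the metric is bounded
  below on a compact coordinate ball, and a curve that leaves the ball is long.\<close>

section \<open>Calculus of \<open>C\<^sup>k\<close> functions\<close>

text \<open>Openness of \<open>S\<close> makes \<open>f\<close> and \<open>g\<close> agree near each
  point of \<open>S\<close>, so their derivatives agree on \<open>S\<close> and the induction
  applies to these.\<close>

lemma Ck_on_cong:
  assumes "open S" "Ck_on k S f" "\<And>x. x \<in> S \<Longrightarrow> f x = g x"
  shows "Ck_on k S g"
  using assms(2,3)
proof (induction k arbitrary: f g)
  case 0
  then show ?case by (simp cong: continuous_on_cong)
next
  case (Suc k)
  have fg: "frechet_derivative f (at x) = frechet_derivative g (at x)" "g differentiable (at x)"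
    if x: "x \<in> S" for x
  proof -
    have "f differentiable (at x)"
      using Suc.prems(1) x by simp
    then have "(g has_derivative frechet_derivative f (at x)) (at x)"
      by (intro has_derivative_transform_within_open[OF _ \<open>open S\<close> x Suc.prems(2)])
        (simp_all add: frechet_derivative_works)
    then show "frechet_derivative f (at x) = frechet_derivative g (at x)" "g differentiable (at x)"
      by (auto simp: frechet_derivative_at differentiable_def)
  qed
  show ?case
    using Suc.prems(1) fg Suc.IH[of "\<lambda>x. frechet_derivative f (at x) _" "\<lambda>x. frechet_derivative g (at x) _"]
    by auto
qed

text \<open>Lets an explicit derivative \<open>D\<close> take the place of the one selected by
  \<open>frechet_derivative\<close>.\<close>

lemma Ck_on_SucI:
  assumes "open S" "\<And>x. x \<in> S \<Longrightarrow> (f has_derivative D x) (at x)"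
    and "\<And>v. Ck_on k S (\<lambda>x. D x v)"
  shows "Ck_on (Suc k) S f"
proof -
  have "Ck_on k S (\<lambda>x. frechet_derivative f (at x) v)" for v
    by (rule Ck_on_cong[OF assms(1,3)]) (simp add: frechet_derivative_at[OF assms(2)])
  then show ?thesis
    using assms(2) by (auto simp: differentiable_def)
qed

lemma Ck_on_SucD:
  assumes "Ck_on (Suc k) S f" "x \<in> S"
  shows "(f has_derivative frechet_derivative f (at x)) (at x)"
  using assms by (simp add: frechet_derivative_works)

lemma Ck_on_mono: "Ck_on (Suc k) S f \<Longrightarrow> Ck_on k S f"
proof (induction k arbitrary: f)
  case 0
  then show ?case
    by (auto intro!: continuous_at_imp_continuous_on differentiable_imp_continuous_within)
next
  case (Suc k)
  show ?case
    using Suc.prems Suc.IH by (metis Ck_on.simps(2))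
qed

text \<open>Glues regularity from different open sets, as is needed for the coefficients in
  \<open>linear_diff_op_bump\<close>.\<close>

lemma Ck_on_local:
  assumes "\<And>x. x \<in> S \<Longrightarrow> \<exists>T. open T \<and> x \<in> T \<and> Ck_on k T f"
  shows "Ck_on k S f"
  using assms
proof (induction k arbitrary: f)
  case 0
  then show ?case
    by (metis Ck_on.simps(1) continuous_at_imp_continuous_on continuous_on_eq_continuous_at)
next
  case (Suc k)
  then have "f differentiable (at x)" if "x \<in> S" for x
    using that by fastforce
  moreover have "Ck_on k S (\<lambda>x. frechet_derivative f (at x) v)" for v
    using Suc.prems by (intro Suc.IH) fastforce
  ultimately show ?case by simp
qed

lemma Ck_on_const: "open S \<Longrightarrow> Ck_on k S (\<lambda>x. c)"
proof (induction k arbitrary: c)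
  case (Suc k)
  then show ?case
    by (intro Ck_on_SucI[where D="\<lambda>x v. 0"]) auto
qed simp

lemma Ck_on_bounded_linear:
  assumes "open S" "bounded_linear L" "Ck_on k S f"
  shows "Ck_on k S (\<lambda>x. L (f x))"
  using assms(3)
proof (induction k arbitrary: f)
  case 0
  then show ?case
    by (simp add: bounded_linear.continuous_on[OF assms(2)])
next
  case (Suc k)
  show ?case
  proof (rule Ck_on_SucI[OF \<open>open S\<close>])
    show "((\<lambda>x. L (f x)) has_derivative (\<lambda>v. L (frechet_derivative f (at x) v))) (at x)"
      if "x \<in> S" for x
      by (rule bounded_linear.has_derivative[OF assms(2) Ck_on_SucD[OF Suc.prems that]])
    show "Ck_on k S (\<lambda>x. L (frechet_derivative f (at x) v))" for v
      using Suc.prems by (intro Suc.IH) auto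
  qed
qed

lemma Ck_on_add:
  assumes "open S" "Ck_on k S f" "Ck_on k S g"
  shows "Ck_on k S (\<lambda>x. f x + g x)"
  using assms(2,3)
proof (induction k arbitrary: f g)
  case 0
  then show ?case by (auto intro: continuous_intros)
next
  case (Suc k)
  show ?case
  proof (rule Ck_on_SucI[OF \<open>open S\<close>])
    show "((\<lambda>x. f x + g x) has_derivative
        (\<lambda>v. frechet_derivative f (at x) v + frechet_derivative g (at x) v)) (at x)"
      if "x \<in> S" for x
      by (rule has_derivative_add[OF Ck_on_SucD[OF Suc.prems(1) that] Ck_on_SucD[OF Suc.prems(2) that]])
    show "Ck_on k S (\<lambda>x. frechet_derivative f (at x) v + frechet_derivative g (at x) v)" for v
      using Suc.prems by (intro Suc.IH) auto
  qed
qed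

lemma Ck_on_diff:
  assumes "open S" "Ck_on k S f" "Ck_on k S g"
  shows "Ck_on k S (\<lambda>x. f x - g x)"
  using Ck_on_add[OF assms(1,2) Ck_on_bounded_linear[OF assms(1) _ assms(3), of uminus]]
  by (simp add: bounded_linear_minus)

lemma Ck_on_sum:
  assumes "open S" "\<And>i. i \<in> I \<Longrightarrow> Ck_on k S (f i)"
  shows "Ck_on k S (\<lambda>x. \<Sum>i\<in>I. f i x)"
  using assms(2)
  by (induction I rule: infinite_finite_induct) (auto intro: Ck_on_add Ck_on_const \<open>open S\<close>)

lemma Ck_on_mult:
  fixes f g :: "'a::real_normed_vector \<Rightarrow> real"
  assumes "open S" "Ck_on k S f" "Ck_on k S g"
  shows "Ck_on k S (\<lambda>x. f x * g x)"
  using assms(2,3)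
proof (induction k arbitrary: f g)
  case 0
  then show ?case by (auto intro: continuous_intros)
next
  case (Suc k)
  have fg: "Ck_on k S f" "Ck_on k S g"
    using Suc.prems Ck_on_mono by blast+
  show ?case
  proof (rule Ck_on_SucI[OF \<open>open S\<close>])
    show "((\<lambda>x. f x * g x) has_derivative
        (\<lambda>v. f x * frechet_derivative g (at x) v + frechet_derivative f (at x) v * g x)) (at x)"
      if "x \<in> S" for x
      by (rule has_derivative_mult[OF Ck_on_SucD[OF Suc.prems(1) that] Ck_on_SucD[OF Suc.prems(2) that]])
    show "Ck_on k S (\<lambda>x. f x * frechet_derivative g (at x) v + frechet_derivative f (at x) v * g x)" for v
      using Suc.prems fg by (intro Ck_on_add[OF \<open>open S\<close>] Suc.IH) auto
  qed
qed

section \<open>Orthonormal bases and the chain rule\<close>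

definition onb :: "'a::real_inner set \<Rightarrow> bool" where
  "onb B \<longleftrightarrow> finite B \<and> independent B \<and> span B = UNIV \<and> (\<forall>b\<in>B. norm b = 1) \<and>
     (\<forall>v. (\<Sum>b\<in>B. (v \<bullet> b) *\<^sub>R b) = v)"

text \<open>Gram-Schmidt, followed by normalising the nonzero vectors. In \<open>onb\<close>,
  orthogonality is encoded by the expansion formula together with independence; in dimension 0 the
  basis is empty.\<close>

lemma onb_exists:
  assumes "finite (A::'a::real_inner set)" "span A = UNIV"
  shows "\<exists>B::'a set. onb B"
proof -
  obtain C where C: "finite C" "span C = (UNIV::'a set)" "pairwise orthogonal C"
    using basis_orthogonal[OF assms(1)] assms(2) by auto
  define B where "B = sgn ` (C - {0})"
  have span: "span B = UNIV"
  proof -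
    have "c \<in> span B" if "c \<in> C" for c
    proof (cases "c = 0")
      case False
      then have "norm c *\<^sub>R sgn c \<in> span B"
        using that by (intro span_scale span_base) (auto simp: B_def)
      then show ?thesis by (simp add: sgn_div_norm False)
    qed (simp add: span_zero)
    then have "span C \<subseteq> span B"
      by (intro span_minimal) auto
    then show ?thesis using C by auto
  qed
  have nrm: "norm b = 1" if "b \<in> B" for b
    using that by (auto simp: B_def norm_sgn split: if_splits)
  have ort: "b \<bullet> b' = (if b = b' then 1 else 0)" if bB: "b \<in> B" "b' \<in> B" for b b'
  proof (cases "b = b'")
    case True
    then show ?thesis using nrm[OF bB(1)] by (simp add: norm_eq_1)
  next
    case False
    obtain x y where xy: "x \<in> C" "y \<in> C" "b = sgn x" "b' = sgn y"
      using bB unfolding B_def by blast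
    with False have "x \<noteq> y" by auto
    then have "x \<bullet> y = 0"
      using C(3) xy by (auto simp: pairwise_def orthogonal_def)
    then show ?thesis using False xy by (simp add: sgn_div_norm)
  qed
  have fin: "finite B" using C by (simp add: B_def)
  have "independent B"
    by (rule pairwise_orthogonal_independent)
      (use ort nrm nrm[of 0] in \<open>auto simp: pairwise_def orthogonal_def\<close>)
  moreover have "(\<Sum>b\<in>B. (v \<bullet> b) *\<^sub>R b) = v" for v
  proof -
    have "v \<in> span B" using span by simp
    then show ?thesis
    proof (induction rule: span_induct_alt)
      case (step c x y)
      have "(\<Sum>b\<in>B. ((c *\<^sub>R x + y) \<bullet> b) *\<^sub>R b) = c *\<^sub>R (\<Sum>b\<in>B. (x \<bullet> b) *\<^sub>R b) + (\<Sum>b\<in>B. (y \<bullet> b) *\<^sub>R b)"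
        by (simp add: inner_add_left scaleR_add_left sum.distrib scaleR_sum_right)
      also have "(\<Sum>b\<in>B. (x \<bullet> b) *\<^sub>R b) = (\<Sum>b\<in>B. if x = b then b else 0)"
        by (intro sum.cong) (auto simp: ort step)
      finally show ?case using step fin by simp
    qed simp
  qed
  ultimately show ?thesis
    using fin span nrm unfolding onb_def by blast
qed

lemma onb_expand:
  assumes "onb B" "linear L"
  shows "L v = (\<Sum>b\<in>B. (v \<bullet> b) *\<^sub>R L b)"
proof -
  have "L v = L (\<Sum>b\<in>B. (v \<bullet> b) *\<^sub>R b)" using assms(1) by (simp add: onb_def)
  also have "\<dots> = (\<Sum>b\<in>B. (v \<bullet> b) *\<^sub>R L b)"
    by (simp add: linear_sum[OF assms(2)] linear_scale[OF assms(2)])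
  finally show ?thesis .
qed

text \<open>The chain rule differentiates \<open>g\<close> at \<open>f x\<close> in a direction that
  moves with \<open>x\<close>, whereas \<open>Ck_on\<close> controls fixed directions. Expanding the
  moving direction in \<open>B\<close> leaves a finite sum of products to which the induction
  hypothesis applies.\<close>

lemma Ck_on_compose:
  fixes f :: "'a::real_normed_vector \<Rightarrow> 'b::real_inner" and g :: "'b \<Rightarrow> real"
  assumes "onb (B::'b set)" "open S" "open T" "f ` S \<subseteq> T" "Ck_on k S f" "Ck_on k T g"
  shows "Ck_on k S (\<lambda>x. g (f x))"
  using assms(5,6)
proof (induction k arbitrary: g)
  case 0
  then show ?case using continuous_on_compose2[OF _ _ assms(4), of g] by simp
next
  case (Suc k)
  let ?f' = "\<lambda>x. frechet_derivative f (at x)" and ?g' = "\<lambda>x. frechet_derivative g (at x)"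
  have f': "(f has_derivative ?f' x) (at x)" if "x \<in> S" for x
    by (rule Ck_on_SucD[OF Suc.prems(1) that])
  have g': "(g has_derivative ?g' x) (at x)" if "x \<in> T" for x
    by (rule Ck_on_SucD[OF Suc.prems(2) that])
  show ?case
  proof (rule Ck_on_SucI[OF \<open>open S\<close>])
    fix x assume x: "x \<in> S"
    then have fx: "f x \<in> T" using assms(4) by auto
    have "((\<lambda>x. g (f x)) has_derivative (\<lambda>v. ?g' (f x) (?f' x v))) (at x)"
      using diff_chain_at[OF f'[OF x] g'[OF fx]] by (simp add: o_def)
    moreover have "?g' (f x) (?f' x v) = (\<Sum>b\<in>B. (?f' x v \<bullet> b) * ?g' (f x) b)" for v
      using onb_expand[OF assms(1) has_derivative_linear[OF g'[OF fx]], of "?f' x v"]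
      unfolding real_scaleR_def .
    ultimately show "((\<lambda>x. g (f x)) has_derivative (\<lambda>v. \<Sum>b\<in>B. (?f' x v \<bullet> b) * ?g' (f x) b)) (at x)"
      by (simp only:)
  next
    fix v
    have 1: "Ck_on k S (\<lambda>x. ?f' x v \<bullet> b)" for b
      using Suc.prems(1) by (intro Ck_on_bounded_linear[OF \<open>open S\<close> bounded_linear_inner_left]) auto
    have 2: "Ck_on k S (\<lambda>x. ?g' (f x) b)" for b
      using Suc.IH[of "\<lambda>x. ?g' x b"] Suc.prems Ck_on_mono by auto
    show "Ck_on k S (\<lambda>x. \<Sum>b\<in>B. (?f' x v \<bullet> b) * ?g' (f x) b)"
      by (intro Ck_on_sum Ck_on_mult \<open>open S\<close> 1 2)
  qed
qed

section \<open>A smooth function vanishing on a half-line\<close>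

definition flat :: "nat \<Rightarrow> real \<Rightarrow> real" where
  "flat n t = (if t > 0 then exp (- inverse t) * inverse t ^ n else 0)"

lemma flat_tendsto_0: "(flat n \<longlongrightarrow> 0) (at 0)"
proof -
  have "((\<lambda>x::real. x ^ n / exp x) \<longlongrightarrow> 0) at_top"
    by (rule tendsto_power_div_exp_0)
  then have "((\<lambda>t. inverse t ^ n / exp (inverse t)) \<longlongrightarrow> (0::real)) (at_right 0)"
    by (rule filterlim_compose[OF _ filterlim_inverse_at_top_right])
  then have "(flat n \<longlongrightarrow> 0) (at_right 0)"
    by (rule Lim_transform_eventually)
      (auto simp: eventually_at_filter flat_def exp_minus field_simps)
  moreover have "(flat n \<longlongrightarrow> 0) (at_left 0)"
    by (rule Lim_transform_eventually[OF tendsto_const])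
      (auto simp: eventually_at_filter flat_def)
  ultimately show ?thesis by (rule filterlim_split_at[rotated])
qed

text \<open>The powers \<open>inverse t ^ n\<close> are carried along because derivatives of
  exp(-1/t) are combinations of such products; the family is thus closed under
  differentiation.\<close>

lemma flat_has_derivative:
  "(flat n has_real_derivative (flat (n + 2) t - n * flat (n + 1) t)) (at t)"
proof -
  consider "t > 0" | "t < 0" | "t = 0" by linarith
  then show ?thesis
  proof cases
    case 1
    have "((\<lambda>t. exp (- inverse t) * inverse t ^ n) has_real_derivative
        exp (- inverse t) * inverse t ^ 2 * inverse t ^ n
        + exp (- inverse t) * (n * inverse t ^ (n - 1) * (- (inverse t ^ 2)))) (at t)"
      using 1 by (auto intro!: derivative_eq_intros simp: power2_eq_square)
    also have "n * inverse t ^ (n - 1) * (- (inverse t ^ 2)) = - (n * inverse t ^ (n + 1))"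
      by (cases n) (auto simp: power2_eq_square)
    also have "exp (- inverse t) * inverse t ^ 2 * inverse t ^ n
        + exp (- inverse t) * (- (n * inverse t ^ (n + 1))) = flat (n + 2) t - n * flat (n + 1) t"
      using 1 by (simp add: flat_def power2_eq_square)
    finally have "((\<lambda>t. exp (- inverse t) * inverse t ^ n) has_real_derivative
      (flat (n + 2) t - n * flat (n + 1) t)) (at t)" .
    then show ?thesis
      by (rule has_field_derivative_transform_within_open[of _ _ _ "{0<..}"]) (use 1 in \<open>auto simp: flat_def\<close>)
  next
    case 2
    have "((\<lambda>t. 0) has_real_derivative (flat (n + 2) t - n * flat (n + 1) t)) (at t)"
      using 2 by (auto simp: flat_def)
    then show ?thesis
      by (rule has_field_derivative_transform_within_open[of _ _ _ "{..<0}"]) (use 2 in \<open>auto simp: flat_def\<close>)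
  next
    case 3
    \<comment> \<open>The difference quotient of \<open>flat n\<close> at 0 is
      \<open>flat (Suc n)\<close>, which tends to 0.\<close>
    have "((\<lambda>h. flat n h / h) \<longlongrightarrow> 0) (at 0)"
      by (rule Lim_transform_eventually[OF flat_tendsto_0[of "Suc n"]])
        (auto simp: eventually_at_filter flat_def field_simps)
    then show ?thesis
      using 3 by (simp add: DERIV_def flat_def)
  qed
qed

lemma Ck_on_flat: "Ck_on k UNIV (flat n)"
proof (induction k arbitrary: n)
  case 0
  have "isCont (flat n) t" for t
    by (rule DERIV_isCont[OF flat_has_derivative])
  then show ?case by (simp add: continuous_on_eq_continuous_at)
next
  case (Suc k)
  show ?case
  proof (rule Ck_on_SucI)
    show "(flat n has_derivative (\<lambda>v. (flat (n + 2) t - n * flat (n + 1) t) * v)) (at t)" for t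
      using flat_has_derivative[of n t] by (simp add: has_field_derivative_def)
    show "Ck_on k UNIV (\<lambda>t. (flat (n + 2) t - n * flat (n + 1) t) * v)" for v
      by (intro Ck_on_mult Ck_on_diff Ck_on_const Suc.IH open_UNIV)
  qed simp
qed



section \<open>Charts and curves\<close>

lemma chart_simps:
  assumes "smooth_atlas A" "c \<in> A"
  shows chart_open: "open (fst c)" and chart_image_open: "open (chart_image c)"
    and chart_continuous: "continuous_on (fst c) (snd c)"
    and chart_inv_continuous: "continuous_on (chart_image c) (chart_inv c)"
    and chart_inv_chart: "\<And>q. q \<in> fst c \<Longrightarrow> chart_inv c (snd c q) = q"
    and chart_chart_inv: "\<And>y. y \<in> chart_image c \<Longrightarrow> snd c (chart_inv c y) = y"
    and chart_inv_in: "\<And>y. y \<in> chart_image c \<Longrightarrow> chart_inv c y \<in> fst c"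
  using assms unfolding smooth_atlas_def is_chart_def homeomorphism_def by auto

lemma atlas_cover:
  assumes "smooth_atlas A"
  obtains c where "c \<in> A" "q \<in> fst c"
  using assms unfolding smooth_atlas_def by blast

lemma chart_overlap_eq:
  assumes "smooth_atlas A" "c \<in> A"
  shows "snd c ` (fst c \<inter> U) = chart_image c \<inter> chart_inv c -` U"
  using chart_inv_chart[OF assms] chart_chart_inv[OF assms] chart_inv_in[OF assms]
  by (auto simp: image_iff)

lemma chart_overlap_open:
  assumes "smooth_atlas A" "c \<in> A" "open U"
  shows "open (snd c ` (fst c \<inter> U))"
  unfolding chart_overlap_eq[OF assms(1,2)]
  using chart_simps[OF assms(1,2)] assms(3) continuous_open_preimage by blast

lemma chart_preimage_open:
  assumes "smooth_atlas A" "c \<in> A" "open V"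
  shows "open {q \<in> fst c. snd c q \<in> V}"
proof -
  have "{q \<in> fst c. snd c q \<in> V} = fst c \<inter> snd c -` V" by auto
  then show ?thesis
    using continuous_open_preimage[OF chart_continuous[OF assms(1,2)] chart_open[OF assms(1,2)] assms(3)]
    by simp
qed

lemma chart_preimage_compact:
  assumes "smooth_atlas A" "c \<in> A" "compact K" "K \<subseteq> chart_image c"
  shows "compact {q \<in> fst c. snd c q \<in> K}"
proof -
  have "{q \<in> fst c. snd c q \<in> K} = chart_inv c ` K"
    using chart_simps[OF assms(1,2)] assms(4) by (auto simp: image_iff) metis
  then show ?thesis
    using compact_continuous_image[OF continuous_on_subset[OF chart_inv_continuous[OF assms(1,2)] assms(4)] assms(3)]
    by simp
qed

lemma chart_cball:
  assumes "smooth_atlas (A :: ('m::topological_space, 'e::real_normed_vector) atlas)"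
  obtains c r where "c \<in> A" "q \<in> fst c" "r > 0" "cball (snd c q) r \<subseteq> chart_image c"
proof -
  obtain c where c: "c \<in> A" "q \<in> fst c"
    using atlas_cover[OF assms] by blast
  have "snd c q \<in> chart_image c" using c by simp
  then obtain r where "r > 0" "cball (snd c q) r \<subseteq> chart_image c"
    using chart_image_open[OF assms c(1)] open_contains_cball by blast
  then show ?thesis using that c by blast
qed

lemma transition_Ck:
  assumes "smooth_atlas A" "c \<in> A" "d \<in> A"
  shows "Ck_on k (snd c ` (fst c \<inter> fst d)) (snd d \<circ> chart_inv c)"
  using assms unfolding smooth_atlas_def smooth_on_def by blast

lemma transition_derivative:
  assumes "smooth_atlas A" "c \<in> A" "d \<in> A" "q \<in> fst c" "q \<in> fst d"
  shows "((snd d \<circ> chart_inv c) has_derivative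
    frechet_derivative (snd d \<circ> chart_inv c) (at (snd c q))) (at (snd c q))"
  by (rule Ck_on_SucD[OF transition_Ck[OF assms(1-3), of "Suc 0"]]) (use assms in auto)

text \<open>Near \<open>t\<close> within \<open>S\<close> the curve stays in the domain of
  \<open>c\<close>, so \<open>snd d \<circ> \<gamma>\<close> is the transition map after
  \<open>snd c \<circ> \<gamma>\<close>. Derivatives within \<open>S\<close> also cover end points
  of closed intervals.\<close>

lemma velocity_change_chart:
  assumes A: "smooth_atlas A" "c \<in> A" "d \<in> A" and q: "\<gamma> t \<in> fst c" "\<gamma> t \<in> fst d"
    and cont: "continuous (at t within S) \<gamma>" and t: "t \<in> S"
    and v: "((snd c \<circ> \<gamma>) has_vector_derivative v) (at t within S)"
  shows "((snd d \<circ> \<gamma>) has_vector_derivative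
    frechet_derivative (snd d \<circ> chart_inv c) (at (snd c (\<gamma> t))) v) (at t within S)"
proof -
  let ?D = "frechet_derivative (snd d \<circ> chart_inv c) (at (snd c (\<gamma> t)))"
  have \<gamma>t: "(snd c \<circ> \<gamma>) t = snd c (\<gamma> t)" by simp
  have "((snd d \<circ> chart_inv c) has_derivative ?D) (at ((snd c \<circ> \<gamma>) t) within (snd c \<circ> \<gamma>) ` S)"
    unfolding \<gamma>t by (rule has_derivative_at_withinI[OF transition_derivative[OF A q]])
  then have "((snd d \<circ> chart_inv c) \<circ> (snd c \<circ> \<gamma>) has_vector_derivative ?D v) (at t within S)"
    by (rule vector_derivative_diff_chain_within[OF v])
  moreover have "\<forall>\<^sub>F s in at t within S. \<gamma> s \<in> fst c"
    using cont q(1) chart_open[OF A(1,2)] by (auto simp: continuous_within intro: topological_tendstoD)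
  then have "\<forall>\<^sub>F s in at t within S. ((snd d \<circ> chart_inv c) \<circ> (snd c \<circ> \<gamma>)) s = (snd d \<circ> \<gamma>) s"
    by eventually_elim (simp add: chart_inv_chart[OF A(1,2)])
  ultimately show ?thesis
    unfolding has_vector_derivative_def
    by (rule has_derivative_transform_eventually[OF _ _ _ t])
      (use q in \<open>simp add: chart_inv_chart[OF A(1,2)]\<close>)
qed

lemma C1_curve_on_subset:
  assumes "C1_curve_on A \<gamma> S" "T \<subseteq> S"
  shows "C1_curve_on A \<gamma> T"
  unfolding C1_curve_on_def
proof (intro conjI ballI)
  show "continuous_on T \<gamma>"
    using assms continuous_on_subset unfolding C1_curve_on_def by blast
  fix c assume "c \<in> A"
  then obtain D where D: "\<And>t. t \<in> S \<inter> \<gamma> -` fst c \<Longrightarrow> ((snd c \<circ> \<gamma>) has_vector_derivative D t) (at t within S)"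
      "continuous_on (S \<inter> \<gamma> -` fst c) D"
    using assms(1) unfolding C1_curve_on_def by blast
  have "\<forall>t\<in>T \<inter> \<gamma> -` fst c. ((snd c \<circ> \<gamma>) has_vector_derivative D t) (at t within T)"
    using D(1) assms(2) by (meson Int_iff has_vector_derivative_within_subset subsetD)
  moreover have "continuous_on (T \<inter> \<gamma> -` fst c) D"
    by (rule continuous_on_subset[OF D(2)]) (use assms(2) in auto)
  ultimately show "\<exists>D. (\<forall>t\<in>T \<inter> \<gamma> -` fst c. ((snd c \<circ> \<gamma>) has_vector_derivative D t) (at t within T)) \<and>
      continuous_on (T \<inter> \<gamma> -` fst c) D"
    by blast
qed

lemma C1_curve_on_cong:
  assumes "C1_curve_on A \<gamma> S" "\<And>t. t \<in> S \<Longrightarrow> \<gamma> t = \<gamma>' t"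
  shows "C1_curve_on A \<gamma>' S"
  unfolding C1_curve_on_def
proof (intro conjI ballI)
  show "continuous_on S \<gamma>'"
    using assms continuous_on_cong unfolding C1_curve_on_def by metis
  fix c assume "c \<in> A"
  then obtain D where D: "\<And>t. t \<in> S \<inter> \<gamma> -` fst c \<Longrightarrow> ((snd c \<circ> \<gamma>) has_vector_derivative D t) (at t within S)"
      "continuous_on (S \<inter> \<gamma> -` fst c) D"
    using assms(1) unfolding C1_curve_on_def by blast
  have eq: "S \<inter> \<gamma> -` fst c = S \<inter> \<gamma>' -` fst c"
    using assms(2) by auto
  have "((snd c \<circ> \<gamma>') has_vector_derivative D t) (at t within S)" if "t \<in> S \<inter> \<gamma> -` fst c" for t
    using that assms(2) by (intro has_vector_derivative_transform[OF _ _ D(1)[OF that]]) auto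
  with D(2) show "\<exists>D. (\<forall>t\<in>S \<inter> \<gamma>' -` fst c. ((snd c \<circ> \<gamma>') has_vector_derivative D t) (at t within S)) \<and>
      continuous_on (S \<inter> \<gamma>' -` fst c) D"
    unfolding eq by blast
qed

lemma C1_curve_on_const: "C1_curve_on A (\<lambda>t. q) S"
  unfolding C1_curve_on_def o_def
  by (intro conjI ballI exI[of _ "\<lambda>t. 0"]) auto

lemma C1_curve_on_rescale:
  assumes "C1_curve_on A \<gamma> S" "(\<lambda>t. a * t) ` T \<subseteq> S"
  shows "C1_curve_on A (\<lambda>t. \<gamma> (a * t)) T"
  unfolding C1_curve_on_def
proof (intro conjI ballI)
  have l: "continuous_on U (\<lambda>t. a * t)" for U by (intro continuous_intros)
  show "continuous_on T (\<lambda>t. \<gamma> (a * t))"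
    using assms continuous_on_compose2[OF _ l] unfolding C1_curve_on_def by blast
  fix c assume "c \<in> A"
  then obtain D where D: "\<And>t. t \<in> S \<inter> \<gamma> -` fst c \<Longrightarrow> ((snd c \<circ> \<gamma>) has_vector_derivative D t) (at t within S)"
      "continuous_on (S \<inter> \<gamma> -` fst c) D"
    using assms(1) unfolding C1_curve_on_def by blast
  let ?T = "T \<inter> (\<lambda>t. \<gamma> (a * t)) -` fst c"
  have 1: "((snd c \<circ> (\<lambda>t. \<gamma> (a * t))) has_vector_derivative a *\<^sub>R D (a * t)) (at t within T)"
    if t: "t \<in> ?T" for t
  proof -
    have "((snd c \<circ> \<gamma>) has_vector_derivative D (a * t)) (at (a * t) within (\<lambda>t. a * t) ` T)"
      using t assms(2) by (intro has_vector_derivative_within_subset[OF D(1) assms(2)]) auto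
    moreover have "((\<lambda>t. a * t) has_vector_derivative a) (at t within T)"
      by (auto simp: has_vector_derivative_def intro!: derivative_eq_intros)
    ultimately have "((snd c \<circ> \<gamma>) \<circ> (\<lambda>t. a * t) has_vector_derivative a *\<^sub>R D (a * t)) (at t within T)"
      unfolding has_vector_derivative_def[of "snd c \<circ> \<gamma>"]
      by (intro vector_derivative_diff_chain_within[where g'="\<lambda>x. x *\<^sub>R D (a * t)"])
    then show ?thesis by (simp add: o_def)
  qed
  have 2: "continuous_on ?T (\<lambda>t. a *\<^sub>R D (a * t))"
    by (intro continuous_intros continuous_on_compose2[OF D(2) l]) (use assms(2) in auto)
  show "\<exists>D. (\<forall>t\<in>?T. ((snd c \<circ> (\<lambda>t. \<gamma> (a * t))) has_vector_derivative D t) (at t within T)) \<and>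
      continuous_on ?T D"
    by (rule exI[of _ "\<lambda>t. a *\<^sub>R D (a * t)"], intro conjI ballI 1 2)
qed

text \<open>In another chart the velocity is the derivative of the transition map in the fixed
  direction \<open>w\<close>, which is continuous along the segment.\<close>

lemma C1_curve_on_segment:
  fixes A :: "('m::topological_space, 'e::real_normed_vector) atlas"
  assumes A: "smooth_atlas A" "c \<in> A"
    and in_image: "\<And>t. t \<in> {a..a+1} \<Longrightarrow> y + (t - a) *\<^sub>R w \<in> chart_image c"
  shows "C1_curve_on A (\<lambda>t. chart_inv c (y + (t - a) *\<^sub>R w)) {a..a+1}"
  unfolding C1_curve_on_def
proof (intro conjI ballI)
  let ?l = "\<lambda>t. y + (t - a) *\<^sub>R w"
  have l: "continuous_on U ?l" for U by (intro continuous_intros)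
  show "continuous_on {a..a+1} (\<lambda>t. chart_inv c (?l t))"
    by (rule continuous_on_compose2[OF chart_inv_continuous[OF A] l]) (use in_image in auto)
  fix d assume d: "d \<in> A"
  let ?F = "snd d \<circ> chart_inv c"
  let ?D = "\<lambda>t. frechet_derivative ?F (at (?l t)) w"
  let ?T = "{a..a+1} \<inter> (\<lambda>t. chart_inv c (?l t)) -` fst d"
  have lT: "?l t \<in> snd c ` (fst c \<inter> fst d)" if "t \<in> ?T" for t
    using in_image[of t] that unfolding chart_overlap_eq[OF A] by auto
  have Ck: "Ck_on (Suc 0) (snd c ` (fst c \<inter> fst d)) ?F"
    by (rule transition_Ck[OF A d])
  have 1: "((snd d \<circ> (\<lambda>t. chart_inv c (?l t))) has_vector_derivative ?D t) (at t within {a..a+1})"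
    if "t \<in> ?T" for t
  proof -
    have "(?l has_vector_derivative w) (at t within {a..a+1})"
      by (auto simp: has_vector_derivative_def intro!: derivative_eq_intros)
    then have "(?F \<circ> ?l has_vector_derivative ?D t) (at t within {a..a+1})"
      by (rule vector_derivative_diff_chain_within)
        (rule has_derivative_at_withinI[OF Ck_on_SucD[OF Ck lT[OF that]]])
    then show ?thesis by (simp add: o_def)
  qed
  have 2: "continuous_on ?T ?D"
    by (rule continuous_on_compose2[OF _ l, of "snd c ` (fst c \<inter> fst d)"]) (use Ck lT in \<open>simp_all del: o_apply add: image_subset_iff\<close>)
  show "\<exists>D. (\<forall>t\<in>?T. ((snd d \<circ> (\<lambda>t. chart_inv c (?l t))) has_vector_derivative D t) (at t within {a..a+1})) \<and>
      continuous_on ?T D"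
    by (rule exI[of _ ?D], intro conjI ballI 1 2)
qed

section \<open>Piecewise C^1 paths and connectedness\<close>

definition reachable :: "('m::topological_space, 'e::real_normed_vector) atlas \<Rightarrow> 'm \<Rightarrow> 'm \<Rightarrow> bool" where
  "reachable A x y \<longleftrightarrow> (\<exists>n \<gamma>. n > 0 \<and> \<gamma> 0 = x \<and> \<gamma> (real n) = y \<and>
     (\<forall>i<n. C1_curve_on A \<gamma> {real i..real i + 1}))"

lemma reachable_refl: "reachable A x x"
  unfolding reachable_def
  by (rule exI[of _ 1], rule exI[of _ "\<lambda>t. x"]) (simp add: C1_curve_on_const)

text \<open>The coordinate segment from \<open>q\<close> to \<open>y\<close> stays in the convex set
  \<open>V\<close> and is appended on the next unit interval. Unit pieces make joining curves free
  of reparametrisation.\<close>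

lemma reachable_in_chart:
  assumes A: "smooth_atlas A" "c \<in> A" and V: "convex V" "V \<subseteq> chart_image c"
    and q: "q \<in> fst c" "snd c q \<in> V" and y: "y \<in> fst c" "snd c y \<in> V"
    and "reachable A x q"
  shows "reachable A x y"
proof -
  obtain n \<gamma> where \<gamma>: "n > 0" "\<gamma> 0 = x" "\<gamma> (real n) = q"
      "\<And>i. i < n \<Longrightarrow> C1_curve_on A \<gamma> {real i..real i + 1}"
    using \<open>reachable A x q\<close> unfolding reachable_def by blast
  let ?\<sigma> = "\<lambda>t. chart_inv c (snd c q + (t - real n) *\<^sub>R (snd c y - snd c q))"
  define \<gamma>' where "\<gamma>' t = (if t \<le> real n then \<gamma> t else ?\<sigma> t)" for t
  \<comment> \<open>At \<open>t = real n\<close> both branches give \<open>q\<close>, so the new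
    closed piece includes its left end point.\<close>
  have \<gamma>'\<sigma>: "\<gamma>' t = ?\<sigma> t" if "t \<ge> real n" for t
    using that \<gamma>(3) chart_inv_chart[OF A q(1)] by (cases "t = real n") (auto simp: \<gamma>'_def)
  have "snd c q + (t - real n) *\<^sub>R (snd c y - snd c q) \<in> chart_image c" if "t \<in> {real n..real n + 1}" for t
  proof -
    have "(1 - (t - real n)) *\<^sub>R snd c q + (t - real n) *\<^sub>R snd c y \<in> V"
      using V(1) q(2) y(2) that by (intro convexD_alt) auto
    then show ?thesis using V(2) by (auto simp: algebra_simps)
  qed
  then have "C1_curve_on A ?\<sigma> {real n..real n + 1}"
    by (rule C1_curve_on_segment[OF A])
  then have "C1_curve_on A \<gamma>' {real n..real n + 1}"
    by (rule C1_curve_on_cong) (simp add: \<gamma>'\<sigma>)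
  moreover have "C1_curve_on A \<gamma>' {real i..real i + 1}" if "i < n" for i
    by (rule C1_curve_on_cong[OF \<gamma>(4)[OF that]]) (use that in \<open>auto simp: \<gamma>'_def\<close>)
  ultimately have "\<forall>i<Suc n. C1_curve_on A \<gamma>' {real i..real i + 1}"
    by (simp add: less_Suc_eq)
  moreover have "\<gamma>' 0 = x" "\<gamma>' (real (Suc n)) = y"
    using \<gamma> \<gamma>'\<sigma>[of "real (Suc n)"] chart_inv_chart[OF A y(1)] by (auto simp: \<gamma>'_def)
  ultimately show ?thesis
    unfolding reachable_def by blast
qed

text \<open>Connectedness is needed here: without a connecting curve, \<open>riemannian_dist\<close> would be the
  junk value \<open>Inf {}\<close>.\<close>

lemma piecewise_C1_curve_exists:
  assumes "smooth_manifold (A :: ('m::t2_space, 'e::{real_inner, heine_borel}) atlas)"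
  obtains \<gamma> where "piecewise_C1_curve A \<gamma>" "\<gamma> 0 = x" "\<gamma> 1 = y"
proof -
  have A: "smooth_atlas A" and conn: "connected (UNIV :: 'm set)"
    using assms unfolding smooth_manifold_def by auto
  define S where "S = {y. reachable A x y}"
  \<comment> \<open>Reachability is locally constant, since points of a coordinate ball are joined
    by segments to its centre. Hence the reachable set and its complement are open.\<close>
  have nbhd: "\<exists>U. open U \<and> q \<in> U \<and> (\<forall>y\<in>U. reachable A x y \<longleftrightarrow> reachable A x q)" for q
  proof -
    obtain c r where c: "c \<in> A" "q \<in> fst c" "r > 0" "cball (snd c q) r \<subseteq> chart_image c"
      using chart_cball[OF A] by metis
    let ?V = "ball (snd c q) r"
    have V: "convex ?V" "?V \<subseteq> chart_image c"
      using c(4) by auto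
    have "open {p \<in> fst c. snd c p \<in> ?V}"
      by (rule chart_preimage_open[OF A c(1)]) simp
    moreover have "reachable A x y \<longleftrightarrow> reachable A x q" if "y \<in> {p \<in> fst c. snd c p \<in> ?V}" for y
    proof -
      have y: "y \<in> fst c" "snd c y \<in> ?V" and q: "snd c q \<in> ?V"
        using that c(3) by simp_all
      show ?thesis
        using reachable_in_chart[OF A c(1) V c(2) q y] reachable_in_chart[OF A c(1) V y c(2) q]
        by blast
    qed
    moreover have "q \<in> {p \<in> fst c. snd c p \<in> ?V}"
      using c by simp
    ultimately show ?thesis by blast
  qed
  have "open S"
  proof (rule Topological_Spaces.openI)
    fix q assume "q \<in> S"
    with nbhd[of q] show "\<exists>T. open T \<and> q \<in> T \<and> T \<subseteq> S"
      unfolding S_def by (metis mem_Collect_eq subsetI)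
  qed
  moreover have "open (- S)"
  proof (rule Topological_Spaces.openI)
    fix q assume "q \<in> - S"
    with nbhd[of q] show "\<exists>T. open T \<and> q \<in> T \<and> T \<subseteq> - S"
      unfolding S_def by (metis ComplD ComplI mem_Collect_eq subsetI)
  qed
  moreover have "x \<in> S" by (simp add: S_def reachable_refl)
  ultimately have "S = UNIV"
    using connectedD[OF conn, of S "- S"] by auto
  then have "reachable A x y" by (auto simp: S_def)
  then obtain n \<gamma> where \<gamma>: "n > 0" "\<gamma> 0 = x" "\<gamma> (real n) = y"
      "\<And>i. i < n \<Longrightarrow> C1_curve_on A \<gamma> {real i..real i + 1}"
    unfolding reachable_def by blast
  \<comment> \<open>Rescaling from [0,n] to [0,1] happens only here, with break points i/n.\<close>
  have "C1_curve_on A (\<lambda>t. \<gamma> (real n * t)) {real i / real n..real (Suc i) / real n}" if "i < n" for i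
    by (rule C1_curve_on_rescale[OF \<gamma>(4)[OF that]]) (use \<gamma>(1) in \<open>auto simp: field_simps\<close>)
  then have "piecewise_C1_curve A (\<lambda>t. \<gamma> (real n * t))"
    unfolding piecewise_C1_curve_def
    by (intro exI[of _ n] exI[of _ "\<lambda>i. real i / real n"]) (use \<gamma>(1) in \<open>auto simp: divide_strict_right_mono\<close>)
  then show ?thesis
    using that \<gamma> by simp
qed



section \<open>The Riemannian distance in charts\<close>

lemma metric_bilinear:
  assumes "riemannian_metric A g" "c \<in> A" "p \<in> fst c"
  shows "bilinear (g c p)"
  using assms unfolding riemannian_metric_def by (elim conjE) blast

lemma metric_pos:
  assumes "riemannian_metric A g" "c \<in> A" "p \<in> fst c" "v \<noteq> 0"
  shows "g c p v v > 0"
  using assms unfolding riemannian_metric_def by (elim conjE) blast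

lemma metric_change_chart:
  assumes "riemannian_metric A g" and c: "c \<in> A" and d: "d \<in> A" and q: "q \<in> fst c" "q \<in> fst d"
  shows "g d q (frechet_derivative (snd d \<circ> chart_inv c) (at (snd c q)) v)
               (frechet_derivative (snd d \<circ> chart_inv c) (at (snd c q)) v) = g c q v v"
proof -
  have "\<forall>c\<in>A. \<forall>d\<in>A. \<forall>p\<in>fst c \<inter> fst d. \<forall>v w.
      g c p v w = g d p (frechet_derivative (snd d \<circ> chart_inv c) (at (snd c p)) v)
                        (frechet_derivative (snd d \<circ> chart_inv c) (at (snd c p)) w)"
    using assms(1) unfolding riemannian_metric_def by (elim conjE)
  from this[rule_format, OF c d, of q v v] q show ?thesis by simp
qed

lemma metric_nonneg:
  assumes "riemannian_metric A g" "c \<in> A" "p \<in> fst c"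
  shows "g c p v v \<ge> 0"
proof (cases "v = 0")
  case True
  then show ?thesis by (simp add: bilinear_lzero[OF metric_bilinear[OF assms]])
next
  case False
  then show ?thesis using metric_pos[OF assms] by (simp add: less_imp_le)
qed

lemma curve_speed_nonneg:
  assumes "smooth_atlas A" "riemannian_metric A g"
  shows "curve_speed A g \<gamma> t \<ge> 0"
proof -
  have "\<exists>c. c \<in> A \<and> \<gamma> t \<in> fst c"
    using atlas_cover[OF assms(1)] by metis
  from someI_ex[OF this] show ?thesis
    unfolding curve_speed_def Let_def by (auto intro: metric_nonneg[OF assms(2)])
qed

text \<open>A metric has smooth entries for fixed vectors; expanding both arguments in
  \<open>B\<close> turns this into joint continuity in base point and vector.\<close>

lemma metric_continuous:
  fixes A :: "('m::topological_space, 'e::real_inner) atlas"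
  assumes B: "onb (B :: 'e set)" and A: "smooth_atlas A" and g: "riemannian_metric A g" and c: "c \<in> A"
  shows "continuous_on (chart_image c \<times> UNIV) (\<lambda>(y, v). g c (chart_inv c y) v v)"
proof -
  have eq: "g c (chart_inv c y) v v =
      (\<Sum>(b, b')\<in>B \<times> B. (v \<bullet> b) * (v \<bullet> b') * g c (chart_inv c y) b b')"
    if "y \<in> chart_image c" for y v
  proof -
    have bl: "bilinear (g c (chart_inv c y))"
      by (rule metric_bilinear[OF g c chart_inv_in[OF A c that]])
    have "g c (chart_inv c y) v v =
        g c (chart_inv c y) (\<Sum>b\<in>B. (v \<bullet> b) *\<^sub>R b) (\<Sum>b\<in>B. (v \<bullet> b) *\<^sub>R b)"
      using B by (simp add: onb_def)
    also have "\<dots> = (\<Sum>(b, b')\<in>B \<times> B. (v \<bullet> b) * (v \<bullet> b') * g c (chart_inv c y) b b')"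
      unfolding bilinear_sum[OF bl]
      by (intro sum.cong) (auto simp: bilinear_lmul[OF bl] bilinear_rmul[OF bl])
    finally show ?thesis .
  qed
  have smooth: "smooth_on (chart_image c) (\<lambda>y. g c (chart_inv c y) b b')" for b b'
    using g c unfolding riemannian_metric_def by blast
  have entry: "continuous_on (chart_image c) (\<lambda>y. g c (chart_inv c y) b b')" for b b'
    using smooth[of b b'] unfolding smooth_on_def by (metis Ck_on.simps(1))
  have "continuous_on (chart_image c \<times> UNIV)
      (\<lambda>p. \<Sum>q\<in>B \<times> B. (snd p \<bullet> fst q) * (snd p \<bullet> snd q) * g c (chart_inv c (fst p)) (fst q) (snd q))"
    by (intro continuous_intros continuous_on_compose2[OF entry]) auto
  then show ?thesis
    by (rule continuous_on_eq) (auto simp: eq split_beta)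
qed

text \<open>The metric attains a positive minimum \<open>a\<close> on the product of
  \<open>K\<close> with the compact unit sphere; homogeneity of degree 2 yields
  \<open>m = sqrt a\<close>.\<close>

lemma metric_coercive:
  fixes A :: "('m::topological_space, 'e::{real_inner, heine_borel}) atlas"
  assumes B: "onb (B :: 'e set)" and A: "smooth_atlas A" and g: "riemannian_metric A g" and c: "c \<in> A"
    and K: "compact K" "K \<subseteq> chart_image c"
  obtains m where "m > 0" "\<And>y v. y \<in> K \<Longrightarrow> m * norm v \<le> sqrt (g c (chart_inv c y) v v)"
proof -
  let ?S = "{v :: 'e. norm v = 1}"
  let ?G = "\<lambda>(y, v). g c (chart_inv c y) v v"
  have "closed ?S" by (intro closed_Collect_eq continuous_intros)
  moreover have "bounded ?S" by (auto simp: bounded_iff)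
  ultimately have "compact (K \<times> ?S)"
    using K(1) by (intro compact_Times) (simp_all add: compact_eq_bounded_closed)
  moreover have "continuous_on (K \<times> ?S) ?G"
    by (rule continuous_on_subset[OF metric_continuous[OF B A g c]]) (use K in auto)
  ultimately have "\<exists>a>0. \<forall>p\<in>K \<times> ?S. a \<le> ?G p"
  proof (cases "K \<times> ?S = {}")
    \<comment> \<open>Either \<open>K\<close> is empty or the model space has dimension 0, and any
      positive constant serves.\<close>
    case True
    then show ?thesis by (metis empty_iff zero_less_one)
  next
    case False
    assume "compact (K \<times> ?S)" "continuous_on (K \<times> ?S) ?G"
    then obtain p where p: "p \<in> K \<times> ?S" "\<forall>q\<in>K \<times> ?S. ?G p \<le> ?G q"
      using continuous_attains_inf False by meson
    obtain y v where yv: "p = (y, v)" "y \<in> K" "norm v = 1"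
      using p(1) by auto
    then have "v \<noteq> 0" by auto
    then have "?G p > 0"
      using metric_pos[OF g c chart_inv_in[OF A c, of y]] K(2) yv by auto
    then show ?thesis using p(2) by blast
  qed
  then obtain a where a: "a > 0" "\<And>p. p \<in> K \<times> ?S \<Longrightarrow> a \<le> ?G p"
    by blast
  show ?thesis
  proof
    show "sqrt a > 0" using a by simp
    fix y v assume y: "y \<in> K"
    have bl: "bilinear (g c (chart_inv c y))"
      using metric_bilinear[OF g c chart_inv_in[OF A c, of y]] K(2) y by blast
    have "a * (norm v)\<^sup>2 \<le> g c (chart_inv c y) v v"
    proof (cases "v = 0")
      case False
      have "g c (chart_inv c y) v v = g c (chart_inv c y) (norm v *\<^sub>R sgn v) (norm v *\<^sub>R sgn v)"
        using False by (simp add: sgn_div_norm)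
      also have "\<dots> = (norm v)\<^sup>2 * g c (chart_inv c y) (sgn v) (sgn v)"
        unfolding bilinear_lmul[OF bl] bilinear_rmul[OF bl] by (simp add: power2_eq_square)
      finally show ?thesis
        using a(2)[of "(y, sgn v)"] y False by (simp add: norm_sgn mult.commute mult_left_mono)
    qed (simp add: bilinear_lzero[OF bl])
    then have "sqrt (a * (norm v)\<^sup>2) \<le> sqrt (g c (chart_inv c y) v v)"
      by (rule real_sqrt_le_mono)
    then show "sqrt a * norm v \<le> sqrt (g c (chart_inv c y) v v)"
      by (simp add: real_sqrt_mult)
  qed
qed

text \<open>\<open>curve_speed\<close> uses a chart selected by \<open>SOME\<close>; the
  transformation law of the metric allows computing it in any chart around the point.\<close>

lemma curve_speed_eq:
  assumes A: "smooth_atlas A" and g: "riemannian_metric A g" and c: "c \<in> A" "\<gamma> t \<in> fst c"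
    and cont: "continuous (at t) \<gamma>" and v: "((snd c \<circ> \<gamma>) has_vector_derivative v) (at t)"
  shows "curve_speed A g \<gamma> t = sqrt (g c (\<gamma> t) v v)"
proof -
  define d where "d = (SOME c. c \<in> A \<and> \<gamma> t \<in> fst c)"
  have d: "d \<in> A" "\<gamma> t \<in> fst d"
    unfolding d_def using someI[of "\<lambda>c. c \<in> A \<and> \<gamma> t \<in> fst c" c] c by auto
  let ?w = "frechet_derivative (snd d \<circ> chart_inv c) (at (snd c (\<gamma> t))) v"
  have "((snd d \<circ> \<gamma>) has_vector_derivative ?w) (at t)"
    using velocity_change_chart[OF A c(1) d(1) c(2) d(2) cont UNIV_I v] .
  then have "curve_speed A g \<gamma> t = sqrt (g d (\<gamma> t) ?w ?w)"
    unfolding curve_speed_def d_def[symmetric] Let_def by (simp only: vector_derivative_at)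
  then show ?thesis
    by (simp add: metric_change_chart[OF g c(1) d(1) c(2) d(2)])
qed

text \<open>\<open>curve_speed\<close> involves two-sided derivatives, which are uncontrolled at
  \<open>a\<close> and \<open>b\<close>. It is compared with a function \<open>s\<close> built from
  the derivatives within \<open>{a..b}\<close>, which is continuous and can differ from it only at
  these two points.\<close>

lemma curve_speed_integrable_segment:
  fixes A :: "('m::topological_space, 'e::{real_inner, heine_borel}) atlas"
  assumes B: "onb (B :: 'e set)" and A: "smooth_atlas A" and g: "riemannian_metric A g"
    and \<gamma>: "C1_curve_on A \<gamma> {a..b}" and ab: "a < b"
  shows "curve_speed A g \<gamma> integrable_on {a..b}"
proof -
  have cont\<gamma>: "continuous_on {a..b} \<gamma>"
    using \<gamma> unfolding C1_curve_on_def by blast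
  have "\<forall>c\<in>A. \<exists>D. (\<forall>t\<in>{a..b} \<inter> \<gamma> -` fst c. ((snd c \<circ> \<gamma>) has_vector_derivative D t) (at t within {a..b})) \<and>
                 continuous_on ({a..b} \<inter> \<gamma> -` fst c) D"
    using \<gamma> unfolding C1_curve_on_def by blast
  from bchoice[OF this] obtain D where D': "\<forall>c\<in>A. (\<forall>t\<in>{a..b} \<inter> \<gamma> -` fst c. ((snd c \<circ> \<gamma>) has_vector_derivative D c t) (at t within {a..b})) \<and>
                 continuous_on ({a..b} \<inter> \<gamma> -` fst c) (D c)" ..
  have D: "((snd c \<circ> \<gamma>) has_vector_derivative D c t) (at t within {a..b})"
    if "c \<in> A" "t \<in> {a..b} \<inter> \<gamma> -` fst c" for c t
    by (rule bspec[OF conjunct1[OF bspec[OF D' that(1)]] that(2)])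
  have contD: "continuous_on ({a..b} \<inter> \<gamma> -` fst c) (D c)" if "c \<in> A" for c
    using bspec[OF D' that] by (rule conjunct2)
  define ch where "ch t = (SOME c. c \<in> A \<and> \<gamma> t \<in> fst c)" for t
  have ch: "ch t \<in> A" "\<gamma> t \<in> fst (ch t)" for t
  proof -
    have "\<exists>c. c \<in> A \<and> \<gamma> t \<in> fst c"
      using atlas_cover[OF A] by metis
    from someI_ex[OF this] show "ch t \<in> A" "\<gamma> t \<in> fst (ch t)"
      by (auto simp: ch_def)
  qed
  define s where "s t = sqrt (g (ch t) (\<gamma> t) (D (ch t) t) (D (ch t) t))" for t
  \<comment> \<open>Derivatives within a nondegenerate interval are unique, so \<open>s\<close> does
    not depend on the chart.\<close>
  have s_eq: "s t = sqrt (g c (\<gamma> t) (D c t) (D c t))"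
    if c: "c \<in> A" and t: "t \<in> {a..b} \<inter> \<gamma> -` fst c" for c t
  proof -
    have cont: "continuous (at t within {a..b}) \<gamma>"
      using cont\<gamma> t by (simp add: continuous_on_eq_continuous_within)
    have "((snd (ch t) \<circ> \<gamma>) has_vector_derivative
        frechet_derivative (snd (ch t) \<circ> chart_inv c) (at (snd c (\<gamma> t))) (D c t)) (at t within {a..b})"
      by (rule velocity_change_chart[OF A c ch(1) _ ch(2) cont _ D[OF c t]]) (use t in auto)
    moreover have "((snd (ch t) \<circ> \<gamma>) has_vector_derivative D (ch t) t) (at t within {a..b})"
      by (rule D[OF ch(1)]) (use t ch in auto)
    ultimately have "frechet_derivative (snd (ch t) \<circ> chart_inv c) (at (snd c (\<gamma> t))) (D c t) = D (ch t) t"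
      using vector_derivative_unique_within_closed_interval[OF ab] t by auto
    then show ?thesis
      unfolding s_def using metric_change_chart[OF g c ch(1), of "\<gamma> t" t "D c t"] t ch(2) by auto
  qed
  have "continuous (at t0 within {a..b}) s" if t0: "t0 \<in> {a..b}" for t0
  proof -
    let ?c = "ch t0"
    let ?T = "{a..b} \<inter> \<gamma> -` fst ?c"
    have "continuous_on ?T (\<lambda>t. (snd ?c (\<gamma> t), D ?c t))"
      by (intro continuous_intros contD ch(1) continuous_on_compose2[OF chart_continuous[OF A ch(1)]]
          continuous_on_subset[OF cont\<gamma>]) auto
    then have "continuous_on ?T (\<lambda>t. (\<lambda>(y, v). g ?c (chart_inv ?c y) v v) (snd ?c (\<gamma> t), D ?c t))"
      by (rule continuous_on_compose2[OF metric_continuous[OF B A g ch(1)]]) auto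
    then have "continuous_on ?T (\<lambda>t. sqrt ((\<lambda>(y, v). g ?c (chart_inv ?c y) v v) (snd ?c (\<gamma> t), D ?c t)))"
      by (rule continuous_on_real_sqrt)
    then have "continuous_on ?T s"
      by (rule continuous_on_eq) (auto simp: s_eq[OF ch(1)] chart_inv_chart[OF A ch(1)])
    then have "continuous (at t0 within ?T) s"
      using t0 ch(2) by (simp add: continuous_on_eq_continuous_within)
    \<comment> \<open>The parameters at which the curve lies in the chart form a relatively open
      set, so continuity on \<open>?T\<close> is continuity on the interval at
      \<open>t0\<close>.\<close>
    moreover obtain U where "open U" "U \<inter> {a..b} = \<gamma> -` fst ?c \<inter> {a..b}"
      using cont\<gamma> chart_open[OF A ch(1)] unfolding continuous_on_open_invariant by metis
    then have "at t0 within ?T = at t0 within {a..b}"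
      using t0 ch(2)[of t0] by (intro at_within_nhd[of _ U]) auto
    ultimately show ?thesis by simp
  qed
  then have "continuous_on {a..b} s"
    by (simp add: continuous_on_eq_continuous_within)
  then have "s integrable_on {a..b}"
    by (rule integrable_continuous_real)
  then show ?thesis
  proof (rule integrable_spike_finite[rotated -1, of _ _ "{a, b}"])
    fix t assume t: "t \<in> {a..b} - {a, b}"
    then have at: "at t within {a..b} = at t"
      by (intro at_within_interior) (simp add: interior_atLeastAtMost_real)
    show "curve_speed A g \<gamma> t = s t"
      unfolding s_def
    proof (rule curve_speed_eq[OF A g ch])
      show "continuous (at t) \<gamma>"
        using cont\<gamma> t at by (metis DiffD1 continuous_on_eq_continuous_within)
      show "((snd (ch t) \<circ> \<gamma>) has_vector_derivative D (ch t) t) (at t)"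
        using D[OF ch(1), of t t] t ch(2) at by simp
    qed
  qed simp
qed



section \<open>Length of piecewise C^1 curves\<close>

lemma partition_le_and_cover:
  fixes t :: "nat \<Rightarrow> real"
  assumes "\<And>i. i < n \<Longrightarrow> t i < t (Suc i)" "k \<le> n"
  shows "t 0 \<le> t k" and "{t 0..t k} - t ` {..k} \<subseteq> (\<Union>i<k. {t i<..<t (Suc i)})"
proof -
  have "t 0 \<le> t k \<and> {t 0..t k} - t ` {..k} \<subseteq> (\<Union>i<k. {t i<..<t (Suc i)})"
    using assms(2)
  proof (induction k)
    case (Suc k)
    then have IH: "t 0 \<le> t k" "{t 0..t k} - t ` {..k} \<subseteq> (\<Union>i<k. {t i<..<t (Suc i)})"
      by auto
    have lt: "t k < t (Suc k)" using assms(1) Suc.prems by simp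
    have "x \<in> (\<Union>i<Suc k. {t i<..<t (Suc i)})" if x: "x \<in> {t 0..t (Suc k)} - t ` {..Suc k}" for x
    proof (cases "x \<le> t k")
      case True
      then have "x \<in> {t 0..t k} - t ` {..k}" using x by auto
      then show ?thesis using IH(2) by fastforce
    next
      case False
      then have "x \<in> {t k<..<t (Suc k)}" using x by (auto simp: less_le)
      then show ?thesis by blast
    qed
    then show ?case using IH(1) lt by auto
  qed auto
  then show "t 0 \<le> t k" "{t 0..t k} - t ` {..k} \<subseteq> (\<Union>i<k. {t i<..<t (Suc i)})" by auto
qed

lemma piecewise_C1_curve_continuous:
  assumes "piecewise_C1_curve A \<gamma>"
  shows "continuous_on {0..1} \<gamma>"
proof -
  obtain n t where t: "t 0 = 0" "t n = 1" "\<And>i. i < n \<Longrightarrow> t i < t (Suc i)"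
      "\<And>i. i < n \<Longrightarrow> C1_curve_on A \<gamma> {t i..t (Suc i)}"
    using assms unfolding piecewise_C1_curve_def by blast
  have "k \<le> n \<Longrightarrow> continuous_on {t 0..t k} \<gamma>" for k
  proof (induction k)
    case (Suc k)
    have "t 0 \<le> t k" "t k \<le> t (Suc k)"
      using partition_le_and_cover(1)[of n t k] t(3)[of k] t(3) Suc.prems by (simp_all add: less_imp_le)
    then have "{t 0..t (Suc k)} = {t 0..t k} \<union> {t k..t (Suc k)}"
      by (intro ivl_disj_un_two_touch(4)[symmetric])
    moreover have "continuous_on {t k..t (Suc k)} \<gamma>"
      using t(4)[of k] Suc.prems unfolding C1_curve_on_def by auto
    ultimately show ?case
      using Suc by (simp add: continuous_on_closed_Un)
  qed auto
  from this[of n] show ?thesis using t by simp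
qed

lemma curve_speed_integrable:
  fixes A :: "('m::topological_space, 'e::{real_inner, heine_borel}) atlas"
  assumes B: "onb (B :: 'e set)" and A: "smooth_atlas A" and g: "riemannian_metric A g"
    and \<gamma>: "piecewise_C1_curve A \<gamma>"
  shows "curve_speed A g \<gamma> integrable_on {0..1}"
proof -
  obtain n t where t: "t 0 = 0" "t n = 1" "\<And>i. i < n \<Longrightarrow> t i < t (Suc i)"
      "\<And>i. i < n \<Longrightarrow> C1_curve_on A \<gamma> {t i..t (Suc i)}"
    using \<gamma> unfolding piecewise_C1_curve_def by blast
  have "k \<le> n \<Longrightarrow> curve_speed A g \<gamma> integrable_on {t 0..t k}" for k
  proof (induction k)
    case (Suc k)
    have "t 0 \<le> t k" "t k < t (Suc k)"
      using partition_le_and_cover(1)[of n t k] t(3) Suc.prems by auto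
    moreover have "curve_speed A g \<gamma> integrable_on {t k..t (Suc k)}"
      using curve_speed_integrable_segment[OF B A g t(4) t(3)] Suc.prems by auto
    ultimately show ?case
      using Suc by (intro Henstock_Kurzweil_Integration.integrable_combine[where a="t 0" and c="t k" and b="t (Suc k)"]) auto
  qed (use integrable_on_refl[of "curve_speed A g \<gamma>" "t 0"] in simp)
  from this[of n] show ?thesis using t by simp
qed

text \<open>Projecting onto the unit vector \<open>w\<close> along the displacement reduces the
  claim to dimension one: \<open>m * (snd c (\<gamma> s) \<bullet> w)\<close> grows no faster than
  the length, except at finitely many parameters. Passing from \<open>T\<close> to 1 only adds
  length, as the speed is nonnegative.\<close>

lemma curve_length_lower_bound:
  fixes A :: "('m::topological_space, 'e::{real_inner, heine_borel}) atlas"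
  assumes B: "onb (B :: 'e set)" and A: "smooth_atlas A" and g: "riemannian_metric A g"
    and \<gamma>: "piecewise_C1_curve A \<gamma>" and c: "c \<in> A"
    and m: "m > 0" "\<And>y v. y \<in> K \<Longrightarrow> m * norm v \<le> sqrt (g c (chart_inv c y) v v)"
    and T: "0 \<le> T" "T \<le> 1" and K: "\<And>s. s \<in> {0..T} \<Longrightarrow> \<gamma> s \<in> fst c \<and> snd c (\<gamma> s) \<in> K"
  shows "m * norm (snd c (\<gamma> T) - snd c (\<gamma> 0)) \<le> integral {0..1} (curve_speed A g \<gamma>)"
proof -
  obtain n t where t: "t 0 = 0" "t n = 1" "\<And>i. i < n \<Longrightarrow> t i < t (Suc i)"
      "\<And>i. i < n \<Longrightarrow> C1_curve_on A \<gamma> {t i..t (Suc i)}"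
    using \<gamma> unfolding piecewise_C1_curve_def by blast
  let ?s = "curve_speed A g \<gamma>" and ?S = "t ` {..n}"
  \<comment> \<open>For zero displacement \<open>sgn\<close> gives \<open>w = 0\<close>, which makes
    the final identity hold as well.\<close>
  define w where "w = sgn (snd c (\<gamma> T) - snd c (\<gamma> 0))"
  define v where "v s = vector_derivative (snd c \<circ> \<gamma>) (at s)" for s
  \<comment> \<open>At the break points and at the ends no two-sided derivative is available; the
    value 0 keeps \<open>f'\<close> below the speed there.\<close>
  define f' where "f' s = (if s \<in> ?S \<union> {0, T} then 0 else m * (v s \<bullet> w))" for s
  have contT: "continuous_on {0..T} \<gamma>"
    by (rule continuous_on_subset[OF piecewise_C1_curve_continuous[OF \<gamma>]]) (use T in auto)
  have s: "((snd c \<circ> \<gamma>) has_vector_derivative v s) (at s)" "m * norm (v s) \<le> ?s s"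
    if "s \<in> {0<..<T} - ?S" for s
  proof -
    have "s \<in> {t 0..t n} - ?S" using that T t by auto
    then obtain i where i: "i < n" "s \<in> {t i<..<t (Suc i)}"
      using partition_le_and_cover(2)[of n t n] t(3) by blast
    have sc: "\<gamma> s \<in> fst c" "snd c (\<gamma> s) \<in> K" using K[of s] that by auto
    \<comment> \<open>On the open piece, derivatives within the piece are two-sided.\<close>
    have C1: "C1_curve_on A \<gamma> {t i<..<t (Suc i)}"
      by (rule C1_curve_on_subset[OF t(4)[OF i(1)]]) auto
    have at: "at s within {t i<..<t (Suc i)} = at s"
      by (rule at_within_open[OF i(2)]) simp
    obtain u where "((snd c \<circ> \<gamma>) has_vector_derivative u) (at s)"
      using C1 c i(2) sc(1) unfolding C1_curve_on_def by (metis IntI at vimageI)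
    then show d: "((snd c \<circ> \<gamma>) has_vector_derivative v s) (at s)"
      unfolding v_def by (simp add: vector_derivative_at)
    have "continuous (at s) \<gamma>"
      using C1 i(2) unfolding C1_curve_on_def by (metis at continuous_on_eq_continuous_within)
    then have "?s s = sqrt (g c (\<gamma> s) (v s) (v s))"
      using curve_speed_eq[OF A g c sc(1) _ d] by simp
    then show "m * norm (v s) \<le> ?s s"
      using m(2)[OF sc(2), of "v s"] by (simp add: chart_inv_chart[OF A c sc(1)])
  qed
  let ?h = "\<lambda>s. m * (snd c (\<gamma> s) \<bullet> w)"
  have "(f' has_integral (?h T - ?h 0)) {0..T}"
  proof (rule fundamental_theorem_of_calculus_interior_strong[of "?S \<union> {0, T}"])
    fix s assume "s \<in> {0<..<T} - (?S \<union> {0, T})"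
    then have "((snd c \<circ> \<gamma>) has_derivative (\<lambda>x. x *\<^sub>R v s)) (at s)" and f': "f' s = m * (v s \<bullet> w)"
      using s(1)[of s] by (auto simp: has_vector_derivative_def f'_def)
    from this(1) have "((\<lambda>s. m * ((snd c \<circ> \<gamma>) s \<bullet> w)) has_derivative (\<lambda>x. m * ((x *\<^sub>R v s) \<bullet> w))) (at s)"
      by (intro has_derivative_mult_right has_derivative_inner_left)
    then show "(?h has_vector_derivative f' s) (at s)"
      by (simp add: has_vector_derivative_def f' mult.left_commute)
  next
    show "continuous_on {0..T} ?h"
      by (intro continuous_intros continuous_on_compose2[OF chart_continuous[OF A c] contT]) (use K in auto)
  qed (use T in auto)
  moreover have int: "?s integrable_on {0..1}"
    by (rule curve_speed_integrable[OF B A g \<gamma>])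
  then have intT: "?s integrable_on {0..T}"
    by (rule integrable_subinterval_real) (use T in auto)
  then have "(?s has_integral integral {0..T} ?s) {0..T}"
    by (rule integrable_integral)
  moreover have "f' x \<le> ?s x" if "x \<in> {0..T}" for x
  proof (cases "x \<in> ?S \<union> {0, T}")
    case True
    then show ?thesis by (simp add: f'_def curve_speed_nonneg[OF A g])
  next
    case False
    have "v x \<bullet> w \<le> norm (v x) * norm w" by (rule norm_cauchy_schwarz)
    also have "\<dots> \<le> norm (v x)"
      by (simp add: w_def norm_sgn)
    finally have "f' x \<le> m * norm (v x)"
      using False m(1) by (simp add: f'_def)
    also have "\<dots> \<le> ?s x"
      using s(2)[of x] False that by auto
    finally show ?thesis .
  qed
  ultimately have "?h T - ?h 0 \<le> integral {0..T} ?s"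
    by (rule has_integral_le)
  also have "\<dots> \<le> integral {0..1} ?s"
    by (intro integral_subset_le) (use T intT int curve_speed_nonneg[OF A g] in auto)
  also have "?h T - ?h 0 = m * ((snd c (\<gamma> T) - snd c (\<gamma> 0)) \<bullet> w)"
    by (simp add: inner_diff_left algebra_simps)
  also have "(snd c (\<gamma> T) - snd c (\<gamma> 0)) \<bullet> w = norm (snd c (\<gamma> T) - snd c (\<gamma> 0))"
    by (cases "snd c (\<gamma> T) = snd c (\<gamma> 0)") (simp_all add: w_def sgn_div_norm dot_square_norm power2_eq_square)
  finally show ?thesis .
qed

text \<open>A non-integrable speed has integral 0 by default, so the bound holds for arbitrary
  \<open>\<gamma>\<close>.\<close>

lemma curve_length_nonneg:
  assumes "smooth_atlas A" "riemannian_metric A g"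
  shows "0 \<le> integral {0..1} (curve_speed A g \<gamma>)"
  using integral_nonneg[of "curve_speed A g \<gamma>" "{0..1}"] curve_speed_nonneg[OF assms]
  by (cases "curve_speed A g \<gamma> integrable_on {0..1}") (auto simp: not_integrable_integral)

text \<open>The infimum is attained by the constant curve.\<close>

lemma riemannian_dist_refl:
  assumes A: "smooth_atlas A" and g: "riemannian_metric A g"
  shows "riemannian_dist A g x x = 0"
proof -
  let ?L = "{integral {0..1} (curve_speed A g \<gamma>) | \<gamma>. piecewise_C1_curve A \<gamma> \<and> \<gamma> 0 = x \<and> \<gamma> 1 = x}"
  obtain c where c: "c \<in> A" "x \<in> fst c" using atlas_cover[OF A] by blast
  have "piecewise_C1_curve A (\<lambda>t. x)"
    unfolding piecewise_C1_curve_def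
    by (rule exI[of _ 1], rule exI[of _ real]) (simp add: C1_curve_on_const)
  moreover have "curve_speed A g (\<lambda>t. x) t = 0" for t
  proof -
    have "curve_speed A g (\<lambda>t. x) t = sqrt (g c x 0 0)"
      by (rule curve_speed_eq[OF A g c]) (auto simp: o_def)
    moreover have "bilinear (g c x)" using g c by (auto intro: metric_bilinear[OF g])
    ultimately show ?thesis by (simp add: bilinear_lzero)
  qed
  then have "curve_speed A g (\<lambda>t. x) = (\<lambda>t. 0)" by (rule ext)
  then have "integral {0..1} (curve_speed A g (\<lambda>t. x)) = 0" by simp
  ultimately have "0 \<in> ?L" by (intro CollectI exI[of _ "\<lambda>t. x"]) auto
  then show ?thesis
    unfolding riemannian_dist_def using curve_length_nonneg[OF A g]
    by (intro cInf_eq_minimum) auto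
qed

text \<open>A curve leaving the ball of radius \<open>r\<close> has a first exit time; up to that time it stays in the
  closed ball, where the metric dominates a multiple of the Euclidean one.\<close>

lemma curve_length_dichotomy:
  fixes A :: "('m::t2_space, 'e::{real_inner, heine_borel}) atlas"
  assumes B: "onb (B :: 'e set)" and A: "smooth_atlas A" and g: "riemannian_metric A g"
    and \<gamma>: "piecewise_C1_curve A \<gamma>" and c: "c \<in> A" and r: "r > 0" "cball z r \<subseteq> chart_image c"
    and m: "m > 0" "\<And>y v. y \<in> cball z r \<Longrightarrow> m * norm v \<le> sqrt (g c (chart_inv c y) v v)"
    and x: "\<gamma> 0 \<in> fst c" "snd c (\<gamma> 0) \<in> ball z (r / 2)"
  shows "m * r / 2 \<le> integral {0..1} (curve_speed A g \<gamma>) \<or>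
    \<gamma> 1 \<in> fst c \<and> snd c (\<gamma> 1) \<in> ball z r \<and>
    m * norm (snd c (\<gamma> 1) - snd c (\<gamma> 0)) \<le> integral {0..1} (curve_speed A g \<gamma>)"
proof -
  let ?V = "{q \<in> fst c. snd c q \<in> ball z r}" and ?K = "{q \<in> fst c. snd c q \<in> cball z r}"
  have opV: "open ?V" by (rule chart_preimage_open[OF A c]) simp
  \<comment> \<open>Compact sets are closed in the Hausdorff manifold, so limits of points of
    \<open>?K\<close> cannot leave the chart domain.\<close>
  have clK: "closed ?K"
    by (intro compact_imp_closed chart_preimage_compact[OF A c _ r(2)])
      (simp add: compact_eq_bounded_closed)
  have cont: "continuous_on {0..1} \<gamma>" by (rule piecewise_C1_curve_continuous[OF \<gamma>])
  note bound = curve_length_lower_bound[OF B A g \<gamma> c m]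
  let ?E = "{0..1} \<inter> \<gamma> -` (- ?V)"
  show ?thesis
  proof (cases "?E = {}")
    case True
    then have "\<gamma> s \<in> ?V" if "s \<in> {0..1}" for s using that by blast
    then show ?thesis using bound[where T=1 and K="cball z r"] by (auto intro: less_imp_le)
  next
    case False
    have clE: "closed ?E"
      by (rule continuous_closed_preimage[OF cont closed_atLeastAtMost closed_Compl[OF opV]])
    have bE: "bdd_below ?E" by (rule bdd_belowI[of _ 0]) auto
    define T where "T = Inf ?E"
    have T: "T \<in> ?E" unfolding T_def by (rule closed_contains_Inf[OF False bE clE])
    have before: "\<gamma> s \<in> ?V" if "0 \<le> s" "s < T" for s
    proof (rule ccontr)
      assume "\<gamma> s \<notin> ?V"
      then have "s \<in> ?E" using that T by auto
      then have "T \<le> s" unfolding T_def by (rule cInf_lower[OF _ bE])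
      then show False using that by simp
    qed
    have "T \<noteq> 0" using T x r(1) by (auto simp: dist_norm)
    then have T0: "T > 0" using T by auto
    have "\<gamma> T \<in> ?K"
    proof (rule Lim_in_closed_set[OF clK])
      show "(\<gamma> \<longlongrightarrow> \<gamma> T) (at_left T)"
      proof -
        have "(\<gamma> \<longlongrightarrow> \<gamma> T) (at T within {0..1})"
          using cont T by (auto simp: continuous_on_def)
        then have "(\<gamma> \<longlongrightarrow> \<gamma> T) (at T within {0..<T})"
          by (rule tendsto_within_subset) (use T in auto)
        moreover have "at T within {0..<T} = at_left T"
          by (rule at_within_nhd[of _ "{0<..}"]) (use T0 in auto)
        ultimately show ?thesis by simp
      qed
      show "\<forall>\<^sub>F s in at_left T. \<gamma> s \<in> ?K"
        using eventually_at_left_real[OF T0]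
      proof eventually_elim
        case (elim s)
        with before[of s] show ?case by auto
      qed
    qed simp
    then have TK: "\<gamma> T \<in> fst c" "snd c (\<gamma> T) \<in> cball z r" by auto
    have "\<gamma> s \<in> fst c \<and> snd c (\<gamma> s) \<in> cball z r" if "s \<in> {0..T}" for s
      using before[of s] TK that by (cases "s = T") (auto intro: less_imp_le)
    then have L: "m * norm (snd c (\<gamma> T) - snd c (\<gamma> 0)) \<le> integral {0..1} (curve_speed A g \<gamma>)"
      using T by (intro bound[where K="cball z r"]) auto
    \<comment> \<open>At \<open>T\<close> the curve has left the open ball but is still in the
      chart, so its coordinate distance from \<open>z\<close> is at least \<open>r\<close>; it
      started within \<open>r / 2\<close>.\<close>
    have "r \<le> dist z (snd c (\<gamma> T))"
      using T TK(1) by (auto simp: not_less)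
    also have "\<dots> \<le> dist z (snd c (\<gamma> 0)) + dist (snd c (\<gamma> 0)) (snd c (\<gamma> T))"
      by (rule dist_triangle)
    finally have "r / 2 \<le> norm (snd c (\<gamma> T) - snd c (\<gamma> 0))"
      using x(2) by (simp add: dist_norm norm_minus_commute)
    then have "m * (r / 2) \<le> m * norm (snd c (\<gamma> T) - snd c (\<gamma> 0))"
      using m(1) by simp
    with L show ?thesis by simp
  qed
qed

text \<open>A curve shorter than \<open>m * r / 2\<close> realises the second alternative of
  \<open>curve_length_dichotomy\<close>. Curves with lengths close to the infimum therefore confine
  \<open>y\<close> to the chart and bound the coordinate distance.\<close>

lemma riemannian_dist_chart:
  fixes A :: "('m::t2_space, 'e::{real_inner, heine_borel}) atlas"
  assumes M: "smooth_manifold A" and g: "riemannian_metric A g" and c: "c \<in> A"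
    and r: "r > 0" "cball z r \<subseteq> chart_image c"
  obtains m where "m > 0"
    "\<And>x y. x \<in> fst c \<Longrightarrow> snd c x \<in> ball z (r / 2) \<Longrightarrow> riemannian_dist A g x y < m * r / 2 \<Longrightarrow>
       y \<in> fst c \<and> snd c y \<in> ball z r \<and> m * norm (snd c y - snd c x) \<le> riemannian_dist A g x y"
proof -
  have A: "smooth_atlas A" using M unfolding smooth_manifold_def by blast
  obtain B :: "'e set" where B: "onb B"
    using M onb_exists unfolding smooth_manifold_def by blast
  have "compact (cball z r)" by (simp add: compact_eq_bounded_closed)
  then obtain m where m: "m > 0" "\<And>y v. y \<in> cball z r \<Longrightarrow> m * norm v \<le> sqrt (g c (chart_inv c y) v v)"
    using metric_coercive[OF B A g c _ r(2)] by metis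
  show ?thesis
  proof (rule that[OF m(1)])
    fix x y assume x: "x \<in> fst c" "snd c x \<in> ball z (r / 2)" and d: "riemannian_dist A g x y < m * r / 2"
    let ?L = "{integral {0..1} (curve_speed A g \<gamma>) | \<gamma>. piecewise_C1_curve A \<gamma> \<and> \<gamma> 0 = x \<and> \<gamma> 1 = y}"
    have ne: "?L \<noteq> {}"
    proof -
      obtain \<gamma> where "piecewise_C1_curve A \<gamma>" "\<gamma> 0 = x" "\<gamma> 1 = y"
        by (rule piecewise_C1_curve_exists[OF M])
      then have "integral {0..1} (curve_speed A g \<gamma>) \<in> ?L" by (intro CollectI exI[of _ \<gamma>] conjI refl)
      then show ?thesis by (metis empty_iff)
    qed
    \<comment> \<open>The set of lengths is nonempty, so some curve is shorter than
      \<open>\<eta>\<close>. Letting \<open>\<eta>\<close> decrease to the distance then gives the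
      sharp bound.\<close>
    have main: "y \<in> fst c \<and> snd c y \<in> ball z r \<and> m * norm (snd c y - snd c x) \<le> \<eta>"
      if \<eta>: "riemannian_dist A g x y < \<eta>" "\<eta> \<le> m * r / 2" for \<eta>
    proof -
      obtain l where "l \<in> ?L" "l < \<eta>"
        using cInf_lessD[OF ne \<eta>(1)[unfolded riemannian_dist_def]] by (rule bexE)
      then obtain \<gamma> where "piecewise_C1_curve A \<gamma>" "\<gamma> 0 = x" "\<gamma> 1 = y"
          "integral {0..1} (curve_speed A g \<gamma>) < \<eta>"
        by blast
      then show ?thesis
        using curve_length_dichotomy[OF B A g _ c r m, of \<gamma>] x \<eta>(2) by auto
    qed
    have "m * norm (snd c y - snd c x) \<le> riemannian_dist A g x y"
    proof (rule ccontr)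
      assume "\<not> ?thesis"
      then obtain \<eta> where "riemannian_dist A g x y < \<eta>" "\<eta> < min (m * norm (snd c y - snd c x)) (m * r / 2)"
        using dense[of "riemannian_dist A g x y" "min (m * norm (snd c y - snd c x)) (m * r / 2)"] d by auto
      then show False using main[of \<eta>] by auto
    qed
    then show "y \<in> fst c \<and> snd c y \<in> ball z r \<and> m * norm (snd c y - snd c x) \<le> riemannian_dist A g x y"
      using main[OF d] by blast
  qed
qed



section \<open>Smooth functions and differential operators\<close>

text \<open>Continuity on a compact set bounds the values, without which \<open>Sup\<close> carries
  no information.\<close>

lemma sup_abs_on_upper:
  assumes "compact K" "continuous_on K f" "x \<in> K"
  shows "\<bar>f x\<bar> \<le> sup_abs_on K f"
proof -
  have "compact ((\<lambda>x. \<bar>f x\<bar>) ` K)"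
    using assms(1,2) by (intro compact_continuous_image continuous_intros)
  then have "bdd_above (insert 0 ((\<lambda>x. \<bar>f x\<bar>) ` K))"
    by (simp add: bounded_imp_bdd_above compact_imp_bounded)
  then show ?thesis
    unfolding sup_abs_on_def using assms(3) by (intro cSup_upper) auto
qed

lemma sup_abs_on_nonneg:
  assumes "compact K" "continuous_on K f"
  shows "0 \<le> sup_abs_on K f"
proof (cases "K = {}")
  case False
  then obtain x where "x \<in> K" by blast
  then show ?thesis using sup_abs_on_upper[OF assms, of x] by linarith
qed (simp add: sup_abs_on_def)

lemma sup_abs_on_least:
  assumes "0 \<le> C" "\<And>x. x \<in> K \<Longrightarrow> \<bar>f x\<bar> \<le> C"
  shows "sup_abs_on K f \<le> C"
  unfolding sup_abs_on_def by (rule cSup_least) (use assms in auto)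

lemma continuous_via_charts:
  assumes A: "smooth_atlas (A :: ('m::t2_space, 'e::real_normed_vector) atlas)"
    and f: "\<And>c. c \<in> A \<Longrightarrow> continuous_on (chart_image c) (f \<circ> chart_inv c)"
  shows "continuous_on UNIV f"
proof -
  have "isCont f q" for q
  proof -
    obtain c where c: "c \<in> A" "q \<in> fst c" using atlas_cover[OF A] by blast
    have "continuous_on (fst c) (\<lambda>p. (f \<circ> chart_inv c) (snd c p))"
      by (rule continuous_on_compose2[OF f[OF c(1)] chart_continuous[OF A c(1)]]) auto
    then have "continuous_on (fst c) f"
      by (rule continuous_on_eq) (simp add: chart_inv_chart[OF A c(1)])
    then show ?thesis
      using c(2) chart_open[OF A c(1)] continuous_on_eq_continuous_at by blast
  qed
  then show ?thesis by (simp add: continuous_on_eq_continuous_at)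
qed

lemma smooth_functions_Ck:
  assumes "f \<in> smooth_functions A" "c \<in> A"
  shows "Ck_on k (chart_image c) (f \<circ> chart_inv c)"
  using assms unfolding smooth_functions_def smooth_on_def by blast

lemma smooth_functions_continuous:
  assumes "smooth_atlas (A :: ('m::t2_space, 'e::real_normed_vector) atlas)" "f \<in> smooth_functions A"
  shows "continuous_on K f"
proof -
  have "continuous_on UNIV f"
    by (rule continuous_via_charts[OF assms(1)])
      (use smooth_functions_Ck[OF assms(2), of _ 0] in simp)
  then show ?thesis by (rule continuous_on_subset) simp
qed

lemma smooth_functions_diff:
  assumes "smooth_atlas A" "f \<in> smooth_functions A" "f' \<in> smooth_functions A"
  shows "(\<lambda>x. f x - f' x) \<in> smooth_functions A"
proof -
  have "Ck_on k (chart_image c) ((\<lambda>x. f x - f' x) \<circ> chart_inv c)" if "c \<in> A" for c k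
    using Ck_on_diff[OF chart_image_open[OF assms(1) that] smooth_functions_Ck[OF assms(2) that]
        smooth_functions_Ck[OF assms(3) that], of k]
    by (simp add: o_def)
  then show ?thesis
    unfolding smooth_functions_def smooth_on_def by blast
qed

text \<open>Both functions satisfy \<open>has_derivative\<close> at \<open>x\<close> for the same
  maps, so the selected values coincide even where no derivative exists.\<close>

lemma frechet_derivative_cong_open:
  assumes "open S" "x \<in> S" "\<And>y. y \<in> S \<Longrightarrow> f y = f' y"
  shows "frechet_derivative f (at x) = frechet_derivative f' (at x)"
proof -
  have "(f has_derivative D) (at x) \<longleftrightarrow> (f' has_derivative D) (at x)" for D
    using has_derivative_transform_within_open[of f D x UNIV S f', OF _ assms(1,2)]
      has_derivative_transform_within_open[of f' D x UNIV S f, OF _ assms(1,2)] assms(3)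
    by metis
  then show ?thesis
    unfolding frechet_derivative_def by simp
qed

section \<open>Iterated derivatives and differential operators\<close>

lemma iterated_dderiv_cong:
  assumes "open S" "y \<in> S" "\<And>y. y \<in> S \<Longrightarrow> f y = f' y"
  shows "iterated_dderiv \<alpha> f y = iterated_dderiv \<alpha> f' y"
  using assms(3)
proof (induction \<alpha> arbitrary: f f')
  case (Cons v \<alpha>)
  have "iterated_dderiv \<alpha> (\<lambda>x. frechet_derivative f (at x) v) y =
      iterated_dderiv \<alpha> (\<lambda>x. frechet_derivative f' (at x) v) y"
  proof (rule Cons.IH)
    fix z assume "z \<in> S"
    then have "frechet_derivative f (at z) = frechet_derivative f' (at z)"
      by (rule frechet_derivative_cong_open[OF assms(1)]) (rule Cons.prems)
    then show "frechet_derivative f (at z) v = frechet_derivative f' (at z) v" by simp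
  qed
  then show ?case by simp
qed (use assms(2) in simp)

lemma Ck_on_iterated_dderiv:
  "Ck_on (length \<alpha> + k) S f \<Longrightarrow> Ck_on k S (iterated_dderiv \<alpha> f)"
  by (induction \<alpha> arbitrary: f) auto

lemma iterated_dderiv_diff:
  assumes "open S" "y \<in> S" "Ck_on (length \<alpha>) S f" "Ck_on (length \<alpha>) S f'"
  shows "iterated_dderiv \<alpha> (\<lambda>x. f x - f' x) y = iterated_dderiv \<alpha> f y - iterated_dderiv \<alpha> f' y"
  using assms(3,4)
proof (induction \<alpha> arbitrary: f f')
  case (Cons v \<alpha>)
  let ?D = "\<lambda>f x. frechet_derivative f (at x) v"
  have Ck: "Ck_on (Suc (length \<alpha>)) S f" "Ck_on (Suc (length \<alpha>)) S f'"
    using Cons.prems by simp_all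
  have "?D (\<lambda>x. f x - f' x) x = ?D f x - ?D f' x" if "x \<in> S" for x
    using has_derivative_diff[OF Ck_on_SucD[OF Ck(1) that] Ck_on_SucD[OF Ck(2) that]]
    by (metis frechet_derivative_at)
  then have "iterated_dderiv \<alpha> (?D (\<lambda>x. f x - f' x)) y = iterated_dderiv \<alpha> (\<lambda>x. ?D f x - ?D f' x) y"
    by (intro iterated_dderiv_cong[OF assms(1,2)])
  also have "\<dots> = iterated_dderiv \<alpha> (?D f) y - iterated_dderiv \<alpha> (?D f') y"
    using Ck by (intro Cons.IH) auto
  finally show ?case by simp
qed simp

text \<open>Linearity is read off from the coordinate formula that defines \<open>P\<close> on
  smooth functions, in one chart around \<open>q\<close>.\<close>

lemma linear_diff_op_diff:
  assumes A: "smooth_atlas A" and P: "linear_diff_op A P"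
    and f: "f \<in> smooth_functions A" "f' \<in> smooth_functions A"
  shows "P (\<lambda>x. f x - f' x) q = P f q - P f' q"
proof -
  obtain B m a where a: "\<forall>f\<in>smooth_functions A. \<forall>c\<in>A. \<forall>y\<in>chart_image c.
      P f (chart_inv c y) = (\<Sum>\<alpha> | set \<alpha> \<subseteq> B \<and> length \<alpha> \<le> m. a c \<alpha> y * iterated_dderiv \<alpha> (f \<circ> chart_inv c) y)"
    using P unfolding linear_diff_op_def by (elim exE conjE) (rule that)
  obtain c where c: "c \<in> A" "q \<in> fst c" using atlas_cover[OF A] by blast
  let ?y = "snd c q"
  have y: "?y \<in> chart_image c" using c by simp
  have Pq: "P h q = (\<Sum>\<alpha> | set \<alpha> \<subseteq> B \<and> length \<alpha> \<le> m. a c \<alpha> ?y * iterated_dderiv \<alpha> (h \<circ> chart_inv c) ?y)"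
    if "h \<in> smooth_functions A" for h
    using a[rule_format, OF that c(1) y] by (simp only: chart_inv_chart[OF A c])
  have "iterated_dderiv \<alpha> ((\<lambda>x. f x - f' x) \<circ> chart_inv c) ?y =
      iterated_dderiv \<alpha> (f \<circ> chart_inv c) ?y - iterated_dderiv \<alpha> (f' \<circ> chart_inv c) ?y" for \<alpha>
    using iterated_dderiv_diff[OF chart_image_open[OF A c(1)] y
        smooth_functions_Ck[OF f(1) c(1)] smooth_functions_Ck[OF f(2) c(1)]]
    by (simp add: o_def)
  then show ?thesis
    unfolding Pq[OF smooth_functions_diff[OF A f]] Pq[OF f(1)] Pq[OF f(2)]
    by (simp add: right_diff_distrib sum_subtractf)
qed

text \<open>Makes the supremum of \<open>P f\<close> over a compact set meaningful.\<close>

lemma linear_diff_op_continuous: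
  assumes A: "smooth_atlas (A :: ('m::t2_space, 'e::real_normed_vector) atlas)"
    and P: "linear_diff_op A P" and f: "f \<in> smooth_functions A"
  shows "continuous_on K (P f)"
proof -
  obtain B m a where sm: "\<forall>c\<in>A. \<forall>\<alpha>. smooth_on (chart_image c) (a c \<alpha>)"
    and a: "\<forall>f\<in>smooth_functions A. \<forall>c\<in>A. \<forall>y\<in>chart_image c.
      P f (chart_inv c y) = (\<Sum>\<alpha> | set \<alpha> \<subseteq> B \<and> length \<alpha> \<le> m. a c \<alpha> y * iterated_dderiv \<alpha> (f \<circ> chart_inv c) y)"
    using P unfolding linear_diff_op_def by (elim exE conjE) (rule that)
  have "continuous_on (chart_image c) (P f \<circ> chart_inv c)" if c: "c \<in> A" for c
  proof -
    have "continuous_on (chart_image c) (a c \<alpha>)" for \<alpha>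
      using sm c unfolding smooth_on_def by (metis Ck_on.simps(1))
    moreover have "continuous_on (chart_image c) (iterated_dderiv \<alpha> (f \<circ> chart_inv c))" for \<alpha>
      using Ck_on_iterated_dderiv[OF smooth_functions_Ck[OF f c], where \<alpha>=\<alpha> and k=0] by simp
    ultimately have "continuous_on (chart_image c)
        (\<lambda>y. \<Sum>\<alpha> | set \<alpha> \<subseteq> B \<and> length \<alpha> \<le> m. a c \<alpha> y * iterated_dderiv \<alpha> (f \<circ> chart_inv c) y)"
      by (intro continuous_intros)
    then show ?thesis
      by (rule continuous_on_eq) (simp add: a[rule_format, OF f c])
  qed
  then have "continuous_on UNIV (P f)"
    by (rule continuous_via_charts[OF A])
  then show ?thesis by (rule continuous_on_subset) simp
qed

text \<open>This is the operator of order 0 with coefficient 1, whose only word is the empty one;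
  through it moderateness bounds the functions themselves.\<close>

lemma linear_diff_op_id:
  assumes "onb (B :: 'e::real_inner set)" and A: "smooth_atlas (A :: ('m::topological_space, 'e) atlas)"
  shows "linear_diff_op A (\<lambda>f. f)"
proof -
  have words: "{\<alpha> :: 'e list. \<alpha> = [] \<and> set \<alpha> \<subseteq> B} = {[]}" by auto
  have "smooth_on (chart_image c) (\<lambda>y. 1 :: real)" if "c \<in> A" for c
    unfolding smooth_on_def by (intro allI Ck_on_const chart_image_open[OF A that])
  then show ?thesis
    unfolding linear_diff_op_def
    by (intro exI[of _ B] exI[of _ 0] exI[of _ "\<lambda>_ _ _. 1"]) (use assms(1) in \<open>simp add: words onb_def conj_commute\<close>)
qed

text \<open>Moderateness only controls operators that are defined on the whole manifold.  A bump function
  turns the derivative \<open>\<partial>\<^sub>v\<close> in a chart into such an operator.\<close>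

lemma linear_diff_op_bump:
  fixes A :: "('m::t2_space, 'e::{real_inner, heine_borel}) atlas"
  assumes B: "onb (B :: 'e set)" and A: "smooth_atlas A" and c: "c \<in> A"
    and r: "cball z r \<subseteq> chart_image c" "r > 0"
  obtains P where "linear_diff_op A P"
    "\<And>f y. f \<in> smooth_functions A \<Longrightarrow> y \<in> chart_image c \<Longrightarrow>
       P f (chart_inv c y) = flat 0 (r\<^sup>2 - (y - z) \<bullet> (y - z)) * frechet_derivative (f \<circ> chart_inv c) (at y) v"
proof -
  \<comment> \<open>A cut-off that is positive on the open ball of radius \<open>r\<close> around
    \<open>z\<close> and zero elsewhere.\<close>
  define \<beta> where "\<beta> y = flat 0 (r\<^sup>2 - (y - z) \<bullet> (y - z))" for y
  have \<beta>0: "\<beta> y = 0" if "y \<notin> cball z r" for y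
  proof -
    have "r < norm (y - z)"
      using that by (simp add: dist_norm norm_minus_commute)
    then have "r\<^sup>2 < (norm (y - z))\<^sup>2"
      using r(2) by (intro power_strict_mono) auto
    then show ?thesis
      by (simp add: \<beta>_def flat_def power2_norm_eq_inner)
  qed
  define P where "P f q = (if q \<in> fst c then \<beta> (snd c q) * frechet_derivative (f \<circ> chart_inv c) (at (snd c q)) v else 0)"
    for f :: "'m \<Rightarrow> real" and q
  \<comment> \<open>\<open>W d y\<close> holds the coordinates in \<open>d\<close> of the vector
    field that is constantly \<open>v\<close> in the chart \<open>c\<close>. The coefficients
    \<open>a d\<close> below are the components of that field, cut off by \<open>\<beta>\<close>,
    and sit on one-letter words.\<close>
  define W where "W d y = frechet_derivative (snd d \<circ> chart_inv c) (at y) v" for d :: "('m, 'e) chart" and y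
  define a where "a d \<alpha> y = (if length \<alpha> = 1 \<and> chart_inv d y \<in> fst c then
      \<beta> (snd c (chart_inv d y)) * (W d (snd c (chart_inv d y)) \<bullet> hd \<alpha>) else 0)"
    for d :: "('m, 'e) chart" and \<alpha> :: "'e list" and y
  \<comment> \<open>The argument of \<open>flat 0\<close> is a polynomial in the coordinates
    \<open>y \<bullet> b\<close>.\<close>
  have \<beta>_Ck: "Ck_on k UNIV \<beta>" for k
  proof -
    have lin: "Ck_on k UNIV (\<lambda>y :: 'e. y \<bullet> b)" for b
    proof (rule Ck_on_bounded_linear[OF open_UNIV bounded_linear_inner_left])
      show "Ck_on k UNIV (\<lambda>y :: 'e. y)"
      proof (cases k)
        case (Suc j)
        show ?thesis unfolding Suc
          by (rule Ck_on_SucI[of _ _ "\<lambda>x v. v"]) (auto intro: Ck_on_const derivative_eq_intros)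
      qed simp
    qed
    have sq: "y \<bullet> y = (\<Sum>b\<in>B. (y \<bullet> b) * (y \<bullet> b))" for y :: 'e
    proof -
      have "y \<bullet> y = (\<Sum>b\<in>B. (y \<bullet> b) *\<^sub>R b) \<bullet> y"
        using B by (simp add: onb_def)
      also have "\<dots> = (\<Sum>b\<in>B. (y \<bullet> b) * (y \<bullet> b))"
        by (subst inner_sum_left) (simp only: inner_scaleR_left inner_scaleR_right inner_commute[of _ y])
      finally show ?thesis .
    qed
    have "(y - z) \<bullet> (y - z) = (\<Sum>b\<in>B. (y \<bullet> b - z \<bullet> b) * (y \<bullet> b - z \<bullet> b))" for y
      using sq[of "y - z"] by (simp only: inner_diff_left)
    then have "Ck_on k UNIV (\<lambda>y. r\<^sup>2 - (y - z) \<bullet> (y - z))"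
      using lin by (simp only:) (intro Ck_on_diff Ck_on_sum Ck_on_mult Ck_on_const open_UNIV)
    moreover have "onb {1 :: real}"
      by (auto simp: onb_def span_singleton)
    ultimately show ?thesis
      unfolding \<beta>_def by (intro Ck_on_compose[OF _ _ _ _ _ Ck_on_flat]) auto
  qed
  have a_smooth: "smooth_on (chart_image d) (a d \<alpha>)" if d: "d \<in> A" for d \<alpha>
    unfolding smooth_on_def
  proof
    fix k
    \<comment> \<open>Two open sets cover the chart image: the overlap with \<open>c\<close>, where
      the coefficient is a composition of smooth maps, and the complement of the compact set
      \<open>?K\<close>, where it vanishes.\<close>
    let ?O1 = "snd d ` (fst d \<inter> fst c)" and ?K = "{q \<in> fst c. snd c q \<in> cball z r}"
    let ?O2 = "snd d ` (fst d \<inter> - ?K)"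
    have "closed ?K"
      by (intro compact_imp_closed chart_preimage_compact[OF A c _ r(1)])
        (simp add: compact_eq_bounded_closed)
    then have op: "open ?O1" "open ?O2"
      using chart_overlap_open[OF A d] chart_open[OF A c] by blast+
    have pull: "chart_inv d y \<in> fst d \<inter> U" if "y \<in> snd d ` (fst d \<inter> U)" for y U
      using that chart_inv_chart[OF A d] by auto
    have "Ck_on k ?O1 (a d \<alpha>)"
    proof (cases "length \<alpha> = 1")
      case True
      let ?T = "snd c \<circ> chart_inv d"
      have T: "Ck_on k ?O1 ?T" by (rule transition_Ck[OF A d c])
      have im: "?T ` ?O1 \<subseteq> snd c ` (fst c \<inter> fst d)"
        using pull by fastforce
      have opc: "open (snd c ` (fst c \<inter> fst d))"
        by (rule chart_overlap_open[OF A c chart_open[OF A d]])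
      have "Ck_on (Suc k) (snd c ` (fst c \<inter> fst d)) (snd d \<circ> chart_inv c)"
        by (rule transition_Ck[OF A c d])
      then have "Ck_on k (snd c ` (fst c \<inter> fst d)) (W d)"
        unfolding W_def by simp
      then have "Ck_on k (snd c ` (fst c \<inter> fst d)) (\<lambda>y. W d y \<bullet> hd \<alpha>)"
        by (rule Ck_on_bounded_linear[OF opc bounded_linear_inner_left])
      then have "Ck_on k ?O1 (\<lambda>y. \<beta> (?T y) * (W d (?T y) \<bullet> hd \<alpha>))"
        by (intro Ck_on_mult op Ck_on_compose[OF B op(1) open_UNIV _ T \<beta>_Ck]
            Ck_on_compose[OF B op(1) opc im T]) auto
      then show ?thesis
        by (rule Ck_on_cong[OF op(1)]) (use pull True in \<open>auto simp: a_def\<close>)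
    next
      case False
      then show ?thesis
        by (intro Ck_on_cong[OF op(1) Ck_on_const[OF op(1), of _ 0]]) (auto simp: a_def)
    qed
    moreover have "Ck_on k ?O2 (a d \<alpha>)"
      by (rule Ck_on_cong[OF op(2) Ck_on_const[OF op(2), of _ 0]])
        (use pull[of _ "- ?K"] \<beta>0 in \<open>auto simp: a_def\<close>)
    moreover have "chart_image d \<subseteq> ?O1 \<union> ?O2" by auto
    ultimately show "Ck_on k (chart_image d) (a d \<alpha>)"
      using op by (intro Ck_on_local) blast
  qed
  have formula: "P f (chart_inv d y) =
      (\<Sum>\<alpha> | set \<alpha> \<subseteq> B \<and> length \<alpha> \<le> 1. a d \<alpha> y * iterated_dderiv \<alpha> (f \<circ> chart_inv d) y)"
    if f: "f \<in> smooth_functions A" and d: "d \<in> A" and y: "y \<in> chart_image d" for f d y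
  proof -
    have fin: "finite B" using B by (simp add: onb_def)
    have words: "{\<alpha>. set \<alpha> \<subseteq> B \<and> length \<alpha> \<le> 1} = insert [] ((\<lambda>b. [b]) ` B)"
      by (auto simp: le_Suc_eq length_Suc_conv)
    have "(\<Sum>\<alpha> | set \<alpha> \<subseteq> B \<and> length \<alpha> \<le> 1. a d \<alpha> y * iterated_dderiv \<alpha> (f \<circ> chart_inv d) y) =
        (\<Sum>b\<in>B. a d [b] y * frechet_derivative (f \<circ> chart_inv d) (at y) b)"
      unfolding words using fin
      by (subst sum.insert) (auto simp: sum.reindex inj_on_def a_def)
    also have "\<dots> = P f (chart_inv d y)"
    proof (cases "chart_inv d y \<in> fst c")
      case False
      then show ?thesis by (simp add: P_def a_def)
    next
      case True
      let ?q = "chart_inv d y" and ?F = "f \<circ> chart_inv d"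
      let ?x = "snd c ?q"
      have q: "?q \<in> fst d" "snd d ?q = y"
        using chart_inv_in[OF A d y] chart_chart_inv[OF A d y] by auto
      have F: "(?F has_derivative frechet_derivative ?F (at y)) (at y)"
        by (rule Ck_on_SucD[OF smooth_functions_Ck[OF f d] y])
      have T: "((snd d \<circ> chart_inv c) has_derivative frechet_derivative (snd d \<circ> chart_inv c) (at ?x)) (at ?x)"
        by (rule transition_derivative[OF A c d True q(1)])
      have Tx: "(snd d \<circ> chart_inv c) ?x = y"
        using chart_inv_chart[OF A c True] q(2) by simp
      \<comment> \<open>Read in \<open>c\<close>, the function is its expression in \<open>d\<close>
        after the transition map. The chain rule turns \<open>v\<close> into \<open>W d ?x\<close>,
        which is then expanded in \<open>B\<close>.\<close>
      have "(?F \<circ> (snd d \<circ> chart_inv c) has_derivative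
          frechet_derivative ?F (at y) \<circ> frechet_derivative (snd d \<circ> chart_inv c) (at ?x)) (at ?x)"
        by (rule diff_chain_at[OF T]) (simp only: Tx F)
      then have "((f \<circ> chart_inv c) has_derivative
          frechet_derivative ?F (at y) \<circ> frechet_derivative (snd d \<circ> chart_inv c) (at ?x)) (at ?x)"
      proof (rule has_derivative_transform_within_open)
        show "open (snd c ` (fst c \<inter> fst d))"
          by (rule chart_overlap_open[OF A c chart_open[OF A d]])
        show "?x \<in> snd c ` (fst c \<inter> fst d)" using True q(1) by simp
        show "(?F \<circ> (snd d \<circ> chart_inv c)) x = (f \<circ> chart_inv c) x" if "x \<in> snd c ` (fst c \<inter> fst d)" for x
          using that chart_inv_chart[OF A c] chart_inv_chart[OF A d] by auto
      qed
      then have "frechet_derivative (f \<circ> chart_inv c) (at ?x) v = frechet_derivative ?F (at y) (W d ?x)"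
        unfolding W_def by (metis comp_apply frechet_derivative_at)
      also have "\<dots> = (\<Sum>b\<in>B. (W d ?x \<bullet> b) *\<^sub>R frechet_derivative ?F (at y) b)"
        by (rule onb_expand[OF B has_derivative_linear[OF F]])
      finally have eq: "frechet_derivative (f \<circ> chart_inv c) (at ?x) v =
          (\<Sum>b\<in>B. (W d ?x \<bullet> b) *\<^sub>R frechet_derivative ?F (at y) b)" .
      show ?thesis
        unfolding P_def a_def eq using True by (simp add: sum_distrib_left mult.assoc)
    qed
    finally show ?thesis by simp
  qed
  show ?thesis
  proof
    show "linear_diff_op A P"
      unfolding linear_diff_op_def
      by (intro exI[of _ B] exI[of _ 1] exI[of _ a] conjI ballI allI a_smooth formula)
        (use B in \<open>auto simp: onb_def\<close>)
    show "P f (chart_inv c y) = flat 0 (r\<^sup>2 - (y - z) \<bullet> (y - z)) * frechet_derivative (f \<circ> chart_inv c) (at y) v"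
      if "y \<in> chart_image c" for f y
      unfolding P_def \<beta>_def using chart_inv_in[OF A c that] chart_chart_inv[OF A c that] by simp
  qed
qed



section \<open>Moderate and negligible nets\<close>

lemma eventually_unit_interval: "\<forall>\<^sub>F \<epsilon> in at_right (0::real). \<epsilon> \<in> {0<..1}"
  using eventually_at_right_real[of 0 "1::real"] by (auto elim: eventually_mono)

lemma negligible_net_mono:
  assumes "negligible_net s" "\<forall>\<^sub>F \<epsilon> in at_right 0. \<bar>w \<epsilon>\<bar> \<le> \<bar>s \<epsilon>\<bar>"
  shows "negligible_net w"
proof -
  have "w \<in> O[at_right 0](s)"
    by (rule landau_o.big_mono) (use assms(2) in simp)
  then show ?thesis
    using assms(1) landau_o.big_trans unfolding negligible_net_def by blast
qed

lemma moderate_order_mono: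
  assumes "moderate_order p s" "\<forall>\<^sub>F \<epsilon> in at_right 0. \<bar>w \<epsilon>\<bar> \<le> \<bar>s \<epsilon>\<bar>"
  shows "moderate_order p w"
proof -
  have "w \<in> O[at_right 0](s)"
    by (rule landau_o.big_mono) (use assms(2) in simp)
  then show ?thesis
    using assms(1) landau_o.big_trans unfolding moderate_order_def by blast
qed

lemma moderate_order_le:
  assumes "moderate_order p r" "p \<le> q"
  shows "moderate_order q r"
proof -
  have "(\<lambda>\<epsilon>. 1 / \<epsilon> ^ p) \<in> O[at_right 0](\<lambda>\<epsilon>. 1 / \<epsilon> ^ q :: real)"
  proof (rule landau_o.big_mono)
    show "\<forall>\<^sub>F \<epsilon> in at_right 0. norm (1 / \<epsilon> ^ p :: real) \<le> norm (1 / \<epsilon> ^ q)"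
      using eventually_unit_interval
      by eventually_elim (use assms(2) in \<open>auto intro!: divide_left_mono power_decreasing\<close>)
  qed
  then show ?thesis
    using assms(1) landau_o.big_trans unfolding moderate_order_def by blast
qed

lemma moderate_order_add:
  assumes "moderate_order p r" "moderate_order q s"
  shows "moderate_order (p + q) (\<lambda>\<epsilon>. r \<epsilon> + s \<epsilon>)"
  using moderate_order_le[OF assms(1), of "p + q"] moderate_order_le[OF assms(2), of "p + q"]
  unfolding moderate_order_def by (auto intro: sum_in_bigo)

lemma moderate_order_sum:
  assumes "finite I" "\<And>i. i \<in> I \<Longrightarrow> \<exists>p. moderate_order p (r i)"
  shows "\<exists>p. moderate_order p (\<lambda>\<epsilon>. \<Sum>i\<in>I. r i \<epsilon>)"
  using assms
proof (induction I rule: finite_induct)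
  case empty
  have "moderate_order 0 (\<lambda>\<epsilon>. 0)" by (simp add: moderate_order_def)
  then show ?case by auto
next
  case (insert i I)
  then obtain p q where "moderate_order p (r i)" "moderate_order q (\<lambda>\<epsilon>. \<Sum>i\<in>I. r i \<epsilon>)"
    by (metis insertCI)
  from moderate_order_add[OF this] show ?case
    using insert.hyps by auto
qed

lemma negligible_net_diff:
  assumes "negligible_net r" "negligible_net s"
  shows "negligible_net (\<lambda>\<epsilon>. r \<epsilon> - s \<epsilon>)"
  using assms unfolding negligible_net_def by (auto intro: sum_in_bigo)

lemma negligible_net_add:
  assumes "negligible_net r" "negligible_net s"
  shows "negligible_net (\<lambda>\<epsilon>. r \<epsilon> + s \<epsilon>)"
  using assms unfolding negligible_net_def by (auto intro: sum_in_bigo)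

lemma negligible_net_moderate:
  assumes "negligible_net r"
  shows "r \<in> moderate_numbers"
proof -
  have "moderate_order 0 r"
    using assms[unfolded negligible_net_def, rule_format, of 0] by (simp add: moderate_order_def)
  then show ?thesis unfolding moderate_numbers_def by blast
qed

text \<open>To reach order \<open>k\<close> for the product, the negligible factor is used at order
  \<open>p + k\<close>.\<close>

lemma moderate_mult_negligible:
  assumes "moderate_order p r" "negligible_net s"
  shows "negligible_net (\<lambda>\<epsilon>. r \<epsilon> * s \<epsilon>)"
  unfolding negligible_net_def
proof
  fix k
  have "s \<in> O[at_right 0](\<lambda>\<epsilon>. \<epsilon> ^ (p + k))"
    using assms(2) unfolding negligible_net_def by blast
  with assms(1) have "(\<lambda>\<epsilon>. r \<epsilon> * s \<epsilon>) \<in> O[at_right 0](\<lambda>\<epsilon>. 1 / \<epsilon> ^ p * \<epsilon> ^ (p + k))"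
    unfolding moderate_order_def by (rule landau_o.big.mult)
  also have "\<forall>\<^sub>F \<epsilon> in at_right 0. 1 / \<epsilon> ^ p * \<epsilon> ^ (p + k) = (\<epsilon> ^ k :: real)"
    using eventually_unit_interval by eventually_elim (simp add: power_add)
  then have "O[at_right 0](\<lambda>\<epsilon>. 1 / \<epsilon> ^ p * \<epsilon> ^ (p + k)) = O[at_right 0](\<lambda>\<epsilon>. \<epsilon> ^ k :: real)"
    by (rule landau_o.big.cong)
  finally show "(\<lambda>\<epsilon>. r \<epsilon> * s \<epsilon>) \<in> O[at_right 0](\<lambda>\<epsilon>. \<epsilon> ^ k)" .
qed

lemma negligible_net_tendsto_0:
  assumes "negligible_net s"
  shows "(s \<longlongrightarrow> 0) (at_right 0)"
proof -
  have "s \<in> O[at_right 0](\<lambda>\<epsilon>. \<epsilon> ^ 1)"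
    using assms unfolding negligible_net_def by blast
  then obtain C where "\<forall>\<^sub>F \<epsilon> in at_right 0. norm (s \<epsilon>) \<le> C * norm (\<epsilon> :: real)"
    by (auto elim: landau_o.bigE)
  moreover have "((\<lambda>\<epsilon>. C * norm (\<epsilon> :: real)) \<longlongrightarrow> 0) (at_right 0)"
    by (rule tendsto_eq_intros refl | simp)+
  ultimately show ?thesis by (rule Lim_null_comparison)
qed

section \<open>Moderate and negligible nets of functions\<close>

lemma moderate_functions_smooth:
  assumes "u \<in> moderate_functions A" "\<epsilon> \<in> {0<..1}"
  shows "u \<epsilon> \<in> smooth_functions A"
  using assms unfolding moderate_functions_def by blast

lemma moderate_functions_order:
  assumes "u \<in> moderate_functions A" "compact K" "linear_diff_op A P"
  shows "\<exists>p. moderate_order p (\<lambda>\<epsilon>. sup_abs_on K (P (u \<epsilon>)))"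
  using assms unfolding moderate_functions_def by blast

lemma sup_abs_on_diff_le:
  assumes "compact K" "continuous_on K f" "continuous_on K f'"
  shows "\<bar>sup_abs_on K (\<lambda>x. f x - f' x)\<bar> \<le> \<bar>sup_abs_on K f + sup_abs_on K f'\<bar>"
proof -
  have "sup_abs_on K (\<lambda>x. f x - f' x) \<le> sup_abs_on K f + sup_abs_on K f'"
  proof (rule sup_abs_on_least)
    show "\<bar>f x - f' x\<bar> \<le> sup_abs_on K f + sup_abs_on K f'" if "x \<in> K" for x
      using sup_abs_on_upper[OF assms(1,2) that] sup_abs_on_upper[OF assms(1,3) that] by linarith
  qed (use sup_abs_on_nonneg[OF assms(1,2)] sup_abs_on_nonneg[OF assms(1,3)] in linarith)
  moreover have "0 \<le> sup_abs_on K (\<lambda>x. f x - f' x)"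
    by (intro sup_abs_on_nonneg continuous_intros assms)
  ultimately show ?thesis by linarith
qed

lemma moderate_functions_diff:
  fixes A :: "('m::t2_space, 'e::real_normed_vector) atlas"
  assumes A: "smooth_atlas A" and u: "u \<in> moderate_functions A" and v: "v \<in> moderate_functions A"
  shows "(\<lambda>\<epsilon> x. u \<epsilon> x - v \<epsilon> x) \<in> moderate_functions A"
proof -
  have "\<exists>p. moderate_order p (\<lambda>\<epsilon>. sup_abs_on K (P (\<lambda>x. u \<epsilon> x - v \<epsilon> x)))"
    if K: "compact K" and P: "linear_diff_op A P" for K P
  proof -
    obtain p q where "moderate_order p (\<lambda>\<epsilon>. sup_abs_on K (P (u \<epsilon>)))"
        "moderate_order q (\<lambda>\<epsilon>. sup_abs_on K (P (v \<epsilon>)))"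
      using moderate_functions_order[OF u K P] moderate_functions_order[OF v K P] by blast
    then have "moderate_order (p + q) (\<lambda>\<epsilon>. sup_abs_on K (P (u \<epsilon>)) + sup_abs_on K (P (v \<epsilon>)))"
      by (rule moderate_order_add)
    moreover have "\<forall>\<^sub>F \<epsilon> in at_right 0. \<bar>sup_abs_on K (P (\<lambda>x. u \<epsilon> x - v \<epsilon> x))\<bar> \<le>
        \<bar>sup_abs_on K (P (u \<epsilon>)) + sup_abs_on K (P (v \<epsilon>))\<bar>"
      using eventually_unit_interval
    proof eventually_elim
      case (elim \<epsilon>)
      note sm = moderate_functions_smooth[OF u elim] moderate_functions_smooth[OF v elim]
      have "P (\<lambda>x. u \<epsilon> x - v \<epsilon> x) = (\<lambda>x. P (u \<epsilon>) x - P (v \<epsilon>) x)"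
        by (rule ext) (rule linear_diff_op_diff[OF A P sm])
      then show ?case
        using sup_abs_on_diff_le[OF K linear_diff_op_continuous[OF A P sm(1)] linear_diff_op_continuous[OF A P sm(2)]]
        by simp
    qed
    ultimately show ?thesis by (intro exI[of _ "p + q"]) (rule moderate_order_mono)
  qed
  moreover have "(\<lambda>x. u \<epsilon> x - v \<epsilon> x) \<in> smooth_functions A" if "\<epsilon> \<in> {0<..1}" for \<epsilon>
    by (rule smooth_functions_diff[OF A moderate_functions_smooth[OF u that] moderate_functions_smooth[OF v that]])
  ultimately show ?thesis
    unfolding moderate_functions_def by simp
qed

lemma negligible_functions_sup:
  assumes "u \<in> negligible_functions A" "compact K"
  shows "negligible_net (\<lambda>\<epsilon>. sup_abs_on K (u \<epsilon>))"
  using assms unfolding negligible_functions_def by blast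

lemma negligible_functions_moderate:
  "u \<in> negligible_functions A \<Longrightarrow> u \<in> moderate_functions A"
  unfolding negligible_functions_def by blast

lemma moderate_functions_continuous:
  fixes A :: "('m::t2_space, 'e::real_normed_vector) atlas"
  assumes "smooth_atlas A" "u \<in> moderate_functions A" "\<epsilon> \<in> {0<..1}"
  shows "continuous_on K (u \<epsilon>)"
  by (rule smooth_functions_continuous[OF assms(1) moderate_functions_smooth[OF assms(2,3)]])

lemma negligible_functions_diff:
  fixes A :: "('m::t2_space, 'e::real_normed_vector) atlas"
  assumes A: "smooth_atlas A" and u: "u \<in> negligible_functions A" and v: "v \<in> negligible_functions A"
  shows "(\<lambda>\<epsilon> x. u \<epsilon> x - v \<epsilon> x) \<in> negligible_functions A"
proof -
  note mod = negligible_functions_moderate[OF u] negligible_functions_moderate[OF v]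
  have "negligible_net (\<lambda>\<epsilon>. sup_abs_on K (\<lambda>x. u \<epsilon> x - v \<epsilon> x))" if K: "compact K" for K
  proof (rule negligible_net_mono)
    show "negligible_net (\<lambda>\<epsilon>. sup_abs_on K (u \<epsilon>) + sup_abs_on K (v \<epsilon>))"
      by (rule negligible_net_add[OF negligible_functions_sup[OF u K] negligible_functions_sup[OF v K]])
    show "\<forall>\<^sub>F \<epsilon> in at_right 0. \<bar>sup_abs_on K (\<lambda>x. u \<epsilon> x - v \<epsilon> x)\<bar> \<le> \<bar>sup_abs_on K (u \<epsilon>) + sup_abs_on K (v \<epsilon>)\<bar>"
      using eventually_unit_interval
      by eventually_elim (rule sup_abs_on_diff_le[OF K moderate_functions_continuous[OF A mod(1)]
            moderate_functions_continuous[OF A mod(2)]])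
  qed
  then show ?thesis
    using moderate_functions_diff[OF A mod] unfolding negligible_functions_def by simp
qed

text \<open>The zero net is \<open>u - u\<close> and inherits moderateness from there.\<close>

lemma zero_negligible_functions:
  fixes A :: "('m::t2_space, 'e::real_normed_vector) atlas"
  assumes "smooth_atlas A" "u \<in> moderate_functions A"
  shows "(\<lambda>\<epsilon> x. 0) \<in> negligible_functions A"
  using moderate_functions_diff[OF assms assms(2)]
  by (simp add: negligible_functions_def sup_abs_on_def image_constant_conv negligible_net_def)

lemma negligible_functions_swap:
  fixes A :: "('m::t2_space, 'e::real_normed_vector) atlas"
  assumes A: "smooth_atlas A" and w: "(\<lambda>\<epsilon> x. u \<epsilon> x - v \<epsilon> x) \<in> negligible_functions A"
  shows "(\<lambda>\<epsilon> x. v \<epsilon> x - u \<epsilon> x) \<in> negligible_functions A"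
  using negligible_functions_diff[OF A zero_negligible_functions[OF A negligible_functions_moderate[OF w]] w]
  by simp

lemma negligible_functions_trans:
  fixes A :: "('m::t2_space, 'e::real_normed_vector) atlas"
  assumes A: "smooth_atlas A" and "(\<lambda>\<epsilon> x. u \<epsilon> x - v \<epsilon> x) \<in> negligible_functions A"
    and "(\<lambda>\<epsilon> x. v \<epsilon> x - w \<epsilon> x) \<in> negligible_functions A"
  shows "(\<lambda>\<epsilon> x. u \<epsilon> x - w \<epsilon> x) \<in> negligible_functions A"
  using negligible_functions_diff[OF A assms(2) negligible_functions_swap[OF A assms(3)]] by simp

section \<open>Equivalence of representatives\<close>

lemma equiv_gen_function_rel:
  fixes A :: "('m::t2_space, 'e::real_normed_vector) atlas"
  assumes A: "smooth_atlas A"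
  shows "equiv (moderate_functions A) (gen_function_rel A)"
proof (rule equivI)
  show "gen_function_rel A \<subseteq> moderate_functions A \<times> moderate_functions A"
    unfolding gen_function_rel_def by auto
  show "refl_on (moderate_functions A) (gen_function_rel A)"
    unfolding refl_on_def gen_function_rel_def using zero_negligible_functions[OF A] by auto
  show "sym (gen_function_rel A)"
    unfolding sym_def gen_function_rel_def using negligible_functions_swap[OF A] by blast
  show "trans (gen_function_rel A)"
    unfolding trans_def gen_function_rel_def using negligible_functions_trans[OF A] by blast
qed

lemma equiv_gen_map_rel:
  fixes A :: "('m::t2_space, 'e::real_normed_vector) atlas"
  assumes A: "smooth_atlas A"
  shows "equiv (moderate_maps A B) (gen_map_rel A B)"
proof (rule equivI)
  show "gen_map_rel A B \<subseteq> moderate_maps A B \<times> moderate_maps A B"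
    unfolding gen_map_rel_def by auto
  have "(u, u) \<in> gen_map_rel A B" if u: "u \<in> moderate_maps A B" for u
  proof -
    have "(\<lambda>\<epsilon> x. 0) \<in> negligible_functions A" if "f \<in> smooth_functions B" for f
      using u that zero_negligible_functions[OF A, of "\<lambda>\<epsilon>. f \<circ> u \<epsilon>"] unfolding moderate_maps_def by blast
    then show ?thesis using u unfolding gen_map_rel_def by simp
  qed
  then show "refl_on (moderate_maps A B) (gen_map_rel A B)"
    unfolding refl_on_def by blast
  show "sym (gen_map_rel A B)"
  proof (rule symI)
    fix u v assume uv: "(u, v) \<in> gen_map_rel A B"
    have "(\<lambda>\<epsilon> x. f (v \<epsilon> x) - f (u \<epsilon> x)) \<in> negligible_functions A" if "f \<in> smooth_functions B" for f
      by (rule negligible_functions_swap[OF A]) (use uv that in \<open>simp add: gen_map_rel_def\<close>)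
    then show "(v, u) \<in> gen_map_rel A B" using uv unfolding gen_map_rel_def by simp
  qed
  show "trans (gen_map_rel A B)"
  proof (rule transI)
    fix u v w assume uv: "(u, v) \<in> gen_map_rel A B" "(v, w) \<in> gen_map_rel A B"
    have "(\<lambda>\<epsilon> x. f (u \<epsilon> x) - f (w \<epsilon> x)) \<in> negligible_functions A" if "f \<in> smooth_functions B" for f
      by (rule negligible_functions_trans[OF A, of _ "\<lambda>\<epsilon> x. f (v \<epsilon> x)"])
        (use uv that in \<open>simp_all add: gen_map_rel_def\<close>)
    then show "(u, w) \<in> gen_map_rel A B" using uv unfolding gen_map_rel_def by simp
  qed
qed

section \<open>Values along compactly supported nets\<close>

lemma moderate_point_value:
  fixes A :: "('m::t2_space, 'e::{real_inner, heine_borel}) atlas"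
  assumes M: "smooth_manifold A" and u: "u \<in> moderate_functions A" and x: "x \<in> compactly_supported_nets"
  shows "(\<lambda>\<epsilon>. u \<epsilon> (x \<epsilon>)) \<in> moderate_numbers"
proof -
  have A: "smooth_atlas A" using M unfolding smooth_manifold_def by blast
  obtain B :: "'e set" where B: "onb B"
    using M onb_exists unfolding smooth_manifold_def by blast
  obtain K where K: "compact K" "\<forall>\<^sub>F \<epsilon> in at_right 0. x \<epsilon> \<in> K"
    using x unfolding compactly_supported_nets_def by blast
  obtain p where p: "moderate_order p (\<lambda>\<epsilon>. sup_abs_on K (u \<epsilon>))"
    using moderate_functions_order[OF u K(1) linear_diff_op_id[OF B A]] by blast
  have "\<forall>\<^sub>F \<epsilon> in at_right 0. \<bar>u \<epsilon> (x \<epsilon>)\<bar> \<le> \<bar>sup_abs_on K (u \<epsilon>)\<bar>"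
    using eventually_unit_interval K(2)
    by eventually_elim (use sup_abs_on_upper[OF K(1) moderate_functions_continuous[OF A u]] in force)
  from moderate_order_mono[OF p this] show ?thesis
    unfolding moderate_numbers_def by blast
qed

lemma negligible_point_value:
  fixes A :: "('m::t2_space, 'e::real_normed_vector) atlas"
  assumes A: "smooth_atlas A" and u: "u \<in> negligible_functions A" and x: "x \<in> compactly_supported_nets"
  shows "negligible_net (\<lambda>\<epsilon>. u \<epsilon> (x \<epsilon>))"
proof -
  obtain K where K: "compact K" "\<forall>\<^sub>F \<epsilon> in at_right 0. x \<epsilon> \<in> K"
    using x unfolding compactly_supported_nets_def by blast
  have "\<forall>\<^sub>F \<epsilon> in at_right 0. \<bar>u \<epsilon> (x \<epsilon>)\<bar> \<le> \<bar>sup_abs_on K (u \<epsilon>)\<bar>"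
    using eventually_unit_interval K(2)
    by eventually_elim
      (use sup_abs_on_upper[OF K(1) moderate_functions_continuous[OF A negligible_functions_moderate[OF u]]] in force)
  then show ?thesis
    by (rule negligible_net_mono[OF negligible_functions_sup[OF u K(1)]])
qed



section \<open>Generalized points at small distance\<close>

text \<open>Mean value inequality on a convex set, with the operator norm estimated through the
  partial derivatives along \<open>B\<close>, each contributing at most
  \<open>C * norm v\<close>.\<close>

lemma onb_lipschitz:
  fixes F :: "'e::real_inner \<Rightarrow> real"
  assumes B: "onb B" and S: "convex S" and F: "\<And>y. y \<in> S \<Longrightarrow> (F has_derivative F' y) (at y)"
    and C: "0 \<le> C" "\<And>y b. y \<in> S \<Longrightarrow> b \<in> B \<Longrightarrow> \<bar>F' y b\<bar> \<le> C"
    and xy: "x \<in> S" "y \<in> S"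
  shows "\<bar>F x - F y\<bar> \<le> real (card B) * C * norm (x - y)"
proof -
  have "norm (F x - F y) \<le> (real (card B) * C) * norm (x - y)"
  proof (rule differentiable_bound[OF S _ _ xy])
    fix z assume z: "z \<in> S"
    show "(F has_derivative F' z) (at z within S)"
      by (rule has_derivative_at_withinI[OF F[OF z]])
    show "onorm (F' z) \<le> real (card B) * C"
    proof (rule onorm_bound)
      fix v
      have "norm (F' z v) = norm (\<Sum>b\<in>B. (v \<bullet> b) *\<^sub>R F' z b)"
        by (rule arg_cong[OF onb_expand[OF B has_derivative_linear[OF F[OF z]]]])
      also have "\<dots> \<le> (\<Sum>b\<in>B. norm v * C)"
      proof (rule sum_norm_le)
        fix b assume b: "b \<in> B"
        have "\<bar>v \<bullet> b\<bar> \<le> norm v"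
          using Cauchy_Schwarz_ineq2[of v b] B b by (simp add: onb_def)
        then show "norm ((v \<bullet> b) *\<^sub>R F' z b) \<le> norm v * C"
          using C(2)[OF z b] by (simp add: abs_mult mult_mono)
      qed
      finally show "norm (F' z v) \<le> real (card B) * C * norm v"
        by (simp add: mult_ac)
    qed (use C(1) in simp)
  qed
  then show ?thesis by simp
qed

text \<open>Reduces statements about two nets at distance tending to 0 to Euclidean estimates in one
  chart around the limit.\<close>

lemma near_standard_chart:
  fixes A :: "('m::t2_space, 'e::{real_inner, heine_borel}) atlas"
  assumes M: "smooth_manifold A" and g: "riemannian_metric A g" and c: "c \<in> A" "p \<in> fst c"
    and r: "r > 0" "cball (snd c p) r \<subseteq> chart_image c"
    and x: "(x \<longlongrightarrow> p) F" and d: "((\<lambda>\<epsilon>. riemannian_dist A g (x \<epsilon>) (y \<epsilon>)) \<longlongrightarrow> 0) F"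
  obtains m where "m > 0" "\<forall>\<^sub>F \<epsilon> in F.
    (x \<epsilon> \<in> fst c \<and> snd c (x \<epsilon>) \<in> ball (snd c p) r) \<and> (y \<epsilon> \<in> fst c \<and> snd c (y \<epsilon>) \<in> ball (snd c p) r) \<and>
    m * norm (snd c (y \<epsilon>) - snd c (x \<epsilon>)) \<le> riemannian_dist A g (x \<epsilon>) (y \<epsilon>)"
proof -
  have A: "smooth_atlas A" using M unfolding smooth_manifold_def by blast
  obtain m where m: "m > 0"
    "\<And>x y. x \<in> fst c \<Longrightarrow> snd c x \<in> ball (snd c p) (r / 2) \<Longrightarrow> riemannian_dist A g x y < m * r / 2 \<Longrightarrow>
       y \<in> fst c \<and> snd c y \<in> ball (snd c p) r \<and> m * norm (snd c y - snd c x) \<le> riemannian_dist A g x y"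
    using riemannian_dist_chart[OF M g c(1) r] by metis
  have "\<forall>\<^sub>F \<epsilon> in F. x \<epsilon> \<in> {q \<in> fst c. snd c q \<in> ball (snd c p) (r / 2)}"
    by (rule topological_tendstoD[OF x chart_preimage_open[OF A c(1)]]) (use c r in auto)
  moreover have "\<forall>\<^sub>F \<epsilon> in F. riemannian_dist A g (x \<epsilon>) (y \<epsilon>) < m * r / 2"
    by (rule order_tendstoD(2)[OF d]) (use m(1) r in simp)
  ultimately have "\<forall>\<^sub>F \<epsilon> in F.
    (x \<epsilon> \<in> fst c \<and> snd c (x \<epsilon>) \<in> ball (snd c p) r) \<and> (y \<epsilon> \<in> fst c \<and> snd c (y \<epsilon>) \<in> ball (snd c p) r) \<and>
    m * norm (snd c (y \<epsilon>) - snd c (x \<epsilon>)) \<le> riemannian_dist A g (x \<epsilon>) (y \<epsilon>)"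
  proof eventually_elim
    case (elim \<epsilon>)
    then have "x \<epsilon> \<in> fst c" "snd c (x \<epsilon>) \<in> ball (snd c p) (r / 2)" by auto
    with m(2)[OF this elim(2)] show ?case using r(1) by auto
  qed
  with m(1) show ?thesis by (rule that)
qed

text \<open>Any neighbourhood of \<open>p\<close> contains a coordinate ball, and
  \<open>near_standard_chart\<close> places \<open>y\<close> in it eventually. Near-standardness can
  thus be checked on one representative.\<close>

lemma tendsto_riemannian_dist_0:
  fixes A :: "('m::t2_space, 'e::{real_inner, heine_borel}) atlas"
  assumes M: "smooth_manifold A" and g: "riemannian_metric A g"
    and x: "(x \<longlongrightarrow> p) F" and d: "((\<lambda>\<epsilon>. riemannian_dist A g (x \<epsilon>) (y \<epsilon>)) \<longlongrightarrow> 0) F"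
  shows "(y \<longlongrightarrow> p) F"
proof (rule topological_tendstoI)
  fix V assume V: "open V" "p \<in> V"
  have A: "smooth_atlas A" using M unfolding smooth_manifold_def by blast
  obtain c where c: "c \<in> A" "p \<in> fst c" using atlas_cover[OF A] by blast
  have "open (snd c ` (fst c \<inter> V))" by (rule chart_overlap_open[OF A c(1) V(1)])
  then have "\<forall>y\<in>snd c ` (fst c \<inter> V). \<exists>e>0. cball y e \<subseteq> snd c ` (fst c \<inter> V)"
    by (simp only: open_contains_cball)
  moreover have "snd c p \<in> snd c ` (fst c \<inter> V)" using c V by simp
  ultimately obtain r where r: "r > 0" "cball (snd c p) r \<subseteq> snd c ` (fst c \<inter> V)" by blast
  then have "cball (snd c p) r \<subseteq> chart_image c" by auto
  then obtain m :: real where "\<forall>\<^sub>F \<epsilon> in F.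
    (x \<epsilon> \<in> fst c \<and> snd c (x \<epsilon>) \<in> ball (snd c p) r) \<and> (y \<epsilon> \<in> fst c \<and> snd c (y \<epsilon>) \<in> ball (snd c p) r) \<and>
    m * norm (snd c (y \<epsilon>) - snd c (x \<epsilon>)) \<le> riemannian_dist A g (x \<epsilon>) (y \<epsilon>)"
    by (rule near_standard_chart[OF M g c r(1) _ x d])
  then show "\<forall>\<^sub>F \<epsilon> in F. y \<epsilon> \<in> V"
  proof eventually_elim
    case (elim \<epsilon>)
    then have y: "y \<epsilon> \<in> fst c" "snd c (y \<epsilon>) \<in> cball (snd c p) r" by auto
    then obtain q where "q \<in> fst c" "q \<in> V" "snd c (y \<epsilon>) = snd c q" using r(2) by blast
    then show ?case using chart_inv_chart[OF A c(1)] y(1) by metis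
  qed
qed

text \<open>The partial derivatives of \<open>f\<close> are bounded on a compact coordinate ball.
  Points \<open>z\<close> closer than \<open>m * r / 2\<close> to \<open>y\<close> lie in that ball,
  and coordinate distances are at most the Riemannian ones divided by \<open>m\<close>.\<close>

lemma smooth_functions_locally_lipschitz:
  fixes A :: "('m::t2_space, 'e::{real_inner, heine_borel}) atlas"
  assumes M: "smooth_manifold A" and g: "riemannian_metric A g" and f: "f \<in> smooth_functions A"
  shows "\<exists>U \<delta> C. open U \<and> q \<in> U \<and> \<delta> > 0 \<and> C \<ge> 0 \<and>
    (\<forall>y\<in>U. \<forall>z. riemannian_dist A g y z < \<delta> \<longrightarrow> \<bar>f y - f z\<bar> \<le> C * riemannian_dist A g y z)"
proof -
  have A: "smooth_atlas A" using M unfolding smooth_manifold_def by blast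
  obtain B :: "'e set" where B: "onb B"
    using M onb_exists unfolding smooth_manifold_def by blast
  obtain c r where c: "c \<in> A" "q \<in> fst c" and r: "r > 0" "cball (snd c q) r \<subseteq> chart_image c"
    using chart_cball[OF A] by metis
  let ?K = "cball (snd c q) r" and ?F = "f \<circ> chart_inv c"
  let ?F' = "\<lambda>y. frechet_derivative ?F (at y)"
  have Ck: "Ck_on (Suc 0) (chart_image c) ?F" by (rule smooth_functions_Ck[OF f c(1)])
  have K: "compact ?K" by (simp add: compact_eq_bounded_closed)
  have "\<forall>v. continuous_on (chart_image c) (\<lambda>y. ?F' y v)"
    using Ck by (simp del: o_apply)
  then have "continuous_on (chart_image c) (\<lambda>y. ?F' y b)" for b
    by (rule spec)
  from continuous_on_subset[OF this r(2)] have cont: "continuous_on ?K (\<lambda>y. ?F' y b)" for b .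
  define C where "C = (\<Sum>b\<in>B. sup_abs_on ?K (\<lambda>y. ?F' y b))"
  have pos: "0 \<le> sup_abs_on ?K (\<lambda>y. ?F' y b)" for b
    by (rule sup_abs_on_nonneg[OF K cont])
  then have C0: "0 \<le> C" unfolding C_def by (rule sum_nonneg)
  have C: "\<bar>?F' y b\<bar> \<le> C" if "y \<in> ?K" "b \<in> B" for y b
  proof -
    have "\<bar>?F' y b\<bar> \<le> sup_abs_on ?K (\<lambda>y. ?F' y b)"
      by (rule sup_abs_on_upper[OF K cont that(1)])
    also have "\<dots> \<le> C"
      unfolding C_def using B pos that(2) by (intro member_le_sum) (auto simp: onb_def)
    finally show ?thesis .
  qed
  obtain m where m: "m > 0"
    "\<And>x y. x \<in> fst c \<Longrightarrow> snd c x \<in> ball (snd c q) (r / 2) \<Longrightarrow> riemannian_dist A g x y < m * r / 2 \<Longrightarrow>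
       y \<in> fst c \<and> snd c y \<in> ball (snd c q) r \<and> m * norm (snd c y - snd c x) \<le> riemannian_dist A g x y"
    using riemannian_dist_chart[OF M g c(1) r] by metis
  let ?U = "{p \<in> fst c. snd c p \<in> ball (snd c q) (r / 2)}"
  let ?C = "real (card B) * C / m"
  have "\<bar>f y - f z\<bar> \<le> ?C * riemannian_dist A g y z"
    if y: "y \<in> ?U" and d: "riemannian_dist A g y z < m * r / 2" for y z
  proof -
    have y': "y \<in> fst c" "snd c y \<in> ball (snd c q) (r / 2)" using y by auto
    note z = m(2)[OF y' d]
    have "\<bar>?F (snd c y) - ?F (snd c z)\<bar> \<le> real (card B) * C * norm (snd c y - snd c z)"
    proof (rule onb_lipschitz[OF B convex_cball _ C0 C])
      show "(?F has_derivative ?F' x) (at x)" if "x \<in> ?K" for x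
        by (rule Ck_on_SucD[OF Ck]) (use that r(2) in blast)
      show "snd c y \<in> ?K" "snd c z \<in> ?K" using y' z r(1) by auto
    qed
    also have "\<dots> \<le> real (card B) * C * (riemannian_dist A g y z / m)"
      using z C0 m(1) by (intro mult_left_mono) (auto simp: field_simps norm_minus_commute)
    finally show ?thesis
      using chart_inv_chart[OF A c(1)] y' z by simp
  qed
  moreover have "open ?U" by (rule chart_preimage_open[OF A c(1)]) simp
  moreover have "q \<in> ?U" "m * r / 2 > 0" "?C \<ge> 0"
    using c r m(1) C0 by auto
  ultimately show ?thesis by blast
qed

text \<open>Finitely many Lipschitz neighbourhoods cover \<open>K\<close>. Eventually the distance
  is below all their thresholds \<open>\<delta> q\<close>, and the sum of their constants works
  throughout.\<close>

lemma smooth_function_negligible: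
  fixes A :: "('m::t2_space, 'e::{real_inner, heine_borel}) atlas"
  assumes M: "smooth_manifold A" and g: "riemannian_metric A g" and f: "f \<in> smooth_functions A"
    and y: "y \<in> compactly_supported_nets" and d: "negligible_net (\<lambda>\<epsilon>. riemannian_dist A g (y \<epsilon>) (z \<epsilon>))"
  shows "negligible_net (\<lambda>\<epsilon>. f (y \<epsilon>) - f (z \<epsilon>))"
proof -
  let ?d = "riemannian_dist A g"
  obtain K where K: "compact K" "\<forall>\<^sub>F \<epsilon> in at_right 0. y \<epsilon> \<in> K"
    using y unfolding compactly_supported_nets_def by blast
  have "\<forall>q. \<exists>U \<delta> C. open U \<and> q \<in> U \<and> \<delta> > 0 \<and> C \<ge> 0 \<and>
    (\<forall>y\<in>U. \<forall>z. ?d y z < \<delta> \<longrightarrow> \<bar>f y - f z\<bar> \<le> C * ?d y z)"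
    using smooth_functions_locally_lipschitz[OF M g f] by blast
  then obtain U where "\<forall>q. \<exists>\<delta> C. open (U q) \<and> q \<in> U q \<and> \<delta> > 0 \<and> C \<ge> 0 \<and>
    (\<forall>y\<in>U q. \<forall>z. ?d y z < \<delta> \<longrightarrow> \<bar>f y - f z\<bar> \<le> C * ?d y z)"
    by (rule choice[THEN exE])
  then obtain \<delta> where "\<forall>q. \<exists>C. open (U q) \<and> q \<in> U q \<and> \<delta> q > 0 \<and> C \<ge> 0 \<and>
    (\<forall>y\<in>U q. \<forall>z. ?d y z < \<delta> q \<longrightarrow> \<bar>f y - f z\<bar> \<le> C * ?d y z)"
    by (rule choice[THEN exE])
  then obtain C where all: "\<forall>q. open (U q) \<and> q \<in> U q \<and> \<delta> q > 0 \<and> C q \<ge> 0 \<and>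
    (\<forall>y\<in>U q. \<forall>z. ?d y z < \<delta> q \<longrightarrow> \<bar>f y - f z\<bar> \<le> C q * ?d y z)"
    by (rule choice[THEN exE])
  obtain Q where Q: "Q \<subseteq> K" "finite Q" "K \<subseteq> (\<Union>q\<in>Q. U q)"
    by (rule compactE_image[OF K(1), of K U]) (use all in blast)+
  have "\<forall>\<^sub>F \<epsilon> in at_right 0. \<forall>q\<in>Q. ?d (y \<epsilon>) (z \<epsilon>) < \<delta> q"
    using Q(2) all negligible_net_tendsto_0[OF d]
    by (intro eventually_ball_finite ballI order_tendstoD(2)) auto
  with K(2) have "\<forall>\<^sub>F \<epsilon> in at_right 0. \<bar>f (y \<epsilon>) - f (z \<epsilon>)\<bar> \<le> \<bar>(\<Sum>q\<in>Q. C q) * ?d (y \<epsilon>) (z \<epsilon>)\<bar>"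
  proof eventually_elim
    case (elim \<epsilon>)
    then obtain q where q: "q \<in> Q" "y \<epsilon> \<in> U q" using Q(3) by blast
    then have "\<bar>f (y \<epsilon>) - f (z \<epsilon>)\<bar> \<le> C q * ?d (y \<epsilon>) (z \<epsilon>)" using all elim by blast
    \<comment> \<open>With the absolute value, enlarging the constant can only enlarge the
      bound.\<close>
    also have "\<dots> \<le> C q * \<bar>?d (y \<epsilon>) (z \<epsilon>)\<bar>" using all by (intro mult_left_mono) auto
    also have "\<dots> \<le> (\<Sum>q\<in>Q. C q) * \<bar>?d (y \<epsilon>) (z \<epsilon>)\<bar>"
      using all q(1) Q(2) by (intro mult_right_mono member_le_sum) auto
    also have "\<dots> \<le> \<bar>(\<Sum>q\<in>Q. C q) * ?d (y \<epsilon>) (z \<epsilon>)\<bar>"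
      by (simp add: abs_mult mult_right_mono)
    finally show ?case .
  qed
  moreover have "moderate_order 0 (\<lambda>\<epsilon>. \<Sum>q\<in>Q. C q)" by (simp add: moderate_order_def)
  then have "negligible_net (\<lambda>\<epsilon>. (\<Sum>q\<in>Q. C q) * ?d (y \<epsilon>) (z \<epsilon>))"
    using d by (rule moderate_mult_negligible)
  ultimately show ?thesis by (rule negligible_net_mono[rotated])
qed

text \<open>The derivative along \<open>b\<close> times the cut-off is a global operator, so its
  suprema are moderate. On the smaller ball the cut-off is at least
  \<open>flat 0 (R\<^sup>2 - r\<^sup>2) > 0\<close>, since \<open>flat 0\<close> is nondecreasing,
  and can be divided out.\<close>

lemma moderate_first_derivatives:
  fixes A :: "('m::t2_space, 'e::{real_inner, heine_borel}) atlas"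
  assumes B: "onb (B :: 'e set)" and A: "smooth_atlas A" and c: "c \<in> A"
    and r: "cball z R \<subseteq> chart_image c" "0 < r" "r < R" and u: "u \<in> moderate_functions A"
  obtains p C where "moderate_order p C"
    "\<And>\<epsilon>. \<epsilon> \<in> {0<..1} \<Longrightarrow> 0 \<le> C \<epsilon>"
    "\<And>\<epsilon> y b. \<epsilon> \<in> {0<..1} \<Longrightarrow> y \<in> cball z r \<Longrightarrow> b \<in> B \<Longrightarrow>
       \<bar>frechet_derivative (u \<epsilon> \<circ> chart_inv c) (at y) b\<bar> \<le> C \<epsilon>"
proof -
  have R: "R > 0" using r by simp
  have ball: "cball z r \<subseteq> chart_image c" using r by auto
  define K where "K = {q \<in> fst c. snd c q \<in> cball z r}"
  have K: "compact K"
    unfolding K_def by (rule chart_preimage_compact[OF A c _ ball]) (simp add: compact_eq_bounded_closed)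
  let ?\<beta> = "\<lambda>y. flat 0 (R\<^sup>2 - (y - z) \<bullet> (y - z))"
  let ?l = "flat 0 (R\<^sup>2 - r\<^sup>2)"
  have r2: "r\<^sup>2 < R\<^sup>2" using r by (intro power_strict_mono) auto
  then have l_pos: "?l > 0" by (simp add: flat_def)
  have \<beta>: "?l \<le> ?\<beta> y" if "y \<in> cball z r" for y
  proof -
    have "norm (y - z) \<le> r" using that by (simp add: dist_norm norm_minus_commute)
    then have "(norm (y - z))\<^sup>2 \<le> r\<^sup>2" by (intro power_mono) auto
    then have "R\<^sup>2 - r\<^sup>2 \<le> R\<^sup>2 - (y - z) \<bullet> (y - z)" by (simp add: power2_norm_eq_inner)
    then show ?thesis using r2 by (auto simp: flat_def intro!: le_imp_inverse_le)
  qed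
  have "\<forall>b. \<exists>P. linear_diff_op A P \<and> (\<forall>f y. f \<in> smooth_functions A \<longrightarrow> y \<in> chart_image c \<longrightarrow>
       P f (chart_inv c y) = ?\<beta> y * frechet_derivative (f \<circ> chart_inv c) (at y) b)"
    using linear_diff_op_bump[OF B A c r(1) R] by metis
  then obtain P where P: "\<forall>b. linear_diff_op A (P b) \<and> (\<forall>f y. f \<in> smooth_functions A \<longrightarrow> y \<in> chart_image c \<longrightarrow>
       P b f (chart_inv c y) = ?\<beta> y * frechet_derivative (f \<circ> chart_inv c) (at y) b)"
    by (rule choice[THEN exE])
  define s where "s b \<epsilon> = sup_abs_on K (P b (u \<epsilon>))" for b \<epsilon>
  have fin: "finite B" using B by (simp add: onb_def)
  have "\<exists>p. moderate_order p (\<lambda>\<epsilon>. \<Sum>b\<in>B. s b \<epsilon>)"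
    unfolding s_def using moderate_functions_order[OF u K] P by (intro moderate_order_sum fin) blast
  then obtain p where "moderate_order p (\<lambda>\<epsilon>. \<Sum>b\<in>B. s b \<epsilon>)" ..
  then have p: "moderate_order p (\<lambda>\<epsilon>. inverse ?l * (\<Sum>b\<in>B. s b \<epsilon>))"
    unfolding moderate_order_def using l_pos by simp
  have cont: "continuous_on K (P b (u \<epsilon>))" if "\<epsilon> \<in> {0<..1}" for b \<epsilon>
    using P by (intro linear_diff_op_continuous[OF A] moderate_functions_smooth[OF u that]) blast
  have s0: "0 \<le> s b \<epsilon>" if "\<epsilon> \<in> {0<..1}" for b \<epsilon>
    unfolding s_def by (rule sup_abs_on_nonneg[OF K cont[OF that]])
  show ?thesis
  proof (rule that[OF p])
    fix \<epsilon> :: real assume \<epsilon>: "\<epsilon> \<in> {0<..1}"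
    then show "0 \<le> inverse ?l * (\<Sum>b\<in>B. s b \<epsilon>)"
      using l_pos s0 by (simp add: sum_nonneg)
    fix y b assume y: "y \<in> cball z r" and b: "b \<in> B"
    let ?D = "frechet_derivative (u \<epsilon> \<circ> chart_inv c) (at y) b"
    have yi: "y \<in> chart_image c" using y ball by blast
    have "?l * \<bar>?D\<bar> \<le> ?\<beta> y * \<bar>?D\<bar>"
      by (rule mult_right_mono[OF \<beta>[OF y]]) simp
    also have "\<dots> = \<bar>?\<beta> y * ?D\<bar>"
      using \<beta>[OF y] l_pos by (simp add: abs_mult)
    also have "?\<beta> y * ?D = P b (u \<epsilon>) (chart_inv c y)"
      using P moderate_functions_smooth[OF u \<epsilon>] yi by metis
    also have "\<bar>\<dots>\<bar> \<le> s b \<epsilon>"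
      unfolding s_def
      by (rule sup_abs_on_upper[OF K cont[OF \<epsilon>]])
        (use y chart_inv_in[OF A c yi] chart_chart_inv[OF A c yi] in \<open>simp add: K_def\<close>)
    also have "\<dots> \<le> (\<Sum>b\<in>B. s b \<epsilon>)"
      using fin s0[OF \<epsilon>] b by (intro member_le_sum) auto
    finally have *: "?l * \<bar>?D\<bar> \<le> (\<Sum>b\<in>B. s b \<epsilon>)" .
    have "t \<le> inverse ?l * t'" if "?l * t \<le> t'" for t t'
      using that l_pos by (simp add: field_simps)
    from this[OF *] show "\<bar>?D\<bar> \<le> inverse ?l * (\<Sum>b\<in>B. s b \<epsilon>)" .
  qed
qed

text \<open>Convergence of \<open>x\<close> puts both nets into one chart; there the difference is
  at most a moderate Lipschitz constant times a negligible distance.\<close>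

lemma moderate_function_negligible:
  fixes A :: "('m::t2_space, 'e::{real_inner, heine_borel}) atlas"
  assumes M: "smooth_manifold A" and g: "riemannian_metric A g" and u: "u \<in> moderate_functions A"
    and x: "(x \<longlongrightarrow> p) (at_right 0)" and d: "negligible_net (\<lambda>\<epsilon>. riemannian_dist A g (x \<epsilon>) (y \<epsilon>))"
  shows "negligible_net (\<lambda>\<epsilon>. u \<epsilon> (x \<epsilon>) - u \<epsilon> (y \<epsilon>))"
proof -
  let ?d = "riemannian_dist A g"
  have A: "smooth_atlas A" using M unfolding smooth_manifold_def by blast
  obtain B :: "'e set" where B: "onb B"
    using M onb_exists unfolding smooth_manifold_def by blast
  obtain c R where c: "c \<in> A" "p \<in> fst c" and R: "R > 0" "cball (snd c p) R \<subseteq> chart_image c"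
    using chart_cball[OF A] by metis
  define r where "r = R / 2"
  have r: "0 < r" "r < R" using R by (auto simp: r_def)
  then have r': "cball (snd c p) r \<subseteq> chart_image c" using R by auto
  obtain k C where C: "moderate_order k C" "\<And>\<epsilon>. \<epsilon> \<in> {0<..1} \<Longrightarrow> 0 \<le> C \<epsilon>"
    "\<And>\<epsilon> y b. \<epsilon> \<in> {0<..1} \<Longrightarrow> y \<in> cball (snd c p) r \<Longrightarrow> b \<in> B \<Longrightarrow>
       \<bar>frechet_derivative (u \<epsilon> \<circ> chart_inv c) (at y) b\<bar> \<le> C \<epsilon>"
    using moderate_first_derivatives[OF B A c(1) R(2) r u] by metis
  obtain m where m: "m > 0" "\<forall>\<^sub>F \<epsilon> in at_right 0.
    (x \<epsilon> \<in> fst c \<and> snd c (x \<epsilon>) \<in> ball (snd c p) r) \<and> (y \<epsilon> \<in> fst c \<and> snd c (y \<epsilon>) \<in> ball (snd c p) r) \<and>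
    m * norm (snd c (y \<epsilon>) - snd c (x \<epsilon>)) \<le> ?d (x \<epsilon>) (y \<epsilon>)"
    by (rule near_standard_chart[OF M g c r(1) r' x negligible_net_tendsto_0[OF d]])
  have "\<forall>\<^sub>F \<epsilon> in at_right 0. \<bar>u \<epsilon> (x \<epsilon>) - u \<epsilon> (y \<epsilon>)\<bar> \<le> \<bar>(real (card B) / m) * (C \<epsilon> * ?d (x \<epsilon>) (y \<epsilon>))\<bar>"
    using eventually_unit_interval m(2)
  proof eventually_elim
    case (elim \<epsilon>)
    let ?F = "u \<epsilon> \<circ> chart_inv c"
    have xy: "x \<epsilon> \<in> fst c" "snd c (x \<epsilon>) \<in> cball (snd c p) r" "y \<epsilon> \<in> fst c" "snd c (y \<epsilon>) \<in> cball (snd c p) r"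
      using elim(2) by auto
    have der: "(?F has_derivative frechet_derivative ?F (at z)) (at z)" if "z \<in> cball (snd c p) r" for z
      by (rule Ck_on_SucD[OF smooth_functions_Ck[OF moderate_functions_smooth[OF u elim(1)] c(1)]])
        (use that r' in blast)
    have "\<bar>?F (snd c (x \<epsilon>)) - ?F (snd c (y \<epsilon>))\<bar> \<le> real (card B) * C \<epsilon> * norm (snd c (x \<epsilon>) - snd c (y \<epsilon>))"
      by (rule onb_lipschitz[OF B convex_cball der C(2)[OF elim(1)] C(3)[OF elim(1)] xy(2,4)])
    also have "\<dots> \<le> real (card B) * C \<epsilon> * (?d (x \<epsilon>) (y \<epsilon>) / m)"
      using elim(2) C(2)[OF elim(1)] m(1)
      by (intro mult_left_mono) (auto simp: field_simps norm_minus_commute)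
    finally have "\<bar>u \<epsilon> (x \<epsilon>) - u \<epsilon> (y \<epsilon>)\<bar> \<le> (real (card B) / m) * (C \<epsilon> * ?d (x \<epsilon>) (y \<epsilon>))"
      using chart_inv_chart[OF A c(1)] xy by (simp add: mult_ac)
    then show ?case by (rule order_trans[OF _ abs_ge_self])
  qed
  moreover have "moderate_order 0 (\<lambda>\<epsilon>. real (card B) / m)" by (simp add: moderate_order_def)
  then have "negligible_net (\<lambda>\<epsilon>. (real (card B) / m) * (C \<epsilon> * ?d (x \<epsilon>) (y \<epsilon>)))"
    using moderate_mult_negligible[OF C(1) d] by (rule moderate_mult_negligible)
  ultimately show ?thesis by (rule negligible_net_mono[rotated])
qed



section \<open>Detection of non-negligible nets by near-standard points\<close>

text \<open>Otherwise every point of \<open>K\<close> has a neighbourhood that the sequence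
  eventually avoids, and finitely many of these cover \<open>K\<close>.\<close>

lemma sequence_cluster_point:
  fixes y :: "nat \<Rightarrow> 'm::topological_space"
  assumes K: "compact K" and y: "\<And>j. y j \<in> K"
  obtains p where "p \<in> K" "\<And>U n. open U \<Longrightarrow> p \<in> U \<Longrightarrow> \<exists>j\<ge>n. y j \<in> U"
proof (rule ccontr)
  assume neg: "\<not> thesis"
  have "\<forall>p\<in>K. \<exists>U. open U \<and> p \<in> U \<and> (\<forall>\<^sub>F j in sequentially. y j \<notin> U)"
  proof
    fix p assume "p \<in> K"
    with neg that obtain U n where "open U" "p \<in> U" "\<not> (\<exists>j\<ge>n. y j \<in> U)" by metis
    then show "\<exists>U. open U \<and> p \<in> U \<and> (\<forall>\<^sub>F j in sequentially. y j \<notin> U)"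
      unfolding eventually_sequentially by blast
  qed
  then obtain U where U: "\<forall>p\<in>K. open (U p) \<and> p \<in> U p \<and> (\<forall>\<^sub>F j in sequentially. y j \<notin> U p)"
    by (rule bchoice[THEN exE])
  obtain Q where Q: "Q \<subseteq> K" "finite Q" "K \<subseteq> (\<Union>q\<in>Q. U q)"
    by (rule compactE_image[OF K, of K U]) (use U in blast)+
  have "\<forall>\<^sub>F j in sequentially. \<forall>q\<in>Q. y j \<notin> U q"
    using Q U by (intro eventually_ball_finite) auto
  then obtain j where "\<forall>q\<in>Q. y j \<notin> U q"
    unfolding eventually_sequentially by blast
  then show False using Q(3) y[of j] by blast
qed

text \<open>The points witnessing large values along a sequence \<open>\<epsilon>\<^sub>i \<longlonglongrightarrow> 0\<close> are placed on a net that
  equals a cluster point at all other \<open>\<epsilon>\<close>.\<close>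

lemma not_negligible_near_standard:
  fixes A :: "('m::t2_space, 'e::real_normed_vector) atlas"
  assumes A: "smooth_atlas A" and K: "compact (K :: 'm set)"
    and nn: "\<not> negligible_net (\<lambda>\<epsilon>. sup_abs_on K (w \<epsilon>))"
    and w: "\<forall>\<epsilon>\<in>{0<..1}. continuous_on K (w \<epsilon>)"
  obtains x p where "\<forall>\<epsilon>. x \<epsilon> \<in> K" "(x \<longlongrightarrow> p) (at_right 0)" "\<not> negligible_net (\<lambda>\<epsilon>. w \<epsilon> (x \<epsilon>))"
proof -
  obtain k where k: "(\<lambda>\<epsilon>. sup_abs_on K (w \<epsilon>)) \<notin> O[at_right 0](\<lambda>\<epsilon>. \<epsilon> ^ k)"
    using nn unfolding negligible_net_def by blast
  \<comment> \<open>The pair \<open>a\<close> consists of a parameter and a point. If none existed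
    for some \<open>j\<close>, the suprema would be O(\<epsilon>^k) with constant
    \<open>j\<close>.\<close>
  have "\<exists>a. 0 < fst a \<and> fst a < 1 / real (Suc j) \<and> snd a \<in> K \<and> real j * fst a ^ k < \<bar>w (fst a) (snd a)\<bar>" for j
  proof (rule ccontr)
    assume neg: "\<not> ?thesis"
    have small: "\<bar>w \<epsilon> x\<bar> \<le> real j * \<epsilon> ^ k" if "0 < \<epsilon>" "\<epsilon> < 1 / real (Suc j)" "x \<in> K" for \<epsilon> x
    proof (rule ccontr)
      assume "\<not> ?thesis"
      with neg that show False by (auto simp: not_le)
    qed
    have "\<forall>\<^sub>F \<epsilon> in at_right 0. \<epsilon> \<in> {0<..<1 / real (Suc j)}"
      by (rule eventually_at_right_real) simp
    with eventually_unit_interval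
    have "\<forall>\<^sub>F \<epsilon> in at_right 0. norm (sup_abs_on K (w \<epsilon>)) \<le> real j * norm (\<epsilon> ^ k)"
    proof eventually_elim
      case (elim \<epsilon>)
      have "sup_abs_on K (w \<epsilon>) \<le> real j * \<epsilon> ^ k"
        using elim by (intro sup_abs_on_least small) auto
      then show ?case using sup_abs_on_nonneg[OF K bspec[OF w elim(1)]] elim by simp
    qed
    with k show False by (metis bigoI)
  qed
  then have "\<forall>j. \<exists>a. 0 < fst a \<and> fst a < 1 / real (Suc j) \<and> snd a \<in> K \<and> real j * fst a ^ k < \<bar>w (fst a) (snd a)\<bar>"
    by blast
  then obtain a where a: "\<forall>j. 0 < fst (a j) \<and> fst (a j) < 1 / real (Suc j) \<and> snd (a j) \<in> K \<and>
      real j * fst (a j) ^ k < \<bar>w (fst (a j)) (snd (a j))\<bar>"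
    by (rule choice[THEN exE])
  obtain p where p: "p \<in> K" "\<And>U n. open U \<Longrightarrow> p \<in> U \<Longrightarrow> \<exists>j\<ge>n. snd (a j) \<in> U"
    using sequence_cluster_point[OF K, of "\<lambda>j. snd (a j)"] a by metis
  obtain c where c: "c \<in> A" "p \<in> fst c" using atlas_cover[OF A] by blast
  \<comment> \<open>Shrinking coordinate balls form a countable neighbourhood base at
    \<open>p\<close>.\<close>
  define V where "V i = {q \<in> fst c. snd c q \<in> ball (snd c p) (1 / real (Suc i))}" for i
  have "open (V i)" "p \<in> V i" for i
    unfolding V_def using c by (simp_all add: chart_preimage_open[OF A] del: mem_ball)
  then have "\<forall>i. \<exists>j. j \<ge> i \<and> snd (a j) \<in> V i" using p(2) by blast
  then obtain J where J: "\<forall>i. J i \<ge> i \<and> snd (a (J i)) \<in> V i"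
    by (rule choice[THEN exE])
  define E where "E i = fst (a (J i))" for i
  define Y where "Y i = snd (a (J i))" for i
  have E: "0 < E i" "E i < 1 / real (Suc i)" for i
  proof -
    show "0 < E i" using a by (simp add: E_def)
    have "E i < 1 / real (Suc (J i))" using a unfolding E_def by blast
    also have "\<dots> \<le> 1 / real (Suc i)" using J by (intro divide_left_mono) auto
    finally show "E i < 1 / real (Suc i)" .
  qed
  have Y: "Y i \<in> K" "Y i \<in> V i" for i
    using a J by (simp_all add: Y_def)
  have big: "real i * E i ^ k < \<bar>w (E i) (Y i)\<bar>" for i
  proof -
    have "real i * E i ^ k \<le> real (J i) * E i ^ k"
      using J E(1)[of i] by (intro mult_right_mono) auto
    also have "\<dots> < \<bar>w (E i) (Y i)\<bar>" using a unfolding E_def Y_def by blast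
    finally show ?thesis .
  qed
  \<comment> \<open>\<open>E\<close> may repeat values, so one index is chosen for each parameter in
    its range.\<close>
  define idx where "idx \<epsilon> = (SOME i. E i = \<epsilon>)" for \<epsilon>
  have idx: "E (idx \<epsilon>) = \<epsilon>" if "\<epsilon> \<in> range E" for \<epsilon>
    using that someI_ex[of "\<lambda>i. E i = \<epsilon>"] unfolding idx_def by blast
  define x where "x \<epsilon> = (if \<epsilon> \<in> range E then Y (idx \<epsilon>) else p)" for \<epsilon>
  \<comment> \<open>The first \<open>n\<close> values of \<open>E\<close> are positive, so a smaller
    parameter only has indices from \<open>n\<close> on, whichever one \<open>idx\<close>
    selects.\<close>
  have large: "\<forall>\<^sub>F \<epsilon> in at_right 0. \<forall>i. E i = \<epsilon> \<longrightarrow> n \<le> i" for n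
  proof -
    have "\<forall>\<^sub>F \<epsilon> in at_right 0. \<forall>i\<in>{..<n}. \<epsilon> < E i"
      by (intro eventually_ball_finite ballI order_tendstoD(2)[OF tendsto_ident_at] E) simp
    then show ?thesis
      by eventually_elim (metis lessThan_iff less_irrefl not_le)
  qed
  show ?thesis
  proof
    show "\<forall>\<epsilon>. x \<epsilon> \<in> K" using Y(1) p(1) by (simp add: x_def)
    show "(x \<longlongrightarrow> p) (at_right 0)"
    proof (rule topological_tendstoI)
      fix U assume U: "open U" "p \<in> U"
      have "open (snd c ` (fst c \<inter> U))" by (rule chart_overlap_open[OF A c(1) U(1)])
      then have "\<forall>y\<in>snd c ` (fst c \<inter> U). \<exists>e>0. ball y e \<subseteq> snd c ` (fst c \<inter> U)"
        by (simp only: open_contains_ball)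
      moreover have "snd c p \<in> snd c ` (fst c \<inter> U)" using c U by simp
      ultimately obtain r where r: "r > 0" "ball (snd c p) r \<subseteq> snd c ` (fst c \<inter> U)" by blast
      obtain n where n: "1 / real (Suc n) < r"
        using reals_Archimedean[OF r(1)] by (auto simp: inverse_eq_divide)
      show "\<forall>\<^sub>F \<epsilon> in at_right 0. x \<epsilon> \<in> U"
        using large[of n]
      proof eventually_elim
        case (elim \<epsilon>)
        show ?case
        proof (cases "\<epsilon> \<in> range E")
          case True
          let ?i = "idx \<epsilon>"
          have "n \<le> ?i" using elim idx[OF True] by blast
          then have "1 / real (Suc ?i) \<le> 1 / real (Suc n)" by (intro divide_left_mono) auto
          then have q: "Y ?i \<in> fst c" "snd c (Y ?i) \<in> ball (snd c p) r"
            using Y(2)[of ?i] n by (auto simp: V_def)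
          then obtain q where "q \<in> fst c" "q \<in> U" "snd c (Y ?i) = snd c q" using r(2) by blast
          then have "Y ?i \<in> U" using chart_inv_chart[OF A c(1)] q(1) by metis
          then show ?thesis using True by (simp add: x_def)
        qed (simp add: x_def U)
      qed
    qed
    show "\<not> negligible_net (\<lambda>\<epsilon>. w \<epsilon> (x \<epsilon>))"
    proof
      assume "negligible_net (\<lambda>\<epsilon>. w \<epsilon> (x \<epsilon>))"
      then have "(\<lambda>\<epsilon>. w \<epsilon> (x \<epsilon>)) \<in> O[at_right 0](\<lambda>\<epsilon>. \<epsilon> ^ k)"
        unfolding negligible_net_def by blast
      then obtain C where "\<forall>\<^sub>F \<epsilon> in at_right 0. norm (w \<epsilon> (x \<epsilon>)) \<le> C * norm (\<epsilon> ^ k)"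
        by (rule landau_o.bigE)
      moreover obtain n where n: "C < real n" using reals_Archimedean2 by blast
      ultimately have "\<forall>\<^sub>F \<epsilon> in at_right 0. norm (w \<epsilon> (x \<epsilon>)) \<le> C * norm (\<epsilon> ^ k) \<and> (\<forall>i. E i = \<epsilon> \<longrightarrow> n \<le> i)"
        using large[of n] by (intro eventually_conj)
      then obtain b where b: "b > 0"
          "\<And>\<epsilon>. 0 < \<epsilon> \<Longrightarrow> \<epsilon> < b \<Longrightarrow> norm (w \<epsilon> (x \<epsilon>)) \<le> C * norm (\<epsilon> ^ k) \<and> (\<forall>i. E i = \<epsilon> \<longrightarrow> n \<le> i)"
        unfolding eventually_at_right_field by blast
      obtain j where "1 / real (Suc j) < b"
        using reals_Archimedean[OF b(1)] by (auto simp: inverse_eq_divide)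
      then have "E j < b" using E(2)[of j] by linarith
      note bj = b(2)[OF E(1) this]
      \<comment> \<open>This index may differ from \<open>j\<close>, but it has the same parameter
        and is at least \<open>n\<close>, so \<open>big\<close> applies with a factor exceeding
        \<open>C\<close>.\<close>
      let ?i = "idx (E j)"
      have i: "E ?i = E j" by (rule idx) simp
      then have "n \<le> ?i" using bj by blast
      have "C * E j ^ k \<le> real ?i * E j ^ k"
        using n \<open>n \<le> ?i\<close> E(1)[of j] by (intro mult_right_mono) auto
      also have "\<dots> < \<bar>w (E j) (x (E j))\<bar>"
        using big[of ?i] unfolding i x_def by simp
      finally show False using bj E(1)[of j] by simp
    qed
  qed
qed

section \<open>Classes of generalized points and numbers\<close>

lemma gen_point_rel_refl:
  assumes "smooth_atlas A" "riemannian_metric A g" "x \<in> compactly_supported_nets"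
  shows "(x, x) \<in> gen_point_rel A g"
  using assms(3) riemannian_dist_refl[OF assms(1,2)]
  by (simp add: gen_point_rel_def negligible_net_def)

lemma near_standard_class:
  fixes A :: "('m::t2_space, 'e::{real_inner, heine_borel}) atlas"
  assumes M: "smooth_manifold A" and g: "riemannian_metric A g"
    and x: "x \<in> compactly_supported_nets" "(x \<longlongrightarrow> p) (at_right 0)"
  shows "gen_point_rel A g `` {x} \<in> gen_points A g" "near_standard (gen_point_rel A g `` {x})"
proof -
  show "gen_point_rel A g `` {x} \<in> gen_points A g"
    unfolding gen_points_def by (rule quotientI[OF x(1)])
  have "(y \<longlongrightarrow> p) (at_right 0)" if "(x, y) \<in> gen_point_rel A g" for y
    using that tendsto_riemannian_dist_0[OF M g x(2) negligible_net_tendsto_0]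
    unfolding gen_point_rel_def by blast
  then show "near_standard (gen_point_rel A g `` {x})"
    unfolding near_standard_def by blast
qed

lemma gen_points_nonempty_supported:
  assumes "smooth_atlas A" "riemannian_metric A g" "X \<in> gen_points A g"
  shows "X \<noteq> {}" "\<And>x. x \<in> X \<Longrightarrow> x \<in> compactly_supported_nets"
proof -
  obtain x0 where x0: "x0 \<in> compactly_supported_nets" "X = gen_point_rel A g `` {x0}"
    using assms(3) unfolding gen_points_def by (rule quotientE)
  then show "X \<noteq> {}" using gen_point_rel_refl[OF assms(1,2)] by blast
  show "\<And>x. x \<in> X \<Longrightarrow> x \<in> compactly_supported_nets"
    using x0 unfolding gen_point_rel_def by blast
qed

lemma gen_number_class_zero:
  assumes r: "negligible_net r"
  shows "gen_number_rel `` {r} = gen_number_zero"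
proof -
  have z: "negligible_net (\<lambda>\<epsilon>. 0)" by (simp add: negligible_net_def)
  have "negligible_net (\<lambda>\<epsilon>. r \<epsilon> - s \<epsilon>) \<longleftrightarrow> negligible_net (\<lambda>\<epsilon>. 0 - s \<epsilon>)" for s
    using negligible_net_diff[OF _ r, of "\<lambda>\<epsilon>. r \<epsilon> - s \<epsilon>"] negligible_net_add[OF r, of "\<lambda>\<epsilon>. 0 - s \<epsilon>"]
    by auto
  then show ?thesis
    using negligible_net_moderate[OF r] negligible_net_moderate[OF z]
    unfolding gen_number_rel_def gen_number_zero_def Image_singleton by simp
qed

section \<open>Equality detected by point values\<close>

lemma gen_function_zero_iff:
  fixes A :: "('m::t2_space, 'e::real_normed_vector) atlas"
  assumes A: "smooth_atlas A" and u: "u \<in> moderate_functions A"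
  shows "gen_function_rel A `` {u} = gen_function_zero A \<longleftrightarrow> u \<in> negligible_functions A"
proof -
  have z: "(\<lambda>\<epsilon> x. 0) \<in> moderate_functions A"
    by (rule negligible_functions_moderate[OF zero_negligible_functions[OF A u]])
  have "gen_function_rel A `` {u} = gen_function_zero A \<longleftrightarrow> (u, \<lambda>\<epsilon> x. 0) \<in> gen_function_rel A"
    unfolding gen_function_zero_def by (rule eq_equiv_class_iff[OF equiv_gen_function_rel[OF A] u z])
  also have "\<dots> \<longleftrightarrow> u \<in> negligible_functions A"
    using u z by (simp add: gen_function_rel_def)
  finally show ?thesis .
qed

text \<open>Every representative of zero is negligible, hence so are its values. If some supremum of
  \<open>u\<close> were not negligible, \<open>not_negligible_near_standard\<close> would provide a
  near-standard point with nonzero value.\<close>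

lemma gen_function_point_values:
  fixes A :: "('m::t2_space, 'e::{real_inner, heine_borel}) atlas"
  assumes M: "smooth_manifold A" and g: "riemannian_metric A g" and U: "U \<in> gen_functions A"
  shows "U = gen_function_zero A \<longleftrightarrow>
    (\<forall>X\<in>gen_points A g. near_standard X \<longrightarrow> point_value gen_number_rel U X = gen_number_zero)"
proof -
  have A: "smooth_atlas A" using M unfolding smooth_manifold_def by blast
  obtain u where u: "u \<in> moderate_functions A" "U = gen_function_rel A `` {u}"
    using U unfolding gen_functions_def by (rule quotientE)
  have uU: "u \<in> U"
    unfolding u(2) by (rule equiv_class_self[OF equiv_gen_function_rel[OF A] u(1)])
  show ?thesis
  proof
    assume zero: "U = gen_function_zero A"
    show "\<forall>X\<in>gen_points A g. near_standard X \<longrightarrow> point_value gen_number_rel U X = gen_number_zero"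
    proof (intro ballI impI)
      fix X assume X: "X \<in> gen_points A g"
      note Xf = gen_points_nonempty_supported[OF A g X]
      have "gen_number_rel `` {\<lambda>\<epsilon>. w \<epsilon> (x \<epsilon>)} = gen_number_zero" if w: "w \<in> U" and x: "x \<in> X" for w x
      proof -
        have "(\<lambda>\<epsilon> x. 0 - w \<epsilon> x) \<in> negligible_functions A"
          using w unfolding zero gen_function_zero_def gen_function_rel_def by blast
        from negligible_functions_swap[OF A this] have "w \<in> negligible_functions A" by simp
        then show ?thesis
          using x by (intro gen_number_class_zero negligible_point_value[OF A] Xf(2))
      qed
      \<comment> \<open>All sets in the union are the zero class, and both index sets are
        nonempty.\<close>
      then show "point_value gen_number_rel U X = gen_number_zero"
        unfolding point_value_def using uU Xf(1) by (intro SUP_eq_const) auto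
    qed
  next
    assume pv: "\<forall>X\<in>gen_points A g. near_standard X \<longrightarrow> point_value gen_number_rel U X = gen_number_zero"
    have "negligible_net (\<lambda>\<epsilon>. sup_abs_on K (u \<epsilon>))" if K: "compact K" for K
    proof (rule ccontr)
      assume "\<not> ?thesis"
      then obtain x p where x: "\<forall>\<epsilon>. x \<epsilon> \<in> K" "(x \<longlongrightarrow> p) (at_right 0)"
          and nn: "\<not> negligible_net (\<lambda>\<epsilon>. u \<epsilon> (x \<epsilon>))"
        by (rule not_negligible_near_standard[OF A K _ ballI[OF moderate_functions_continuous[OF A u(1)]]])
      have cs: "x \<in> compactly_supported_nets"
        unfolding compactly_supported_nets_def using K x(1) by auto
      let ?X = "gen_point_rel A g `` {x}" and ?r = "\<lambda>\<epsilon>. u \<epsilon> (x \<epsilon>)"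
      have "(?r, ?r) \<in> gen_number_rel"
        using moderate_point_value[OF M u(1) cs] by (simp add: gen_number_rel_def negligible_net_def)
      \<comment> \<open>Reflexivity at the moderate net \<open>?r\<close> puts it into the union,
        which is the zero class by hypothesis.\<close>
      then have "?r \<in> point_value gen_number_rel U ?X"
        unfolding point_value_def using uU gen_point_rel_refl[OF A g cs] by blast
      then have "?r \<in> gen_number_zero"
        using pv near_standard_class[OF M g cs x(2)] by blast
      then have "negligible_net (\<lambda>\<epsilon>. 0 - ?r \<epsilon>)"
        unfolding gen_number_zero_def gen_number_rel_def by blast
      from negligible_net_mono[OF this, of ?r] nn show False by simp
    qed
    then have "u \<in> negligible_functions A"
      using u(1) unfolding negligible_functions_def by simp
    then show "U = gen_function_zero A"
      using gen_function_zero_iff[OF A u(1)] u(2) by simp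
  qed
qed

text \<open>If \<open>f \<circ> u - f \<circ> v\<close> were not negligible for a smooth
  \<open>f\<close>, a near-standard net \<open>x\<close> would detect it. Equal values at its class
  give a negligible distance in the target, which \<open>f\<close> turns into a negligible
  difference.\<close>

lemma gen_map_eq_if_point_values_eq:
  fixes A :: "('m::t2_space, 'e::{real_inner, heine_borel}) atlas"
    and B :: "('n::t2_space, 'f::{real_inner, heine_borel}) atlas"
  assumes M: "smooth_manifold A" and N: "smooth_manifold B"
    and g: "riemannian_metric A g" and h: "riemannian_metric B h"
    and U: "U \<in> gen_maps A B" and V: "V \<in> gen_maps A B"
    and pv: "\<And>X. X \<in> gen_points A g \<Longrightarrow> near_standard X \<Longrightarrow>
      point_value (gen_point_rel B h) U X = point_value (gen_point_rel B h) V X"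
  shows "U = V"
proof -
  have A: "smooth_atlas A" and B: "smooth_atlas B"
    using M N unfolding smooth_manifold_def by auto
  note eq = equiv_gen_map_rel[OF A, of B]
  obtain u where u: "u \<in> moderate_maps A B" "U = gen_map_rel A B `` {u}"
    using U unfolding gen_maps_def by (rule quotientE)
  obtain v where v: "v \<in> moderate_maps A B" "V = gen_map_rel A B `` {v}"
    using V unfolding gen_maps_def by (rule quotientE)
  have "(\<lambda>\<epsilon> x. f (u \<epsilon> x) - f (v \<epsilon> x)) \<in> negligible_functions A" if f: "f \<in> smooth_functions B" for f
  proof -
    have fu: "(\<lambda>\<epsilon> x. f (u \<epsilon> x)) \<in> moderate_functions A" and fv: "(\<lambda>\<epsilon> x. f (v \<epsilon> x)) \<in> moderate_functions A"
      using u(1) v(1) f unfolding moderate_maps_def by (auto simp: o_def)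
    let ?w = "\<lambda>\<epsilon> x. f (u \<epsilon> x) - f (v \<epsilon> x)"
    have w: "?w \<in> moderate_functions A" by (rule moderate_functions_diff[OF A fu fv])
    have "negligible_net (\<lambda>\<epsilon>. sup_abs_on K (?w \<epsilon>))" if K: "compact K" for K
    proof (rule ccontr)
      assume "\<not> ?thesis"
      then obtain x p where x: "\<forall>\<epsilon>. x \<epsilon> \<in> K" "(x \<longlongrightarrow> p) (at_right 0)"
          and nn: "\<not> negligible_net (\<lambda>\<epsilon>. ?w \<epsilon> (x \<epsilon>))"
        by (rule not_negligible_near_standard[OF A K _ ballI[OF moderate_functions_continuous[OF A w]]])
      have cs: "x \<in> compactly_supported_nets"
        unfolding compactly_supported_nets_def using K x(1) by auto
      let ?X = "gen_point_rel A g `` {x}" and ?y = "\<lambda>\<epsilon>. u \<epsilon> (x \<epsilon>)"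
      \<comment> \<open>c-boundedness keeps the values of \<open>u\<close> along \<open>x\<close> in
        a compact set, so they represent a generalized point.\<close>
      obtain K' where K': "compact K'" "\<forall>\<^sub>F \<epsilon> in at_right 0. u \<epsilon> ` K \<subseteq> K'"
        using u(1) K unfolding moderate_maps_def c_bounded_def by blast
      from K'(2) have "\<forall>\<^sub>F \<epsilon> in at_right 0. ?y \<epsilon> \<in> K'"
        by eventually_elim (use x(1) in blast)
      then have "?y \<in> compactly_supported_nets"
        unfolding compactly_supported_nets_def using K'(1) by blast
      then have "(?y, ?y) \<in> gen_point_rel B h" by (rule gen_point_rel_refl[OF B h])
      moreover have "u \<in> U" unfolding u(2) by (rule equiv_class_self[OF eq u(1)])
      moreover have "x \<in> ?X" using gen_point_rel_refl[OF A g cs] by simp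
      ultimately have "?y \<in> point_value (gen_point_rel B h) U ?X"
        unfolding point_value_def by blast
      then have "?y \<in> point_value (gen_point_rel B h) V ?X"
        using pv[OF near_standard_class[OF M g cs x(2)]] by simp
      \<comment> \<open>The union over representatives only yields some \<open>v'\<close> and
        \<open>x'\<close>; the way back to \<open>v\<close> and \<open>x\<close> takes two further
        negligible differences.\<close>
      then obtain v' x' where v': "v' \<in> V" and x': "x' \<in> ?X"
          and y: "(\<lambda>\<epsilon>. v' \<epsilon> (x' \<epsilon>), ?y) \<in> gen_point_rel B h"
        unfolding point_value_def by blast
      have cs': "x' \<in> compactly_supported_nets"
        and d: "negligible_net (\<lambda>\<epsilon>. riemannian_dist A g (x \<epsilon>) (x' \<epsilon>))"
        using x' unfolding gen_point_rel_def by auto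
      have "negligible_net (\<lambda>\<epsilon>. f (v' \<epsilon> (x' \<epsilon>)) - f (?y \<epsilon>))"
        by (rule smooth_function_negligible[OF N h f]) (use y in \<open>auto simp: gen_point_rel_def\<close>)
      moreover have "(\<lambda>\<epsilon> x. f (v \<epsilon> x) - f (v' \<epsilon> x)) \<in> negligible_functions A"
        using v' f unfolding v(2) gen_map_rel_def by blast
      then have "negligible_net (\<lambda>\<epsilon>. f (v \<epsilon> (x' \<epsilon>)) - f (v' \<epsilon> (x' \<epsilon>)))"
        by (rule negligible_point_value[OF A _ cs'])
      moreover have "negligible_net (\<lambda>\<epsilon>. f (v \<epsilon> (x \<epsilon>)) - f (v \<epsilon> (x' \<epsilon>)))"
        by (rule moderate_function_negligible[OF M g fv x(2) d])
      \<comment> \<open>The sum telescopes to the negative of \<open>?w\<close> along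
        \<open>x\<close>.\<close>
      ultimately have "negligible_net (\<lambda>\<epsilon>. (f (v' \<epsilon> (x' \<epsilon>)) - f (?y \<epsilon>)) +
          ((f (v \<epsilon> (x' \<epsilon>)) - f (v' \<epsilon> (x' \<epsilon>))) + (f (v \<epsilon> (x \<epsilon>)) - f (v \<epsilon> (x' \<epsilon>)))))"
        by (intro negligible_net_add)
      then have "negligible_net (\<lambda>\<epsilon>. ?w \<epsilon> (x \<epsilon>))"
        by (rule negligible_net_mono) (rule always_eventually, simp add: abs_minus_commute)
      with nn show False by contradiction
    qed
    with w show ?thesis unfolding negligible_functions_def by simp
  qed
  then have "(u, v) \<in> gen_map_rel A B"
    using u(1) v(1) unfolding gen_map_rel_def by simp
  then show ?thesis
    unfolding u(2) v(2) by (rule equiv_class_eq[OF eq])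
qed

theorem proposition4p2:
  fixes M :: "('m::t2_space, 'e::{real_inner, heine_borel}) atlas"
    and N :: "('n::t2_space, 'f::{real_inner, heine_borel}) atlas"
    and g :: "('m, 'e) metric_tensor"
    and h :: "('n, 'f) metric_tensor"
  assumes "smooth_manifold M" and "smooth_manifold N"
    and "riemannian_metric M g" and "riemannian_metric N h"
  shows "(\<forall>u\<in>gen_functions M.
            u = gen_function_zero M \<longleftrightarrow>
            (\<forall>x\<in>gen_points M g. near_standard x \<longrightarrow>
               point_value gen_number_rel u x = gen_number_zero)) \<and>
         (\<forall>u\<in>gen_maps M N. \<forall>v\<in>gen_maps M N.
            u = v \<longleftrightarrow>
            (\<forall>x\<in>gen_points M g. near_standard x \<longrightarrow>
               point_value (gen_point_rel N h) u x = point_value (gen_point_rel N h) v x))"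
proof (intro conjI ballI)
  show "u = gen_function_zero M \<longleftrightarrow>
      (\<forall>x\<in>gen_points M g. near_standard x \<longrightarrow> point_value gen_number_rel u x = gen_number_zero)"
    if "u \<in> gen_functions M" for u
    by (rule gen_function_point_values[OF assms(1,3) that])
  show "u = v \<longleftrightarrow> (\<forall>x\<in>gen_points M g. near_standard x \<longrightarrow>
      point_value (gen_point_rel N h) u x = point_value (gen_point_rel N h) v x)"
    if "u \<in> gen_maps M N" "v \<in> gen_maps M N" for u v
    using gen_map_eq_if_point_values_eq[OF assms that] by blast
qed

end
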